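(* (1) The affine complex curve $\mathbb{A}^1_{\mathbb{C}}\setminus \{0\}$ has exactly three equivalence classes of real structures, namely those of \[\rho_1\colon x\mapsto \overline{x},\quad \rho_2\colon x\mapsto \overline{x}^{-1},\quad \rho_3\colon x\mapsto -\overline{x}^{-1}.\] The corresponding real forms of $\mathbb{A}^1_{\mathbb{C}}\setminus \{0\}$ are the three affine conics $\Gamma_1,\Gamma_2,\Gamma_3\subset \mathbb{A}^2_{\mathbb{R}}$ given respectively by \[xy-1=0,\quad x^2+y^2-1=0,\quad x^2+y^2+1=0,\] whose real parts are diffeomorphic to $\Gamma_1(\mathbb{R})\simeq \mathbb{R}^*$, $\Gamma_2(\mathbb{R})\simeq \mathbb{S}^1$ and $\Gamma_3(\mathbb{R})=\varnothing$, respectively. (2) The affine complex surface $(\mathbb{A}^1_{\mathbb{C}}\setminus \{0\})^2$ has exactly six isomorphism classes of real forms, namely those of \[\Gamma_1 \times \Gamma_1,\ \Gamma_1\times \Gamma_2,\ \Gamma_1\times \Gamma_3,\ \Gamma_2\times \Gamma_2,\ \Gamma_3\times \Gamma_3\ \text{ and }\ \mathbb{A}^2_{\mathbb{R}}\setminus \{x^2+y^2=0\}.\] (Moreover, $\Gamma_2\times \Gamma_3$ is isomorphic to $\Gamma_3\times \Gamma_3$.)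
   Context: A real structure on a complex algebraic variety $X$ is an anti-regular involution $\rho\colon X\to X$, i.e. a morphism of schemes with $\rho\circ\rho=\mathrm{id}_X$ lying over the morphism of $\mathrm{Spec}(\mathbb{C})$ induced by complex conjugation. Two real structures $\rho,\rho'$ on $X$ are equivalent if $\rho'=\alpha^{-1}\circ\rho\circ\alpha$ for some $\alpha\in\mathrm{Aut}_{\mathbb{C}}(X)$. A real form of $X$ is a real algebraic variety $X_0$ together with a $\mathbb{C}$-isomorphism $X_0\times_{\mathrm{Spec}(\mathbb{R})}\mathrm{Spec}(\mathbb{C})\to X$; the real form corresponding to a real structure $\rho$ is the quotient $X/\langle\rho\rangle$. Isomorphism classes of real forms are taken up to isomorphism over $\mathbb{R}$. Here products are over $\mathrm{Spec}(\mathbb{R})$. *)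

theory Defs
  imports "HOL-Analysis.Analysis" "HOL-Library.FuncSet"
begin

text \<open>
  Real and complex algebraic varieties are treated as abstract varieties over a subfield
  K of the universal domain \<open>\<complex>\<close> (Weil), with K = UNIV (complex varieties)
  or K = \<open>\<real>\<close> (real varieties).  A K-variety is a set of points, always the
  complex points, with a finite atlas of charts onto locally closed subsets of affine
  spaces that are cut out by polynomials with coefficients in K and glued by transition maps that
  are regular over K; its topology and structure sheaf are those over K.

  A real variety is thus a reduced separated scheme of finite type over \<open>\<real>\<close>,
  described through its set of complex points.  The closed points of the scheme are the pairs of
  complex conjugate points; real points are the self-conjugate ones, and there may be none.
  The base change of a real variety to \<open>\<complex>\<close> is the same atlas, considered
  over UNIV.
\<close>


section \<open>Affine space and regular functions\<close>

text \<open>Points of affine n-space are coordinate lists of length n.\<close>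

definition affine_space :: "nat \<Rightarrow> complex list set" where
  "affine_space n = {p. length p = n}"

text \<open>Polynomial functions in n variables with coefficients in K.\<close>

inductive_set polys :: "complex set \<Rightarrow> nat \<Rightarrow> (complex list \<Rightarrow> complex) set"
  for K :: "complex set" and n :: nat where
  const: "a \<in> K \<Longrightarrow> (\<lambda>p. a) \<in> polys K n"
| coord: "i < n \<Longrightarrow> (\<lambda>p. p ! i) \<in> polys K n"
| add: "P \<in> polys K n \<Longrightarrow> Q \<in> polys K n \<Longrightarrow> (\<lambda>p. P p + Q p) \<in> polys K n"
| mult: "P \<in> polys K n \<Longrightarrow> Q \<in> polys K n \<Longrightarrow> (\<lambda>p. P p * Q p) \<in> polys K n"

text \<open>Relatively closed and relatively open subsets of Z in the K-Zariski topology.\<close>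

definition zclosed_in :: "complex set \<Rightarrow> nat \<Rightarrow> complex list set \<Rightarrow> complex list set \<Rightarrow> bool" where
  "zclosed_in K n Z W \<longleftrightarrow> (\<exists>S \<subseteq> polys K n. W = {p \<in> Z. \<forall>P\<in>S. P p = 0})"

definition zopen_in :: "complex set \<Rightarrow> nat \<Rightarrow> complex list set \<Rightarrow> complex list set \<Rightarrow> bool" where
  "zopen_in K n Z W \<longleftrightarrow> W \<subseteq> Z \<and> zclosed_in K n Z (Z - W)"

definition locally_closed :: "complex set \<Rightarrow> nat \<Rightarrow> complex list set \<Rightarrow> bool" where
  "locally_closed K n Z \<longleftrightarrow>
     (\<exists>Y. zclosed_in K n (affine_space n) Y \<and> zopen_in K n Y Z)"

definition regular_on ::
  "complex set \<Rightarrow> nat \<Rightarrow> complex list set \<Rightarrow> (complex list \<Rightarrow> complex) \<Rightarrow> bool" where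
  "regular_on K n Z f \<longleftrightarrow>
     (\<forall>p\<in>Z. \<exists>P\<in>polys K n. \<exists>Q\<in>polys K n. Q p \<noteq> 0 \<and>
        (\<forall>q\<in>Z. Q q \<noteq> 0 \<longrightarrow> f q = P q / Q q))"


section \<open>Varieties\<close>

record 'a chart =
  cdom :: "'a set"
  cdim :: nat
  ccoord :: "'a \<Rightarrow> complex list"

definition cinv :: "'a chart \<Rightarrow> complex list \<Rightarrow> 'a" where
  "cinv c = inv_into (cdom c) (ccoord c)"

definition points :: "'a chart set \<Rightarrow> 'a set" where
  "points X = (\<Union>c\<in>X. cdom c)"

text \<open>The last conjunct says that the diagonal is closed (separatedness); points of the product of
  two charts are represented by concatenated lists.\<close>

definition variety :: "complex set \<Rightarrow> 'a chart set \<Rightarrow> bool" where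
  "variety K X \<longleftrightarrow> finite X \<and>
     (\<forall>c\<in>X. inj_on (ccoord c) (cdom c) \<and> locally_closed K (cdim c) (ccoord c ` cdom c)) \<and>
     (\<forall>c\<in>X. \<forall>d\<in>X.
        zopen_in K (cdim c) (ccoord c ` cdom c) (ccoord c ` (cdom c \<inter> cdom d)) \<and>
        (\<forall>i<cdim d. regular_on K (cdim c) (ccoord c ` (cdom c \<inter> cdom d))
                       (\<lambda>p. ccoord d (cinv c p) ! i)) \<and>
        zclosed_in K (cdim c + cdim d)
          {ccoord c x @ ccoord d y | x y. x \<in> cdom c \<and> y \<in> cdom d}
          {ccoord c x @ ccoord d x | x. x \<in> cdom c \<inter> cdom d})"

definition variety_open :: "complex set \<Rightarrow> 'a chart set \<Rightarrow> 'a set \<Rightarrow> bool" where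
  "variety_open K X V \<longleftrightarrow> V \<subseteq> points X \<and>
     (\<forall>c\<in>X. zopen_in K (cdim c) (ccoord c ` cdom c) (ccoord c ` (V \<inter> cdom c)))"

text \<open>The sections over the open set V of the structure sheaf of the K-variety X.\<close>

definition regular_fun :: "complex set \<Rightarrow> 'a chart set \<Rightarrow> 'a set \<Rightarrow> ('a \<Rightarrow> complex) \<Rightarrow> bool" where
  "regular_fun K X V f \<longleftrightarrow>
     (\<forall>c\<in>X. regular_on K (cdim c) (ccoord c ` (V \<inter> cdom c)) (\<lambda>p. f (cinv c p)))"

definition preimage :: "'a chart set \<Rightarrow> ('a \<Rightarrow> 'b) \<Rightarrow> 'b set \<Rightarrow> 'a set" where
  "preimage X \<phi> V = {x \<in> points X. \<phi> x \<in> V}"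

text \<open>Morphisms of K-varieties.  Only the values on \<open>points X\<close> matter.\<close>

definition regular_map :: "complex set \<Rightarrow> 'a chart set \<Rightarrow> 'b chart set \<Rightarrow> ('a \<Rightarrow> 'b) \<Rightarrow> bool" where
  "regular_map K X Y \<phi> \<longleftrightarrow> \<phi> ` points X \<subseteq> points Y \<and>
     (\<forall>V. variety_open K Y V \<longrightarrow> variety_open K X (preimage X \<phi> V) \<and>
        (\<forall>f. regular_fun K Y V f \<longrightarrow> regular_fun K X (preimage X \<phi> V) (\<lambda>x. f (\<phi> x))))"

definition isomorphism :: "complex set \<Rightarrow> 'a chart set \<Rightarrow> 'b chart set \<Rightarrow> ('a \<Rightarrow> 'b) \<Rightarrow> bool" where
  "isomorphism K X Y \<phi> \<longleftrightarrow> bij_betw \<phi> (points X) (points Y) \<and>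
     regular_map K X Y \<phi> \<and> regular_map K Y X (inv_into (points X) \<phi>)"

definition isomorphic :: "complex set \<Rightarrow> 'a chart set \<Rightarrow> 'b chart set \<Rightarrow> bool" where
  "isomorphic K X Y \<longleftrightarrow> (\<exists>\<phi>. isomorphism K X Y \<phi>)"

definition embedded :: "nat \<Rightarrow> complex list set \<Rightarrow> complex list chart set" where
  "embedded n Z = {\<lparr>cdom = Z, cdim = n, ccoord = (\<lambda>p. p)\<rparr>}"

text \<open>The product over the ground field: the complex points of the fibre product over
  \<open>Spec \<real>\<close> are the pairs of complex points.\<close>

definition variety_prod :: "'a chart set \<Rightarrow> 'b chart set \<Rightarrow> ('a \<times> 'b) chart set" where
  "variety_prod X Y =
     {\<lparr>cdom = cdom c \<times> cdom d, cdim = cdim c + cdim d,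
       ccoord = (\<lambda>(x, y). ccoord c x @ ccoord d y)\<rparr> | c d. c \<in> X \<and> d \<in> Y}"


section \<open>Real structures\<close>

text \<open>A morphism over the complex conjugation of \<open>Spec \<complex>\<close>: its action on
  structure sheaves sends f to the complex conjugate of \<open>f \<circ> \<phi>\<close>, which is
  conjugate-linear.\<close>

definition anti_regular_map :: "'a chart set \<Rightarrow> 'b chart set \<Rightarrow> ('a \<Rightarrow> 'b) \<Rightarrow> bool" where
  "anti_regular_map X Y \<phi> \<longleftrightarrow> \<phi> ` points X \<subseteq> points Y \<and>
     (\<forall>V. variety_open UNIV Y V \<longrightarrow> variety_open UNIV X (preimage X \<phi> V) \<and>
        (\<forall>f. regular_fun UNIV Y V f \<longrightarrow>
           regular_fun UNIV X (preimage X \<phi> V) (\<lambda>x. cnj (f (\<phi> x)))))"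

text \<open>Extensionality makes equality of real structures the equality on \<open>points X\<close>.\<close>

definition real_structures :: "'a chart set \<Rightarrow> ('a \<Rightarrow> 'a) set" where
  "real_structures X =
     {\<rho> \<in> extensional (points X). anti_regular_map X X \<rho> \<and> (\<forall>x\<in>points X. \<rho> (\<rho> x) = x)}"

definition real_structure_equiv :: "'a chart set \<Rightarrow> (('a \<Rightarrow> 'a) \<times> ('a \<Rightarrow> 'a)) set" where
  "real_structure_equiv X =
     {(\<rho>, \<rho>'). \<rho> \<in> real_structures X \<and> \<rho>' \<in> real_structures X \<and>
        (\<exists>\<alpha>. isomorphism UNIV X X \<alpha> \<and>
           (\<forall>x\<in>points X. \<rho>' x = inv_into (points X) \<alpha> (\<rho> (\<alpha> x))))}"


section \<open>Real forms\<close>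

definition real_form :: "'a chart set \<Rightarrow> 'b chart set \<Rightarrow> ('b \<Rightarrow> 'a) \<Rightarrow> bool" where
  "real_form X X0 \<phi> \<longleftrightarrow> variety \<real> X0 \<and> isomorphism UNIV X0 X \<phi>"

definition is_real_form :: "'a chart set \<Rightarrow> 'b chart set \<Rightarrow> bool" where
  "is_real_form X X0 \<longleftrightarrow> (\<exists>\<phi>. real_form X X0 \<phi>)"

text \<open>Complex conjugation on the points of a real variety; it does not depend on the chart since
  transition maps are defined over \<open>\<real>\<close>.\<close>

definition conj_point :: "'a chart set \<Rightarrow> 'a \<Rightarrow> 'a" where
  "conj_point X0 y =
     (THE z. \<exists>c\<in>X0. y \<in> cdom c \<and> z \<in> cdom c \<and> ccoord c z = map cnj (ccoord c y))"

definition closed_point :: "'a chart set \<Rightarrow> 'a \<Rightarrow> 'a set" where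
  "closed_point X0 y = {y, conj_point X0 y}"

definition real_points :: "'a chart set \<Rightarrow> 'a set" where
  "real_points X0 = {y \<in> points X0. conj_point X0 y = y}"

text \<open>A complex morphism \<open>\<pi>\<close> from X to the base change of the real variety X0 is the
  same as a morphism of \<open>\<real>\<close>-schemes from X to X0, whose effect on closed points is
  \<open>x \<mapsto> closed_point X0 (\<pi> x)\<close>.  It exhibits X0 as the quotient of X by
  \<open>\<rho>\<close> if it is the topological quotient (it is onto, its fibres are the orbits and X0
  has the quotient topology; sets of closed points of X0 are represented by conjugation-stable
  sets of complex points) and the structure sheaf of X0 is the sheaf of invariants of the action
  \<open>f \<mapsto> cnj \<circ> f \<circ> \<rho>\<close> on the direct image of the structure sheaf
  of X.\<close>

definition is_quotient :: "'a chart set \<Rightarrow> ('a \<Rightarrow> 'a) \<Rightarrow> 'b chart set \<Rightarrow> ('a \<Rightarrow> 'b) \<Rightarrow> bool" where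
  "is_quotient X \<rho> X0 \<pi> \<longleftrightarrow> variety \<real> X0 \<and> regular_map UNIV X X0 \<pi> \<and>
     (\<forall>y\<in>points X0. \<exists>x\<in>points X. closed_point X0 (\<pi> x) = closed_point X0 y) \<and>
     (\<forall>x\<in>points X. \<forall>x'\<in>points X.
        closed_point X0 (\<pi> x) = closed_point X0 (\<pi> x') \<longleftrightarrow> x' = x \<or> x' = \<rho> x) \<and>
     (\<forall>V \<subseteq> points X0. conj_point X0 ` V \<subseteq> V \<longrightarrow>
        (variety_open \<real> X0 V \<longleftrightarrow> variety_open UNIV X (preimage X \<pi> V))) \<and>
     (\<forall>V. variety_open \<real> X0 V \<longrightarrow>
        bij_betw (\<lambda>f. restrict (\<lambda>x. f (\<pi> x)) (preimage X \<pi> V))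
          {f \<in> extensional V. regular_fun \<real> X0 V f}
          {g \<in> extensional (preimage X \<pi> V). regular_fun UNIV X (preimage X \<pi> V) g \<and>
             (\<forall>x\<in>preimage X \<pi> V. cnj (g (\<rho> x)) = g x)})"

definition corresponding_real_form :: "'a chart set \<Rightarrow> ('a \<Rightarrow> 'a) \<Rightarrow> 'b chart set \<Rightarrow> bool" where
  "corresponding_real_form X \<rho> X0 \<longleftrightarrow>
     (\<exists>\<phi>. real_form X X0 \<phi> \<and> is_quotient X \<rho> X0 (inv_into (points X0) \<phi>))"


section \<open>Diffeomorphisms between subsets of Euclidean spaces\<close>

primrec Ck_on ::
  "nat \<Rightarrow> ('a::euclidean_space \<Rightarrow> 'b::euclidean_space) \<Rightarrow> 'a set \<Rightarrow> bool" where
  "Ck_on 0 f U = continuous_on U f"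
| "Ck_on (Suc k) f U =
     ((\<forall>x\<in>U. f differentiable (at x)) \<and> (\<forall>v. Ck_on k (\<lambda>x. frechet_derivative f (at x) v) U))"

text \<open>A map on an arbitrary subset is smooth if it extends locally to a smooth map on an open
  set.\<close>

definition smooth_map_on ::
  "'a set \<Rightarrow> ('a::euclidean_space \<Rightarrow> 'b::euclidean_space) \<Rightarrow> bool" where
  "smooth_map_on S f \<longleftrightarrow>
     (\<forall>x\<in>S. \<exists>U g. open U \<and> x \<in> U \<and> (\<forall>k. Ck_on k g U) \<and> (\<forall>y\<in>S \<inter> U. g y = f y))"

definition diffeomorphic :: "'a::euclidean_space set \<Rightarrow> 'b::euclidean_space set \<Rightarrow> bool" where
  "diffeomorphic S T \<longleftrightarrow>
     (\<exists>f g. smooth_map_on S f \<and> smooth_map_on T g \<and> f ` S \<subseteq> T \<and> g ` T \<subseteq> S \<and>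
        (\<forall>x\<in>S. g (f x) = x) \<and> (\<forall>y\<in>T. f (g y) = y))"

text \<open>The real part of a plane real variety as a subset of the Euclidean plane.\<close>

definition plane_real_part :: "complex list chart set \<Rightarrow> (real \<times> real) set" where
  "plane_real_part X0 =
     {(a, b). [complex_of_real a, complex_of_real b] \<in> real_points X0}"


section \<open>The varieties and real structures in question\<close>

text \<open>The punctured affine line and its three real structures.\<close>

definition Gm :: "complex list chart set" where
  "Gm = embedded 1 {[x] | x. x \<noteq> 0}"

definition rho1 :: "complex list \<Rightarrow> complex list" where
  "rho1 = (\<lambda>p\<in>points Gm. [cnj (p ! 0)])"

definition rho2 :: "complex list \<Rightarrow> complex list" where
  "rho2 = (\<lambda>p\<in>points Gm. [inverse (cnj (p ! 0))])"

definition rho3 :: "complex list \<Rightarrow> complex list" where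
  "rho3 = (\<lambda>p\<in>points Gm. [- inverse (cnj (p ! 0))])"

definition Gamma1 :: "complex list chart set" where
  "Gamma1 = embedded 2 {[x, y] | x y. x * y - 1 = 0}"

definition Gamma2 :: "complex list chart set" where
  "Gamma2 = embedded 2 {[x, y] | x y. x\<^sup>2 + y\<^sup>2 - 1 = 0}"

definition Gamma3 :: "complex list chart set" where
  "Gamma3 = embedded 2 {[x, y] | x y. x\<^sup>2 + y\<^sup>2 + 1 = 0}"

text \<open>The complement in the affine plane of the real curve \<open>x\<^sup>2 + y\<^sup>2 = 0\<close>, whose
  complex points form two lines.\<close>

definition punctured_plane :: "complex list chart set" where
  "punctured_plane = embedded 2 {[x, y] | x y. x\<^sup>2 + y\<^sup>2 \<noteq> 0}"

end

theory Submission
  imports Defs "HOL-Computational_Algebra.Fundamental_Theorem_Algebra"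
begin

text \<open>
  Everything is reduced to one relation.  Two varieties with a self-map each are related if there is
  a complex isomorphism that intertwines the self-maps (\<open>equivariant_iso\<close>).  For two real
  structures on one variety this is equivalence.  For two real varieties with their conjugations
  it is isomorphism over \<open>\<real>\<close>, by Galois descent: a conjugation-stable complex equation
  \<open>A + \<i> B = 0\<close> amounts to the two real ones, and a conjugation-equivariant fraction
  can be rewritten with real coefficients (\<open>zclosed_in_descent\<close>,
  \<open>regular_on_descent\<close>).  The same descent shows that a real form is the quotient by
  the corresponding real structure.

  The geometric input is that a nowhere vanishing regular function on \<open>\<complex>\<^sup>*\<close> or
  on the torus \<open>(\<complex>\<^sup>*)\<^sup>2\<close> is a monomial.  In one variable a reduced fraction
  without zeros and poles off the origin is a monomial by the fundamental theorem of algebra; in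
  two variables the result follows by restriction to horizontal and vertical lines.  Hence
  every real structure on the line has the form \<open>x \<mapsto> a x\<^sup>n\<close> after conjugation, with
  \<open>n = 1\<close> and \<open>\<bar>a\<bar> = 1\<close> or \<open>n = - 1\<close> and \<open>a\<close> real,
  and rescaling \<open>x\<close> leaves three normal forms.  The exponent separates the first form from
  the others, and the existence of a fixed point separates these two.

  On the torus a real structure consists of two constants and an integral exponent matrix, which is
  an involution.  Up to conjugation in the general linear group over the integers such a matrix is
  \<open>\<plusminus> 1\<close>, \<open>diag (1, - 1)\<close> or the exchange of the coordinates
  (\<open>integral_involution_normal_form\<close>), and a monomial change of coordinates
  realises the conjugation.  In the diagonal cases the structure is a product of two
  one-dimensional ones, which gives the products of conics; the coordinate change
  \<open>(x y, y)\<close> identifies the signs \<open>(1, - 1)\<close> and \<open>(- 1, - 1)\<close> for the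
  matrix \<open>- 1\<close>.  The exchange is the conjugation of the plane without the curve
  \<open>x\<^sup>2 + y\<^sup>2 = 0\<close> in the coordinates \<open>x \<plusminus> \<i> y\<close>.
  The six forms are distinguished by the conjugacy class of the exponent matrix and, within one
  class, by the existence of real points.
\<close>

section \<open>Polynomial and regular functions\<close>

lemma polys_mono:
  assumes "P \<in> polys K n" "K \<subseteq> K'"
  shows "P \<in> polys K' n"
  using assms(1)
proof induction
  case (const a)
  then show ?case using assms(2) by (intro polys.const) auto
qed (rule polys.intros; assumption)+

lemma polys_compose:
  assumes "P \<in> polys K m" "\<And>i. i < m \<Longrightarrow> (\<lambda>q. F q ! i) \<in> polys K n"
  shows "(\<lambda>q. P (F q)) \<in> polys K n"
  using assms(1)
proof induction
  case (coord i)
  then show ?case by (rule assms(2))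
qed (rule polys.const polys.add polys.mult; assumption)+

lemma regular_onD:
  assumes "regular_on K n Z f" "p \<in> Z"
  obtains P Q where "P \<in> polys K n" "Q \<in> polys K n" "Q p \<noteq> 0"
    "\<forall>q\<in>Z. Q q \<noteq> 0 \<longrightarrow> f q = P q / Q q"
proof -
  from assms have "\<exists>P\<in>polys K n. \<exists>Q\<in>polys K n. Q p \<noteq> 0 \<and> (\<forall>q\<in>Z. Q q \<noteq> 0 \<longrightarrow> f q = P q / Q q)"
    unfolding regular_on_def by (rule bspec)
  then show thesis by (elim bexE conjE) (rule that)
qed

lemma regular_onI:
  assumes "\<And>p. p \<in> Z \<Longrightarrow> \<exists>P\<in>polys K n. \<exists>Q\<in>polys K n. Q p \<noteq> 0 \<and>
        (\<forall>q\<in>Z. Q q \<noteq> 0 \<longrightarrow> f q = P q / Q q)"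
  shows "regular_on K n Z f"
  using assms unfolding regular_on_def by blast

lemma regular_on_cong:
  assumes "Z = Z'" "\<And>p. p \<in> Z' \<Longrightarrow> f p = g p"
  shows "regular_on K n Z f \<longleftrightarrow> regular_on K n Z' g"
  using assms unfolding regular_on_def by auto

lemma regular_on_mono_field:
  assumes "regular_on K n Z f" "K \<subseteq> K'"
  shows "regular_on K' n Z f"
proof (rule regular_onI)
  fix p assume "p \<in> Z"
  then show "\<exists>P\<in>polys K' n. \<exists>Q\<in>polys K' n. Q p \<noteq> 0 \<and> (\<forall>q\<in>Z. Q q \<noteq> 0 \<longrightarrow> f q = P q / Q q)"
    by (rule regular_onD[OF assms(1)]) (use polys_mono[OF _ assms(2)] in blast)
qed

lemma regular_on_poly:
  assumes "1 \<in> K" "P \<in> polys K n"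
  shows "regular_on K n Z P"
proof (rule regular_onI)
  fix p
  show "\<exists>Pa\<in>polys K n. \<exists>Q\<in>polys K n. Q p \<noteq> 0 \<and> (\<forall>q\<in>Z. Q q \<noteq> 0 \<longrightarrow> P q = Pa q / Q q)"
    using assms by (intro bexI[of _ P] bexI[of _ "\<lambda>_. 1"]) (auto intro: polys.intros)
qed

lemma regular_on_const: "1 \<in> K \<Longrightarrow> a \<in> K \<Longrightarrow> regular_on K n Z (\<lambda>_. a)"
  by (intro regular_on_poly polys.const)

lemma regular_on_coord: "1 \<in> K \<Longrightarrow> i < n \<Longrightarrow> regular_on K n Z (\<lambda>p. p ! i)"
  by (intro regular_on_poly polys.coord)

lemma regular_on_add:
  assumes "regular_on K n Z f" "regular_on K n Z g"
  shows "regular_on K n Z (\<lambda>p. f p + g p)"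
proof (rule regular_onI)
  fix p assume p: "p \<in> Z"
  obtain P Q where 1: "P \<in> polys K n" "Q \<in> polys K n" "Q p \<noteq> 0"
    "\<forall>q\<in>Z. Q q \<noteq> 0 \<longrightarrow> f q = P q / Q q" by (rule regular_onD[OF assms(1) p])
  obtain P' Q' where 2: "P' \<in> polys K n" "Q' \<in> polys K n" "Q' p \<noteq> 0"
    "\<forall>q\<in>Z. Q' q \<noteq> 0 \<longrightarrow> g q = P' q / Q' q" by (rule regular_onD[OF assms(2) p])
  show "\<exists>P\<in>polys K n. \<exists>Q\<in>polys K n. Q p \<noteq> 0 \<and> (\<forall>q\<in>Z. Q q \<noteq> 0 \<longrightarrow> f q + g q = P q / Q q)"
    by (rule bexI[of _ "\<lambda>q. P q * Q' q + P' q * Q q"], rule bexI[of _ "\<lambda>q. Q q * Q' q"])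
      (use 1 2 in \<open>auto intro!: polys.add polys.mult simp: field_simps\<close>)
qed

lemma regular_on_mult:
  assumes "regular_on K n Z f" "regular_on K n Z g"
  shows "regular_on K n Z (\<lambda>p. f p * g p)"
proof (rule regular_onI)
  fix p assume p: "p \<in> Z"
  obtain P Q where 1: "P \<in> polys K n" "Q \<in> polys K n" "Q p \<noteq> 0"
    "\<forall>q\<in>Z. Q q \<noteq> 0 \<longrightarrow> f q = P q / Q q" by (rule regular_onD[OF assms(1) p])
  obtain P' Q' where 2: "P' \<in> polys K n" "Q' \<in> polys K n" "Q' p \<noteq> 0"
    "\<forall>q\<in>Z. Q' q \<noteq> 0 \<longrightarrow> g q = P' q / Q' q" by (rule regular_onD[OF assms(2) p])
  show "\<exists>P\<in>polys K n. \<exists>Q\<in>polys K n. Q p \<noteq> 0 \<and> (\<forall>q\<in>Z. Q q \<noteq> 0 \<longrightarrow> f q * g q = P q / Q q)"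
    by (rule bexI[of _ "\<lambda>q. P q * P' q"], rule bexI[of _ "\<lambda>q. Q q * Q' q"])
      (use 1 2 in \<open>auto intro!: polys.mult\<close>)
qed

lemma regular_on_inverse:
  assumes "regular_on K n Z f" "\<And>p. p \<in> Z \<Longrightarrow> f p \<noteq> 0"
  shows "regular_on K n Z (\<lambda>p. inverse (f p))"
proof (rule regular_onI)
  fix p assume p: "p \<in> Z"
  obtain P Q where 1: "P \<in> polys K n" "Q \<in> polys K n" "Q p \<noteq> 0"
    "\<forall>q\<in>Z. Q q \<noteq> 0 \<longrightarrow> f q = P q / Q q" by (rule regular_onD[OF assms(1) p])
  have "P p \<noteq> 0" using 1 p assms(2)[OF p] by auto
  then show "\<exists>P\<in>polys K n. \<exists>Q\<in>polys K n. Q p \<noteq> 0 \<and> (\<forall>q\<in>Z. Q q \<noteq> 0 \<longrightarrow> inverse (f q) = P q / Q q)"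
    by (intro bexI[of _ "\<lambda>q. Q q * Q q"] bexI[of _ "\<lambda>q. P q * Q q"])
      (use 1 in \<open>auto intro!: polys.mult\<close>)
qed

lemma regular_on_power:
  assumes "1 \<in> K" "regular_on K n Z f"
  shows "regular_on K n Z (\<lambda>p. f p ^ k)"
proof (induction k)
  case 0
  then show ?case using regular_on_const[OF assms(1) assms(1)] by simp
next
  case (Suc k)
  then show ?case using regular_on_mult[OF assms(2) Suc] by simp
qed

lemma regular_on_power_int:
  assumes "1 \<in> K" "regular_on K n Z f" "\<And>p. p \<in> Z \<Longrightarrow> f p \<noteq> 0"
  shows "regular_on K n Z (\<lambda>p. f p powi k)"
proof (cases "k \<ge> 0")
  case True
  then show ?thesis using assms by (simp add: power_int_def regular_on_power)
next
  case False
  then show ?thesis using assms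
    by (simp add: power_int_def regular_on_power regular_on_inverse flip: power_inverse)
qed

lemma regular_on_compose_poly:
  assumes "1 \<in> K" "P \<in> polys K m" "\<And>i. i < m \<Longrightarrow> regular_on K n Z (\<lambda>q. F q ! i)"
  shows "regular_on K n Z (\<lambda>q. P (F q))"
  using assms(2)
proof induction
  case (const a)
  then show ?case using assms(1) by (intro regular_on_const)
next
  case (coord i)
  then show ?case by (rule assms(3))
qed (rule regular_on_add regular_on_mult; assumption)+

text \<open>A function that is locally \<open>P / Q\<close> vanishes exactly where all the products
  \<open>P * Q\<close> of its local representations do; the factor \<open>Q\<close> takes care of the points
  where a representation says nothing.\<close>

lemma zclosed_in_zeros_of_regular:
  assumes "\<And>f. f \<in> T \<Longrightarrow> regular_on K n Z f"
  shows "zclosed_in K n Z {p \<in> Z. \<forall>f\<in>T. f p = 0}"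
proof -
  define S where "S = {\<lambda>q. P q * Q q | P Q. P \<in> polys K n \<and> Q \<in> polys K n \<and>
    (\<exists>f\<in>T. \<forall>q\<in>Z. Q q \<noteq> 0 \<longrightarrow> f q = P q / Q q)}"
  have "S \<subseteq> polys K n" unfolding S_def by (auto intro: polys.mult)
  moreover have "(\<forall>f\<in>T. f p = 0) \<longleftrightarrow> (\<forall>R\<in>S. R p = 0)" if p: "p \<in> Z" for p
  proof
    assume "\<forall>f\<in>T. f p = 0"
    then show "\<forall>R\<in>S. R p = 0" using p unfolding S_def by fastforce
  next
    assume R: "\<forall>R\<in>S. R p = 0"
    show "\<forall>f\<in>T. f p = 0"
    proof
      fix f assume f: "f \<in> T"
      obtain P Q where 1: "P \<in> polys K n" "Q \<in> polys K n" "Q p \<noteq> 0"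
        "\<forall>q\<in>Z. Q q \<noteq> 0 \<longrightarrow> f q = P q / Q q" by (rule regular_onD[OF assms[OF f] p])
      have "(\<lambda>q. P q * Q q) \<in> S" unfolding S_def using 1 f by blast
      then have "P p * Q p = 0" by (rule bspec[OF R])
      then show "f p = 0" using 1(3,4) p by simp
    qed
  qed
  ultimately show ?thesis unfolding zclosed_in_def by (intro exI[of _ S]) auto
qed

lemma zopen_in_whole:
  assumes "1 \<in> K"
  shows "zopen_in K n Z Z"
  unfolding zopen_in_def zclosed_in_def
  by (intro conjI subset_refl exI[of _ "{\<lambda>_. 1}"]) (use assms in \<open>auto intro: polys.const\<close>)

lemma zopen_in_mono_field:
  assumes "zopen_in K n Z W" "K \<subseteq> K'"
  shows "zopen_in K' n Z W"
proof -
  obtain S where "W \<subseteq> Z" "S \<subseteq> polys K n" "Z - W = {p \<in> Z. \<forall>P\<in>S. P p = 0}"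
    using assms(1) unfolding zopen_in_def zclosed_in_def by blast
  moreover from this have "S \<subseteq> polys K' n" using polys_mono[OF _ assms(2)] by blast
  ultimately show ?thesis unfolding zopen_in_def zclosed_in_def by blast
qed


section \<open>Morphisms\<close>

lemma cinv_mem: "p \<in> ccoord c ` cdom c \<Longrightarrow> cinv c p \<in> cdom c"
  unfolding cinv_def by (rule inv_into_into)

lemma ccoord_cinv: "p \<in> ccoord c ` cdom c \<Longrightarrow> ccoord c (cinv c p) = p"
  unfolding cinv_def by (rule f_inv_into_f)

lemma cinv_ccoord: "inj_on (ccoord c) (cdom c) \<Longrightarrow> x \<in> cdom c \<Longrightarrow> cinv c (ccoord c x) = x"
  unfolding cinv_def by (rule inv_into_f_f)

lemma points_single [simp]: "points {c} = cdom c"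
  by (simp add: points_def)

lemma variety_open_points:
  assumes "1 \<in> K"
  shows "variety_open K X (points X)"
proof -
  have "points X \<inter> cdom c = cdom c" if "c \<in> X" for c using that by (auto simp: points_def)
  then show ?thesis unfolding variety_open_def by (simp add: zopen_in_whole assms)
qed

lemma regular_fun_cong:
  assumes "\<And>x. x \<in> points X \<Longrightarrow> f x = g x"
  shows "regular_fun K X V f \<longleftrightarrow> regular_fun K X V g"
proof -
  have "regular_on K (cdim c) (ccoord c ` (V \<inter> cdom c)) (\<lambda>p. f (cinv c p)) \<longleftrightarrow>
    regular_on K (cdim c) (ccoord c ` (V \<inter> cdom c)) (\<lambda>p. g (cinv c p))" if "c \<in> X" for c
  proof (rule regular_on_cong[OF refl])
    fix p assume "p \<in> ccoord c ` (V \<inter> cdom c)"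
    then have "cinv c p \<in> cdom c" by (intro cinv_mem) auto
    then show "f (cinv c p) = g (cinv c p)" using that assms by (auto simp: points_def)
  qed
  then show ?thesis unfolding regular_fun_def by blast
qed

lemma preimage_points: "\<phi> ` points X \<subseteq> points Y \<Longrightarrow> preimage X \<phi> (points Y) = points X"
  by (auto simp: preimage_def)

lemma preimage_compose:
  "\<phi> ` points X \<subseteq> points Y \<Longrightarrow> preimage X (\<lambda>x. \<psi> (\<phi> x)) V = preimage X \<phi> (preimage Y \<psi> V)"
  by (auto simp: preimage_def)

lemma preimage_cong:
  "(\<And>x. x \<in> points X \<Longrightarrow> \<phi> x = \<psi> x) \<Longrightarrow> preimage X \<phi> V = preimage X \<psi> V"
  by (auto simp: preimage_def)

lemma regular_map_cong:
  assumes "\<And>x. x \<in> points X \<Longrightarrow> \<phi> x = \<psi> x"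
  shows "regular_map K X Y \<phi> \<longleftrightarrow> regular_map K X Y \<psi>"
  unfolding regular_map_def
  using assms preimage_cong[of X \<phi> \<psi>] regular_fun_cong[of X "\<lambda>x. f (\<phi> x)" "\<lambda>x. f (\<psi> x)" for f]
  by (simp add: image_subset_iff)

lemma anti_regular_map_cong:
  assumes "\<And>x. x \<in> points X \<Longrightarrow> \<phi> x = \<psi> x"
  shows "anti_regular_map X Y \<phi> \<longleftrightarrow> anti_regular_map X Y \<psi>"
  unfolding anti_regular_map_def
  using assms preimage_cong[of X \<phi> \<psi>]
    regular_fun_cong[of X "\<lambda>x. cnj (f (\<phi> x))" "\<lambda>x. cnj (f (\<psi> x))" for f]
  by (simp add: image_subset_iff)

lemma regular_map_mem: "regular_map K X Y \<phi> \<Longrightarrow> x \<in> points X \<Longrightarrow> \<phi> x \<in> points Y"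
  unfolding regular_map_def by blast

lemma anti_regular_map_mem: "anti_regular_map X Y \<phi> \<Longrightarrow> x \<in> points X \<Longrightarrow> \<phi> x \<in> points Y"
  unfolding anti_regular_map_def by blast

lemma regular_map_id: "regular_map K X X (\<lambda>x. x)"
  unfolding regular_map_def
proof (intro conjI allI impI)
  fix V assume V: "variety_open K X V"
  then have eq: "preimage X (\<lambda>x. x) V = V" by (auto simp: preimage_def variety_open_def)
  show "variety_open K X (preimage X (\<lambda>x. x) V)" using V eq by simp
  show "regular_fun K X (preimage X (\<lambda>x. x) V) f" if "regular_fun K X V f" for f
    using that eq by simp
qed auto

lemma regular_map_compose:
  assumes "regular_map K X Y \<phi>" "regular_map K Y Z \<psi>"
  shows "regular_map K X Z (\<lambda>x. \<psi> (\<phi> x))"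
proof -
  have \<phi>: "\<phi> ` points X \<subseteq> points Y" using assms(1) unfolding regular_map_def by blast
  show ?thesis
    unfolding regular_map_def preimage_compose[OF \<phi>]
    using assms regular_map_mem[OF assms(1)] regular_map_mem[OF assms(2)]
    unfolding regular_map_def by blast
qed

lemma regular_anti_regular_compose:
  assumes "regular_map UNIV X Y \<phi>" "anti_regular_map Y Z \<psi>"
  shows "anti_regular_map X Z (\<lambda>x. \<psi> (\<phi> x))"
proof -
  have \<phi>: "\<phi> ` points X \<subseteq> points Y" using assms(1) unfolding regular_map_def by blast
  show ?thesis
    unfolding anti_regular_map_def preimage_compose[OF \<phi>]
    using assms regular_map_mem[OF assms(1)] anti_regular_map_mem[OF assms(2)]
    unfolding anti_regular_map_def regular_map_def by blast
qed

lemma anti_regular_regular_compose: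
  assumes "anti_regular_map X Y \<phi>" "regular_map UNIV Y Z \<psi>"
  shows "anti_regular_map X Z (\<lambda>x. \<psi> (\<phi> x))"
proof -
  have \<phi>: "\<phi> ` points X \<subseteq> points Y" using assms(1) unfolding anti_regular_map_def by blast
  show ?thesis
    unfolding anti_regular_map_def preimage_compose[OF \<phi>]
    using assms anti_regular_map_mem[OF assms(1)] regular_map_mem[OF assms(2)]
    unfolding anti_regular_map_def regular_map_def by blast
qed

lemma anti_regular_anti_regular_compose:
  assumes "anti_regular_map X Y \<phi>" "anti_regular_map Y Z \<psi>"
  shows "regular_map UNIV X Z (\<lambda>x. \<psi> (\<phi> x))"
proof -
  have \<phi>: "\<phi> ` points X \<subseteq> points Y" using assms(1) unfolding anti_regular_map_def by blast
  have fn: "regular_fun UNIV X (preimage X \<phi> (preimage Y \<psi> V)) (\<lambda>x. f (\<psi> (\<phi> x)))"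
    if "variety_open UNIV Z V" "regular_fun UNIV Z V f" for V f
  proof -
    have "variety_open UNIV Y (preimage Y \<psi> V)" "regular_fun UNIV Y (preimage Y \<psi> V) (\<lambda>y. cnj (f (\<psi> y)))"
      using that assms(2) unfolding anti_regular_map_def by blast+
    then have "regular_fun UNIV X (preimage X \<phi> (preimage Y \<psi> V)) (\<lambda>x. cnj (cnj (f (\<psi> (\<phi> x)))))"
      using assms(1) unfolding anti_regular_map_def by blast
    then show ?thesis by simp
  qed
  have op: "variety_open UNIV X (preimage X \<phi> (preimage Y \<psi> V))" if "variety_open UNIV Z V" for V
    using that assms unfolding anti_regular_map_def by blast
  show ?thesis
    unfolding regular_map_def preimage_compose[OF \<phi>]
  proof (intro conjI allI impI op fn)
    show "(\<lambda>x. \<psi> (\<phi> x)) ` points X \<subseteq> points Z"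
      using anti_regular_map_mem[OF assms(1)] anti_regular_map_mem[OF assms(2)] by blast
  qed
qed

lemma regular_map_pullback:
  assumes "regular_map K X Y \<phi>" "regular_fun K Y (points Y) f" "1 \<in> K"
  shows "regular_fun K X (points X) (\<lambda>x. f (\<phi> x))"
  using assms variety_open_points[of K Y] preimage_points[of \<phi> X Y]
  unfolding regular_map_def by metis

lemma isomorphismI:
  assumes "regular_map K X Y \<phi>" "regular_map K Y X \<psi>"
    and "\<And>x. x \<in> points X \<Longrightarrow> \<psi> (\<phi> x) = x" "\<And>y. y \<in> points Y \<Longrightarrow> \<phi> (\<psi> y) = y"
  shows "isomorphism K X Y \<phi>"
proof -
  have bij: "bij_betw \<phi> (points X) (points Y)"
    using assms by (intro bij_betwI[where g = \<psi>]) (auto simp: regular_map_mem)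
  have "inv_into (points X) \<phi> y = \<psi> y" if "y \<in> points Y" for y
    using that assms bij
    by (intro inv_into_f_eq) (auto simp: regular_map_mem bij_betw_def)
  then have "regular_map K Y X (inv_into (points X) \<phi>)"
    using regular_map_cong[of Y "inv_into (points X) \<phi>" \<psi> K X] assms by blast
  then show ?thesis unfolding isomorphism_def using bij assms by blast
qed

lemma isomorphismE:
  assumes "isomorphism K X Y \<phi>"
  obtains \<psi> where "regular_map K X Y \<phi>" "regular_map K Y X \<psi>" "\<psi> = inv_into (points X) \<phi>"
    "\<And>x. x \<in> points X \<Longrightarrow> \<psi> (\<phi> x) = x" "\<And>y. y \<in> points Y \<Longrightarrow> \<phi> (\<psi> y) = y"
    "\<And>x. x \<in> points X \<Longrightarrow> \<phi> x \<in> points Y" "\<And>y. y \<in> points Y \<Longrightarrow> \<psi> y \<in> points X"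
  using that[of "inv_into (points X) \<phi>"] assms unfolding isomorphism_def
  by (metis bij_betw_inv_into_left bij_betw_inv_into_right regular_map_mem)

lemma isomorphism_refl: "isomorphism K X X (\<lambda>x. x)"
  by (rule isomorphismI[where \<psi> = "\<lambda>x. x"]) (auto simp: regular_map_id)


subsection \<open>Varieties with one chart\<close>

lemma regular_fun_single_iff:
  "regular_fun K {c} V f \<longleftrightarrow>
     regular_on K (cdim c) (ccoord c ` (V \<inter> cdom c)) (\<lambda>p. f (cinv c p))"
  by (simp add: regular_fun_def)

lemma regular_fun_coord:
  assumes "1 \<in> K" "i < cdim d"
  shows "regular_fun K {d} (cdom d) (\<lambda>y. ccoord d y ! i)"
proof -
  have "regular_on K (cdim d) (ccoord d ` cdom d) (\<lambda>p. ccoord d (cinv d p) ! i) \<longleftrightarrow>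
      regular_on K (cdim d) (ccoord d ` cdom d) (\<lambda>p. p ! i)"
    by (rule regular_on_cong) (auto simp: ccoord_cinv)
  then show ?thesis using assms by (simp add: regular_fun_single_iff regular_on_coord)
qed

lemma regular_map_coord:
  assumes "1 \<in> K" "regular_map K {c} {d} \<phi>" "i < cdim d"
  shows "regular_on K (cdim c) (ccoord c ` cdom c) (\<lambda>p. ccoord d (\<phi> (cinv c p)) ! i)"
  using regular_map_pullback[OF assms(2) _ assms(1), of "\<lambda>y. ccoord d y ! i"]
    regular_fun_coord[OF assms(1,3)] by (simp add: regular_fun_single_iff)

text \<open>A polynomial in regular functions is regular.  So the preimage of a closed set is the zero set of
  regular functions, and the pullback of a fraction is a quotient of regular functions.\<close>

lemma regular_map_singleI:
  assumes K: "1 \<in> K" and c: "inj_on (ccoord c) (cdom c)" and d: "inj_on (ccoord d) (cdom d)"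
    and \<phi>: "\<And>x. x \<in> cdom c \<Longrightarrow> \<phi> x \<in> cdom d"
    and reg: "\<And>i. i < cdim d \<Longrightarrow>
      regular_on K (cdim c) (ccoord c ` cdom c) (\<lambda>p. ccoord d (\<phi> (cinv c p)) ! i)"
  shows "regular_map K {c} {d} \<phi>"
proof -
  define F where "F = (\<lambda>p. ccoord d (\<phi> (cinv c p)))"
  have F: "F (ccoord c x) = ccoord d (\<phi> x)" if "x \<in> cdom c" for x
    using that c by (simp add: F_def cinv_ccoord)
  have pF: "regular_on K (cdim c) (ccoord c ` cdom c) (\<lambda>q. P (F q))" if "P \<in> polys K (cdim d)" for P
    using K that by (rule regular_on_compose_poly) (use reg in \<open>simp add: F_def\<close>)
  have op: "variety_open K {c} (preimage {c} \<phi> V)" if V: "variety_open K {d} V" for V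
  proof -
    have Vd: "V \<subseteq> cdom d" and "zclosed_in K (cdim d) (ccoord d ` cdom d) (ccoord d ` cdom d - ccoord d ` V)"
      using V unfolding variety_open_def zopen_in_def by (auto simp: Int_absorb2)
    then obtain S where S: "S \<subseteq> polys K (cdim d)"
      "ccoord d ` cdom d - ccoord d ` V = {p \<in> ccoord d ` cdom d. \<forall>P\<in>S. P p = 0}"
      unfolding zclosed_in_def by blast
    have V_iff: "y \<in> V \<longleftrightarrow> \<not> (\<forall>P\<in>S. P (ccoord d y) = 0)" if "y \<in> cdom d" for y
    proof -
      have "y \<in> V \<longleftrightarrow> ccoord d y \<in> ccoord d ` V"
        using d Vd that by (auto simp: inj_on_def)
      also have "\<dots> \<longleftrightarrow> ccoord d y \<notin> ccoord d ` cdom d - ccoord d ` V" using that by auto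
      also have "\<dots> \<longleftrightarrow> \<not> (\<forall>P\<in>S. P (ccoord d y) = 0)" unfolding S(2) using that by auto
      finally show ?thesis .
    qed
    let ?W = "preimage {c} \<phi> V"
    have W: "x \<in> ?W \<longleftrightarrow> \<not> (\<forall>P\<in>S. P (F (ccoord c x)) = 0)" if "x \<in> cdom c" for x
      using that V_iff[OF \<phi>[OF that]] by (simp add: preimage_def F)
    have sub: "?W \<subseteq> cdom c" by (auto simp: preimage_def)
    have "ccoord c ` cdom c - ccoord c ` ?W =
      {p \<in> ccoord c ` cdom c. \<forall>f\<in>(\<lambda>P q. P (F q)) ` S. f p = 0}"
    proof -
      have "ccoord c x \<in> ccoord c ` ?W \<longleftrightarrow> x \<in> ?W" if "x \<in> cdom c" for x
        using c sub that by (auto simp: inj_on_def)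
      then show ?thesis using W by auto
    qed
    also have "zclosed_in K (cdim c) (ccoord c ` cdom c) \<dots>"
      by (rule zclosed_in_zeros_of_regular) (use S(1) pF in auto)
    finally show ?thesis
      using sub unfolding variety_open_def zopen_in_def by (auto simp: Int_absorb2)
  qed
  have fn: "regular_fun K {c} (preimage {c} \<phi> V) (\<lambda>x. f (\<phi> x))"
    if V: "variety_open K {d} V" and f: "regular_fun K {d} V f" for V f
  proof -
    have Vd: "V \<subseteq> cdom d" using V unfolding variety_open_def by simp
    have freg: "regular_on K (cdim d) (ccoord d ` V) (\<lambda>p. f (cinv d p))"
      using f Vd by (simp add: regular_fun_single_iff Int_absorb2)
    let ?W = "preimage {c} \<phi> V"
    have sub: "?W \<subseteq> cdom c" by (auto simp: preimage_def)
    have "regular_on K (cdim c) (ccoord c ` ?W) (\<lambda>p. f (\<phi> (cinv c p)))"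
    proof (rule regular_onI)
      fix p assume p: "p \<in> ccoord c ` ?W"
      then have pc: "p \<in> ccoord c ` cdom c" using sub by auto
      have FW: "F q \<in> ccoord d ` V \<and> f (\<phi> (cinv c q)) = f (cinv d (F q)) \<and> q \<in> ccoord c ` cdom c"
        if q: "q \<in> ccoord c ` ?W" for q
      proof -
        obtain x where x: "x \<in> ?W" "q = ccoord c x" using q by auto
        then have "x \<in> cdom c" "\<phi> x \<in> V" "\<phi> x \<in> cdom d" using \<phi> by (auto simp: preimage_def)
        then show ?thesis using x c d F by (simp add: cinv_ccoord)
      qed
      obtain P Q where 1: "P \<in> polys K (cdim d)" "Q \<in> polys K (cdim d)" "Q (F p) \<noteq> 0"
        "\<forall>q\<in>ccoord d ` V. Q q \<noteq> 0 \<longrightarrow> f (cinv d q) = P q / Q q"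
        using FW[OF p] by (elim conjE) (rule regular_onD[OF freg, of "F p"])
      obtain A B where AB: "A \<in> polys K (cdim c)" "B \<in> polys K (cdim c)" "B p \<noteq> 0"
        "\<forall>q\<in>ccoord c ` cdom c. B q \<noteq> 0 \<longrightarrow> P (F q) = A q / B q"
        by (rule regular_onD[OF pF[OF 1(1)] pc])
      obtain C D where CD: "C \<in> polys K (cdim c)" "D \<in> polys K (cdim c)" "D p \<noteq> 0"
        "\<forall>q\<in>ccoord c ` cdom c. D q \<noteq> 0 \<longrightarrow> Q (F q) = C q / D q"
        by (rule regular_onD[OF pF[OF 1(2)] pc])
      \<comment> \<open>The pullback is \<open>(A / B) / (C / D)\<close>.  The extra factor \<open>D\<close> makes the new
        denominator vanish wherever one of the two representations is not available.\<close>
      have C: "C p \<noteq> 0" using CD(3,4) pc 1(3) by auto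
      have "f (\<phi> (cinv c q)) = (A q * D q * D q) / (B q * C q * D q)"
        if q: "q \<in> ccoord c ` ?W" "B q * C q * D q \<noteq> 0" for q
      proof -
        have "Q (F q) = C q / D q" "P (F q) = A q / B q" using AB CD q FW[OF q(1)] by auto
        then show ?thesis using bspec[OF 1(4), of "F q"] FW[OF q(1)] q(2) by (simp add: field_simps)
      qed
      then show "\<exists>P\<in>polys K (cdim c). \<exists>Q\<in>polys K (cdim c). Q p \<noteq> 0 \<and>
          (\<forall>q\<in>ccoord c ` ?W. Q q \<noteq> 0 \<longrightarrow> f (\<phi> (cinv c q)) = P q / Q q)"
        using AB CD C
        by (intro bexI[of _ "\<lambda>q. A q * D q * D q"] bexI[of _ "\<lambda>q. B q * C q * D q"])
          (auto intro!: polys.mult)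
    qed
    then show ?thesis using sub by (simp add: regular_fun_single_iff Int_absorb2)
  qed
  show ?thesis unfolding regular_map_def using \<phi> op fn by auto
qed

lemma regular_map_single_mono_field:
  assumes "1 \<in> K" "K \<subseteq> K'" "inj_on (ccoord c) (cdom c)" "inj_on (ccoord d) (cdom d)"
    and "regular_map K {c} {d} \<phi>"
  shows "regular_map K' {c} {d} \<phi>"
proof (rule regular_map_singleI)
  show "\<phi> x \<in> cdom d" if "x \<in> cdom c" for x
    using regular_map_mem[OF assms(5)] that by simp
  show "regular_on K' (cdim c) (ccoord c ` cdom c) (\<lambda>p. ccoord d (\<phi> (cinv c p)) ! i)"
    if "i < cdim d" for i
    by (rule regular_on_mono_field[OF regular_map_coord[OF assms(1,5) that] assms(2)])
qed (use assms in auto)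

section \<open>Complex conjugation on real varieties\<close>

lemma cnj_comp_cnj [simp]: "cnj \<circ> cnj = (\<lambda>x. x)"
  by (simp add: fun_eq_iff)

lemma polys_cnj:
  assumes "P \<in> polys \<real> n" "length p = n"
  shows "P (map cnj p) = cnj (P p)"
  using assms(1)
proof induction
  case (const a)
  then show ?case by (simp add: Reals_cnj_iff)
qed (use assms(2) in auto)

lemma polys_Re_Im:
  assumes "P \<in> polys UNIV n"
  shows "\<exists>A\<in>polys \<real> n. \<exists>B\<in>polys \<real> n. \<forall>p. P p = A p + \<i> * B p"
  using assms
proof induction
  case (const a)
  show ?case
    by (rule bexI[of _ "\<lambda>_. complex_of_real (Re a)"], rule bexI[of _ "\<lambda>_. complex_of_real (Im a)"])
      (auto intro: polys.const simp: complex_eq)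
next
  case (coord i)
  then show ?case
    by (intro bexI[of _ "\<lambda>p. p ! i"] bexI[of _ "\<lambda>_. 0"]) (auto intro: polys.const polys.coord)
next
  case (add P Q)
  then obtain A B A' B' where AB: "A \<in> polys \<real> n" "B \<in> polys \<real> n" "A' \<in> polys \<real> n" "B' \<in> polys \<real> n"
    and eq: "\<forall>p. P p = A p + \<i> * B p" "\<forall>p. Q p = A' p + \<i> * B' p" by blast
  show ?case
    by (rule bexI[of _ "\<lambda>p. A p + A' p"], rule bexI[of _ "\<lambda>p. B p + B' p"])
      (use AB eq in \<open>auto intro!: polys.add simp: algebra_simps\<close>)
next
  case (mult P Q)
  then obtain A B A' B' where AB: "A \<in> polys \<real> n" "B \<in> polys \<real> n" "A' \<in> polys \<real> n" "B' \<in> polys \<real> n"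
    and eq: "\<forall>p. P p = A p + \<i> * B p" "\<forall>p. Q p = A' p + \<i> * B' p" by blast
  have m: "(\<lambda>p. - 1 * (B p * B' p)) \<in> polys \<real> n"
    by (rule polys.mult[OF polys.const polys.mult]) (use AB in auto)
  show ?case
  proof (rule bexI[of _ "\<lambda>p. A p * A' p + (- 1 * (B p * B' p))"], rule bexI[of _ "\<lambda>p. A p * B' p + B p * A' p"])
    show "\<forall>p. P p * Q p = A p * A' p + - 1 * (B p * B' p) + \<i> * (A p * B' p + B p * A' p)"
      using eq by (simp add: algebra_simps)
    show "(\<lambda>p. A p * B' p + B p * A' p) \<in> polys \<real> n"
      by (rule polys.add; rule polys.mult; rule AB)
    show "(\<lambda>p. A p * A' p + (- 1 * (B p * B' p))) \<in> polys \<real> n"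
      by (rule polys.add[OF polys.mult m]; rule AB)
  qed
qed

text \<open>The length matters: an index beyond the end of a list returns an arbitrary value, on which
  conjugating the list has no effect.\<close>

lemma polys_conjugate:
  assumes "P \<in> polys UNIV n"
  shows "\<exists>P'\<in>polys UNIV n. \<forall>p. length p = n \<longrightarrow> P' p = cnj (P (map cnj p))"
proof -
  obtain A B where AB: "A \<in> polys \<real> n" "B \<in> polys \<real> n" "\<forall>p. P p = A p + \<i> * B p"
    using polys_Re_Im[OF assms] by blast
  have U: "A \<in> polys UNIV n" "B \<in> polys UNIV n" using AB polys_mono[of _ \<real> n UNIV] by auto
  have m: "(\<lambda>p. A p + (- \<i>) * B p) \<in> polys UNIV n"
    by (rule polys.add[OF U(1) polys.mult[OF polys.const U(2)]]) simp
  show ?thesis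
    by (rule bexI[OF _ m]) (use AB polys_cnj in auto)
qed

lemma zclosed_in_cnj:
  assumes "zclosed_in \<real> n Z W" "Z \<subseteq> affine_space n" "\<And>p. p \<in> Z \<Longrightarrow> map cnj p \<in> Z" "p \<in> W"
  shows "map cnj p \<in> W"
proof -
  obtain S where S: "S \<subseteq> polys \<real> n" "W = {p \<in> Z. \<forall>P\<in>S. P p = 0}"
    using assms(1) unfolding zclosed_in_def by blast
  have len: "length p = n" using assms(2,4) S(2) by (auto simp: affine_space_def)
  have "P (map cnj p) = 0" if "P \<in> S" for P
    using polys_cnj[OF subsetD[OF S(1) that] len] S(2) assms(4) that by simp
  then show ?thesis using S(2) assms(3,4) by simp
qed

lemma zopen_in_cnj:
  assumes "zopen_in \<real> n Z W" "Z \<subseteq> affine_space n" "\<And>p. p \<in> Z \<Longrightarrow> map cnj p \<in> Z" "p \<in> W"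
  shows "map cnj p \<in> W"
proof (rule ccontr)
  assume "map cnj p \<notin> W"
  then have "map cnj p \<in> Z - W" using assms unfolding zopen_in_def by blast
  then have "map cnj (map cnj p) \<in> Z - W"
    using assms(1) zclosed_in_cnj[OF _ assms(2,3)] unfolding zopen_in_def by blast
  then show False using assms(4) by simp
qed

lemma locally_closed_affine: "locally_closed K n Z \<Longrightarrow> Z \<subseteq> affine_space n"
  unfolding locally_closed_def zclosed_in_def zopen_in_def by blast

lemma locally_closed_cnj:
  assumes "locally_closed \<real> n Z" "p \<in> Z"
  shows "map cnj p \<in> Z"
proof -
  obtain Y where Y: "zclosed_in \<real> n (affine_space n) Y" "zopen_in \<real> n Y Z"
    using assms(1) unfolding locally_closed_def by blast
  have "Y \<subseteq> affine_space n" using Y(1) unfolding zclosed_in_def by blast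
  moreover have "map cnj q \<in> Y" if "q \<in> Y" for q
    by (rule zclosed_in_cnj[OF Y(1) _ _ that]) (auto simp: affine_space_def)
  ultimately show ?thesis using zopen_in_cnj[OF Y(2) _ _ assms(2)] by blast
qed

text \<open>The denominator of a real fraction does not vanish at the conjugate point either, so that
  the same fraction gives both values.\<close>

lemma regular_on_cnj:
  assumes "regular_on \<real> n Z f" "p \<in> Z" "map cnj p \<in> Z" "length p = n"
  shows "f (map cnj p) = cnj (f p)"
proof -
  obtain P Q where PQ: "P \<in> polys \<real> n" "Q \<in> polys \<real> n" "Q p \<noteq> 0"
    "\<forall>q\<in>Z. Q q \<noteq> 0 \<longrightarrow> f q = P q / Q q" by (rule regular_onD[OF assms(1,2)])
  have "Q (map cnj p) = cnj (Q p)" "P (map cnj p) = cnj (P p)" using PQ assms(4) polys_cnj by auto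
  moreover have "Q (map cnj p) \<noteq> 0" using calculation(1) PQ(3) by simp
  then have "f (map cnj p) = P (map cnj p) / Q (map cnj p)" using PQ(4) assms(3) by blast
  ultimately show ?thesis using PQ(3,4) assms(2) by simp
qed

text \<open>Descent from \<open>\<complex>\<close> to \<open>\<real>\<close>: where a conjugation-stable condition
  \<open>A + \<i> B = 0\<close> holds, its conjugate \<open>A - \<i> B = 0\<close> holds as well, so the
  condition may be replaced by the two real ones.\<close>

lemma real_parts_zero:
  fixes a b :: complex
  assumes "a + \<i> * b = 0" "cnj a + \<i> * cnj b = 0"
  shows "a = 0 \<and> b = 0"
proof -
  have "cnj (cnj a + \<i> * cnj b) = 0" using assms(2) by simp
  then have "a - \<i> * b = 0" by simp
  then have "2 * a = 0" "2 * (\<i> * b) = 0" using assms(1) by (auto simp: algebra_simps)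
  then show ?thesis by simp
qed

lemma zclosed_in_descent:
  assumes "zclosed_in UNIV n Z W" "Z \<subseteq> affine_space n" "\<And>p. p \<in> W \<Longrightarrow> map cnj p \<in> W"
  shows "zclosed_in \<real> n Z W"
proof -
  obtain S where S: "S \<subseteq> polys UNIV n" "W = {p \<in> Z. \<forall>P\<in>S. P p = 0}"
    using assms(1) unfolding zclosed_in_def by blast
  define T where "T = {R. \<exists>A\<in>polys \<real> n. \<exists>B\<in>polys \<real> n. \<exists>P\<in>S.
    (\<forall>p. P p = A p + \<i> * B p) \<and> (R = A \<or> R = B)}"
  have "W = {p \<in> Z. \<forall>R\<in>T. R p = 0}"
  proof (intro set_eqI iffI)
    fix p assume p: "p \<in> W"
    then have len: "length p = n" using S(2) assms(2) by (auto simp: affine_space_def)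
    have "A p = 0 \<and> B p = 0" if "A \<in> polys \<real> n" "B \<in> polys \<real> n" "P \<in> S" "\<forall>p. P p = A p + \<i> * B p"
      for A B P
    proof (rule real_parts_zero)
      have "P p = 0" "P (map cnj p) = 0" using p assms(3)[OF p] S(2) that(3) by auto
      then show "A p + \<i> * B p = 0" "cnj (A p) + \<i> * cnj (B p) = 0"
        using that polys_cnj[OF _ len] by auto
    qed
    then show "p \<in> {p \<in> Z. \<forall>R\<in>T. R p = 0}" using p S(2) unfolding T_def by blast
  next
    fix p assume p: "p \<in> {p \<in> Z. \<forall>R\<in>T. R p = 0}"
    have "P p = 0" if P: "P \<in> S" for P
    proof -
      obtain A B where AB: "A \<in> polys \<real> n" "B \<in> polys \<real> n" "\<forall>p. P p = A p + \<i> * B p"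
        using polys_Re_Im[OF subsetD[OF S(1) P]] by blast
      then have T: "A \<in> T" "B \<in> T" unfolding T_def using P by blast+
      have "\<forall>R\<in>T. R p = 0" using p by simp
      from bspec[OF this T(1)] bspec[OF this T(2)] show ?thesis using AB by simp
    qed
    then show "p \<in> W" using p S(2) by blast
  qed
  moreover have "T \<subseteq> polys \<real> n" unfolding T_def by auto
  ultimately show ?thesis unfolding zclosed_in_def by blast
qed

text \<open>If \<open>f = P / Q\<close>, then \<open>f Q\<^sup>2 = P Q\<close> holds everywhere, and for
  equivariant \<open>f\<close> it splits into \<open>f C = A\<close> and \<open>f D = B\<close> with real
  polynomials; \<open>C\<close> and \<open>D\<close> do not both vanish where \<open>Q\<close> does not.\<close>

lemma regular_on_descent:
  assumes "regular_on UNIV n Z f" "Z \<subseteq> affine_space n"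
    and "\<And>p. p \<in> Z \<Longrightarrow> map cnj p \<in> Z" "\<And>p. p \<in> Z \<Longrightarrow> f (map cnj p) = cnj (f p)"
  shows "regular_on \<real> n Z f"
proof (rule regular_onI)
  fix p assume p: "p \<in> Z"
  obtain P Q where PQ: "P \<in> polys UNIV n" "Q \<in> polys UNIV n" "Q p \<noteq> 0"
    "\<forall>q\<in>Z. Q q \<noteq> 0 \<longrightarrow> f q = P q / Q q" by (rule regular_onD[OF assms(1) p])
  obtain A B where AB: "A \<in> polys \<real> n" "B \<in> polys \<real> n" "\<forall>p. P p * Q p = A p + \<i> * B p"
    using polys_Re_Im[OF polys.mult[OF PQ(1,2)]] by blast
  obtain C D where CD: "C \<in> polys \<real> n" "D \<in> polys \<real> n" "\<forall>p. Q p * Q p = C p + \<i> * D p"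
    using polys_Re_Im[OF polys.mult[OF PQ(2,2)]] by blast
  have f: "f q * (C q + \<i> * D q) = A q + \<i> * B q" if "q \<in> Z" for q
    using PQ(4) that AB(3)[rule_format, of q, symmetric] CD(3)[rule_format, of q, symmetric]
    by (cases "Q q = 0") auto
  have eq: "f q * C q = A q \<and> f q * D q = B q" if q: "q \<in> Z" for q
  proof -
    have len: "length q = n" using q assms(2) by (auto simp: affine_space_def)
    have "f q * C q - A q = 0 \<and> f q * D q - B q = 0"
    proof (rule real_parts_zero)
      show "f q * C q - A q + \<i> * (f q * D q - B q) = 0" using f[OF q] by (simp add: algebra_simps)
      have "cnj (f q) * (cnj (C q) + \<i> * cnj (D q)) = cnj (A q) + \<i> * cnj (B q)"
        using f[OF assms(3)[OF q]] assms(4)[OF q] AB CD len by (simp add: polys_cnj)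
      then show "cnj (f q * C q - A q) + \<i> * cnj (f q * D q - B q) = 0" by (simp add: algebra_simps)
    qed
    then show ?thesis by simp
  qed
  have "C p \<noteq> 0 \<or> D p \<noteq> 0"
  proof (rule ccontr)
    assume "\<not> ?thesis"
    then have "Q p * Q p = 0" using CD(3) by simp
    then show False using PQ(3) by simp
  qed
  then show "\<exists>P\<in>polys \<real> n. \<exists>Q\<in>polys \<real> n. Q p \<noteq> 0 \<and> (\<forall>q\<in>Z. Q q \<noteq> 0 \<longrightarrow> f q = P q / Q q)"
  proof
    assume "C p \<noteq> 0"
    then show ?thesis
      by (intro bexI[of _ A] bexI[of _ C]) (use AB CD eq in \<open>auto simp: field_simps\<close>)
  next
    assume "D p \<noteq> 0"
    then show ?thesis
      by (intro bexI[of _ B] bexI[of _ D]) (use AB CD eq in \<open>auto simp: field_simps\<close>)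
  qed
qed

lemma variety_chart:
  assumes "variety K X" "c \<in> X"
  shows "inj_on (ccoord c) (cdom c)" "locally_closed K (cdim c) (ccoord c ` cdom c)"
    "ccoord c ` cdom c \<subseteq> affine_space (cdim c)"
  using assms locally_closed_affine unfolding variety_def by blast+

lemma variety_chart_cnj:
  assumes "variety \<real> X" "c \<in> X" "p \<in> ccoord c ` cdom c"
  shows "map cnj p \<in> ccoord c ` cdom c"
  using locally_closed_cnj[OF variety_chart(2)[OF assms(1,2)] assms(3)] .

text \<open>In any other chart around the same point, the point with conjugate coordinates is the same
  one: the overlap is open over \<open>\<real>\<close>, so stable, and the transition map commutes with
  conjugation.\<close>

lemma conj_point_chart:
  assumes X: "variety \<real> X" and c: "c \<in> X" and y: "y \<in> cdom c"
  shows "conj_point X y \<in> cdom c \<and> ccoord c (conj_point X y) = map cnj (ccoord c y)"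
proof -
  define z where "z = cinv c (map cnj (ccoord c y))"
  have z: "z \<in> cdom c" "ccoord c z = map cnj (ccoord c y)"
    unfolding z_def using variety_chart_cnj[OF X c, of "ccoord c y"] y
    by (auto intro: cinv_mem ccoord_cinv)
  have uniq: "w = z" if d: "d \<in> X" "y \<in> cdom d" "w \<in> cdom d" "ccoord d w = map cnj (ccoord d y)" for d w
  proof -
    let ?W = "ccoord d ` (cdom d \<inter> cdom c)"
    have op: "zopen_in \<real> (cdim d) (ccoord d ` cdom d) ?W"
      and reg: "\<forall>i<cdim c. regular_on \<real> (cdim d) ?W (\<lambda>p. ccoord c (cinv d p) ! i)"
      using X c d(1) unfolding variety_def by blast+
    have inj: "inj_on (ccoord d) (cdom d)" using variety_chart[OF X d(1)] by blast
    have yW: "ccoord d y \<in> ?W" using y d by blast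
    have wW: "map cnj (ccoord d y) \<in> ?W"
      by (rule zopen_in_cnj[OF op variety_chart(3)[OF X d(1)] variety_chart_cnj[OF X d(1)] yW])
    then have wc: "w \<in> cdom c" using d inj by (auto simp: inj_on_def)
    have len: "length (ccoord d y) = cdim d"
      using variety_chart(3)[OF X d(1)] d(2) by (auto simp: affine_space_def)
    have len': "length (ccoord c w) = cdim c" "length (ccoord c y) = cdim c"
      using variety_chart(3)[OF X c] wc y by (auto simp: affine_space_def)
    have "ccoord c w = map cnj (ccoord c y)"
    proof (rule nth_equalityI)
      fix i assume "i < length (ccoord c w)"
      then have i: "i < cdim c" using len' by simp
      have "ccoord c (cinv d (map cnj (ccoord d y))) ! i = cnj (ccoord c (cinv d (ccoord d y)) ! i)"
        by (rule regular_on_cnj[OF reg[rule_format, OF i] yW wW len])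
      then have "ccoord c w ! i = cnj (ccoord c y ! i)"
        using d cinv_ccoord[OF inj, of w] cinv_ccoord[OF inj, of y] by simp
      then show "ccoord c w ! i = map cnj (ccoord c y) ! i" using i len' by simp
    qed (use len' in simp)
    then show "w = z" using z wc variety_chart(1)[OF X c] by (auto simp: inj_on_def)
  qed
  have "conj_point X y = z"
    unfolding conj_point_def
    by (rule the_equality) (use z c y uniq in blast)+
  then show ?thesis using z by simp
qed

lemma conj_point_mem:
  assumes "variety \<real> X" "y \<in> points X"
  shows "conj_point X y \<in> points X"
  using assms conj_point_chart by (fastforce simp: points_def)

lemma conj_point_involution:
  assumes X: "variety \<real> X" and "y \<in> points X"
  shows "conj_point X (conj_point X y) = y"
proof -
  obtain c where c: "c \<in> X" "y \<in> cdom c" using assms(2) by (auto simp: points_def)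
  note 1 = conj_point_chart[OF X c]
  note 2 = conj_point_chart[OF X c(1) conjunct1[OF 1]]
  show ?thesis
    using 1 2 c variety_chart(1)[OF X c(1)] by (auto simp: inj_on_def)
qed

lemma image_conj_stable:
  assumes X: "variety \<real> X" and c: "c \<in> X" and V: "\<And>x. x \<in> V \<Longrightarrow> conj_point X x \<in> V"
    and p: "p \<in> ccoord c ` (V \<inter> cdom c)"
  shows "map cnj p \<in> ccoord c ` (V \<inter> cdom c)"
proof -
  obtain x where x: "x \<in> V" "x \<in> cdom c" "p = ccoord c x" using p by blast
  then have "conj_point X x \<in> V \<inter> cdom c" "map cnj p = ccoord c (conj_point X x)"
    using conj_point_chart[OF X c x(2)] V by auto
  then show ?thesis by blast
qed

lemma cinv_cnj:
  assumes X: "variety \<real> X" and c: "c \<in> X" and p: "p \<in> ccoord c ` cdom c"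
  shows "cinv c (map cnj p) = conj_point X (cinv c p)"
  using conj_point_chart[OF X c cinv_mem[OF p]] ccoord_cinv[OF p]
    cinv_ccoord[OF variety_chart(1)[OF X c], of "conj_point X (cinv c p)"] by simp

lemma variety_open_conj_stable:
  assumes X: "variety \<real> X" and V: "variety_open \<real> X V" and x: "x \<in> V"
  shows "conj_point X x \<in> V"
proof -
  obtain c where c: "c \<in> X" "x \<in> cdom c" using V x by (auto simp: points_def variety_open_def)
  have "zopen_in \<real> (cdim c) (ccoord c ` cdom c) (ccoord c ` (V \<inter> cdom c))"
    using V c unfolding variety_open_def by blast
  then have "map cnj (ccoord c x) \<in> ccoord c ` (V \<inter> cdom c)"
    by (rule zopen_in_cnj[OF _ variety_chart(3)[OF X c(1)] variety_chart_cnj[OF X c(1)]])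
      (use x c in auto)
  then show ?thesis
    using conj_point_chart[OF X c] variety_chart(1)[OF X c(1)] by (auto simp: inj_on_def)
qed

lemma variety_open_complexify: "variety_open \<real> X V \<Longrightarrow> variety_open UNIV X V"
  unfolding variety_open_def by (auto intro: zopen_in_mono_field)

lemma regular_fun_complexify: "regular_fun \<real> X V f \<Longrightarrow> regular_fun UNIV X V f"
  unfolding regular_fun_def by (auto intro: regular_on_mono_field)

lemma variety_open_descent:
  assumes X: "variety \<real> X" and V: "variety_open UNIV X V" "\<And>x. x \<in> V \<Longrightarrow> conj_point X x \<in> V"
  shows "variety_open \<real> X V"
  unfolding variety_open_def
proof (intro conjI ballI)
  show "V \<subseteq> points X" using V unfolding variety_open_def by blast
  fix c assume c: "c \<in> X"
  let ?Z = "ccoord c ` cdom c" and ?W = "ccoord c ` (V \<inter> cdom c)"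
  have "zclosed_in UNIV (cdim c) ?Z (?Z - ?W)"
    using V(1) c unfolding variety_open_def zopen_in_def by blast
  moreover have "map cnj p \<in> ?Z - ?W" if p: "p \<in> ?Z - ?W" for p
    using variety_chart_cnj[OF X c, of p] image_conj_stable[OF X c V(2), of "map cnj p"] p by auto
  ultimately show "zopen_in \<real> (cdim c) ?Z ?W"
    unfolding zopen_in_def using zclosed_in_descent[OF _ variety_chart(3)[OF X c]] by blast
qed

lemma regular_fun_conj:
  assumes X: "variety \<real> X" and V: "V \<subseteq> points X" "\<And>x. x \<in> V \<Longrightarrow> conj_point X x \<in> V"
    and f: "regular_fun \<real> X V f" and x: "x \<in> V"
  shows "f (conj_point X x) = cnj (f x)"
proof -
  obtain c where c: "c \<in> X" "x \<in> cdom c" using V(1) x by (auto simp: points_def)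
  have reg: "regular_on \<real> (cdim c) (ccoord c ` (V \<inter> cdom c)) (\<lambda>p. f (cinv c p))"
    using f c unfolding regular_fun_def by blast
  have m: "ccoord c x \<in> ccoord c ` (V \<inter> cdom c)" using x c by blast
  have "length (ccoord c x) = cdim c"
    using variety_chart(3)[OF X c(1)] c(2) by (auto simp: affine_space_def)
  then have "f (cinv c (map cnj (ccoord c x))) = cnj (f (cinv c (ccoord c x)))"
    using regular_on_cnj[OF reg m image_conj_stable[OF X c(1) V(2) m]] by simp
  then show ?thesis
    using cinv_cnj[OF X c(1), of "ccoord c x"] cinv_ccoord[OF variety_chart(1)[OF X c(1)] c(2)] c(2)
    by simp
qed

lemma regular_fun_descent:
  assumes X: "variety \<real> X" and V: "\<And>x. x \<in> V \<Longrightarrow> conj_point X x \<in> V"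
    and f: "regular_fun UNIV X V f" "\<And>x. x \<in> V \<Longrightarrow> f (conj_point X x) = cnj (f x)"
  shows "regular_fun \<real> X V f"
  unfolding regular_fun_def
proof
  fix c assume c: "c \<in> X"
  show "regular_on \<real> (cdim c) (ccoord c ` (V \<inter> cdom c)) (\<lambda>p. f (cinv c p))"
  proof (rule regular_on_descent)
    show "regular_on UNIV (cdim c) (ccoord c ` (V \<inter> cdom c)) (\<lambda>p. f (cinv c p))"
      using f c unfolding regular_fun_def by blast
    show "ccoord c ` (V \<inter> cdom c) \<subseteq> affine_space (cdim c)"
      using variety_chart(3)[OF X c] by blast
    fix p assume p: "p \<in> ccoord c ` (V \<inter> cdom c)"
    show "map cnj p \<in> ccoord c ` (V \<inter> cdom c)" by (rule image_conj_stable[OF X c V p])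
    have "cinv c p \<in> V" using p cinv_ccoord[OF variety_chart(1)[OF X c]] by auto
    then show "f (cinv c (map cnj p)) = cnj (f (cinv c p))"
      using f(2) cinv_cnj[OF X c, of p] p by auto
  qed
qed

text \<open>The preimage of a real open set and the pullback of a real function are compatible with
  conjugation, so that descent of open sets and of functions applies to them.\<close>

lemma regular_map_descent:
  assumes X: "variety \<real> X" and Y: "variety \<real> Y" and \<phi>: "regular_map UNIV X Y \<phi>"
    and eq: "\<And>x. x \<in> points X \<Longrightarrow> \<phi> (conj_point X x) = conj_point Y (\<phi> x)"
  shows "regular_map \<real> X Y \<phi>"
proof -
  have stable: "conj_point X x \<in> preimage X \<phi> V"
    if "variety_open \<real> Y V" "x \<in> preimage X \<phi> V" for V x
    using that eq conj_point_mem[OF X] variety_open_conj_stable[OF Y] by (simp add: preimage_def)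
  have "variety_open \<real> X (preimage X \<phi> V)" if V: "variety_open \<real> Y V" for V
    using \<phi> variety_open_complexify[OF V] unfolding regular_map_def
    by (intro variety_open_descent[OF X _ stable[OF V]]) blast
  moreover have "regular_fun \<real> X (preimage X \<phi> V) (\<lambda>x. f (\<phi> x))"
    if V: "variety_open \<real> Y V" and f: "regular_fun \<real> Y V f" for V f
  proof (rule regular_fun_descent[OF X stable[OF V]])
    show "regular_fun UNIV X (preimage X \<phi> V) (\<lambda>x. f (\<phi> x))"
      using \<phi> variety_open_complexify[OF V] regular_fun_complexify[OF f]
      unfolding regular_map_def by blast
    show "f (\<phi> (conj_point X x)) = cnj (f (\<phi> x))" if "x \<in> preimage X \<phi> V" for x
      using that eq regular_fun_conj[OF Y _ variety_open_conj_stable[OF Y V] f] V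
      by (auto simp: preimage_def variety_open_def)
  qed
  ultimately show ?thesis using regular_map_mem[OF \<phi>] unfolding regular_map_def by blast
qed

text \<open>In a chart, conjugation replaces the coefficients of the equations of a closed set and of the
  fractions of a function by their complex conjugates.\<close>

lemma anti_regular_conj_point:
  assumes X: "variety \<real> X"
  shows "anti_regular_map X X (conj_point X)"
proof -
  have img: "map cnj p \<in> ccoord c ` (V \<inter> cdom c) \<longleftrightarrow> p \<in> ccoord c ` (preimage X (conj_point X) V \<inter> cdom c)"
    if c: "c \<in> X" and V: "V \<subseteq> points X" and p: "p \<in> ccoord c ` cdom c" for c V p
  proof -
    obtain x where x: "x \<in> cdom c" "p = ccoord c x" using p by blast
    have inj: "inj_on (ccoord c) (cdom c)" by (rule variety_chart(1)[OF X c])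
    note cx = conj_point_chart[OF X c x(1)]
    have "map cnj p \<in> ccoord c ` (V \<inter> cdom c) \<longleftrightarrow> conj_point X x \<in> V"
      using cx inj_on_image_mem_iff[OF inj conjunct1[OF cx], of "V \<inter> cdom c"] x(2) by simp
    also have "\<dots> \<longleftrightarrow> x \<in> preimage X (conj_point X) V"
      using x c by (auto simp: preimage_def points_def)
    also have "\<dots> \<longleftrightarrow> p \<in> ccoord c ` (preimage X (conj_point X) V \<inter> cdom c)"
      using inj_on_image_mem_iff[OF inj x(1), of "preimage X (conj_point X) V \<inter> cdom c"] x by simp
    finally show ?thesis .
  qed
  have len: "length p = cdim c" if "c \<in> X" "p \<in> ccoord c ` cdom c" for c p
    using variety_chart(3)[OF X that(1)] that(2) by (auto simp: affine_space_def)
  have op: "variety_open UNIV X (preimage X (conj_point X) V)" if V: "variety_open UNIV X V" for V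
    unfolding variety_open_def
  proof (intro conjI ballI)
    show "preimage X (conj_point X) V \<subseteq> points X" by (auto simp: preimage_def)
    fix c assume c: "c \<in> X"
    let ?Z = "ccoord c ` cdom c"
    let ?W = "ccoord c ` (preimage X (conj_point X) V \<inter> cdom c)"
    have Vp: "V \<subseteq> points X" using V unfolding variety_open_def by blast
    obtain S where S: "S \<subseteq> polys UNIV (cdim c)"
      "?Z - ccoord c ` (V \<inter> cdom c) = {p \<in> ?Z. \<forall>P\<in>S. P p = 0}"
      using V c unfolding variety_open_def zopen_in_def zclosed_in_def by blast
    define T where "T = {P' \<in> polys UNIV (cdim c). \<exists>P\<in>S. \<forall>p. length p = cdim c \<longrightarrow> P' p = cnj (P (map cnj p))}"
    have "?Z - ?W = {p \<in> ?Z. \<forall>P\<in>T. P p = 0}"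
    proof (intro set_eqI)
      fix p
      show "p \<in> ?Z - ?W \<longleftrightarrow> p \<in> {p \<in> ?Z. \<forall>P\<in>T. P p = 0}"
      proof (cases "p \<in> ?Z")
        case True
        have "p \<in> ?Z - ?W \<longleftrightarrow> map cnj p \<in> ?Z - ccoord c ` (V \<inter> cdom c)"
          using True img[OF c Vp True] variety_chart_cnj[OF X c True] by blast
        also have "\<dots> \<longleftrightarrow> (\<forall>P\<in>S. P (map cnj p) = 0)"
          unfolding S(2) using variety_chart_cnj[OF X c True] by blast
        also have "\<dots> \<longleftrightarrow> (\<forall>P\<in>T. P p = 0)"
        proof
          show "\<forall>P\<in>T. P p = 0" if S0: "\<forall>P\<in>S. P (map cnj p) = 0"
          proof
            fix P' assume "P' \<in> T"
            then obtain P where P: "P \<in> S" "\<forall>p. length p = cdim c \<longrightarrow> P' p = cnj (P (map cnj p))"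
              unfolding T_def by blast
            have "P (map cnj p) = 0" by (rule bspec[OF S0 P(1)])
            then show "P' p = 0" using P(2) len[OF c True] by simp
          qed
          show "\<forall>P\<in>S. P (map cnj p) = 0" if T: "\<forall>P\<in>T. P p = 0"
          proof
            fix P assume P: "P \<in> S"
            then have "P \<in> polys UNIV (cdim c)" using S(1) by (rule rev_subsetD)
            from polys_conjugate[OF this] obtain P' where
              P': "P' \<in> polys UNIV (cdim c)" "\<forall>p. length p = cdim c \<longrightarrow> P' p = cnj (P (map cnj p))"
              by (elim bexE)
            have "P' \<in> T" unfolding T_def by (intro CollectI conjI bexI[of _ P] P P')
            then have "P' p = 0" by (rule bspec[OF T])
            then show "P (map cnj p) = 0" using P'(2) len[OF c True] by simp
          qed
        qed
        finally show ?thesis using True by simp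
      qed auto
    qed
    moreover have "T \<subseteq> polys UNIV (cdim c)" unfolding T_def by (rule Collect_subset)
    ultimately show "zopen_in UNIV (cdim c) ?Z ?W" unfolding zopen_in_def zclosed_in_def
      by (intro conjI exI[of _ T]) auto
  qed
  have fn: "regular_fun UNIV X (preimage X (conj_point X) V) (\<lambda>x. cnj (f (conj_point X x)))"
    if V: "variety_open UNIV X V" and f: "regular_fun UNIV X V f" for V f
    unfolding regular_fun_def
  proof (intro ballI regular_onI)
    fix c p
    assume c: "c \<in> X" and p: "p \<in> ccoord c ` (preimage X (conj_point X) V \<inter> cdom c)"
    have Vp: "V \<subseteq> points X" using V unfolding variety_open_def by blast
    have img': "map cnj q \<in> ccoord c ` (V \<inter> cdom c) \<and> cinv c (map cnj q) = conj_point X (cinv c q)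
        \<and> length q = cdim c"
      if q: "q \<in> ccoord c ` (preimage X (conj_point X) V \<inter> cdom c)" for q
    proof -
      have "q \<in> ccoord c ` cdom c" using q by blast
      then show ?thesis using img[OF c Vp] q cinv_cnj[OF X c] len[OF c] by blast
    qed
    have reg: "regular_on UNIV (cdim c) (ccoord c ` (V \<inter> cdom c)) (\<lambda>p. f (cinv c p))"
      using f c unfolding regular_fun_def by (rule bspec)
    obtain P Q where PQ: "P \<in> polys UNIV (cdim c)" "Q \<in> polys UNIV (cdim c)" "Q (map cnj p) \<noteq> 0"
      "\<forall>q\<in>ccoord c ` (V \<inter> cdom c). Q q \<noteq> 0 \<longrightarrow> f (cinv c q) = P q / Q q"
      by (rule regular_onD[OF reg conjunct1[OF img'[OF p]]])
    obtain P' where P': "P' \<in> polys UNIV (cdim c)" "\<forall>p. length p = cdim c \<longrightarrow> P' p = cnj (P (map cnj p))"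
      using polys_conjugate[OF PQ(1)] by (elim bexE)
    obtain Q' where Q': "Q' \<in> polys UNIV (cdim c)" "\<forall>p. length p = cdim c \<longrightarrow> Q' p = cnj (Q (map cnj p))"
      using polys_conjugate[OF PQ(2)] by (elim bexE)
    show "\<exists>P\<in>polys UNIV (cdim c). \<exists>Q\<in>polys UNIV (cdim c). Q p \<noteq> 0 \<and>
        (\<forall>q\<in>ccoord c ` (preimage X (conj_point X) V \<inter> cdom c). Q q \<noteq> 0 \<longrightarrow>
           cnj (f (conj_point X (cinv c q))) = P q / Q q)"
    proof (rule bexI[OF _ P'(1)], rule bexI[OF _ Q'(1)], intro conjI ballI impI)
      show "Q' p \<noteq> 0" using Q'(2) img'[OF p] PQ(3) by simp
      fix q assume q: "q \<in> ccoord c ` (preimage X (conj_point X) V \<inter> cdom c)" "Q' q \<noteq> 0"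
      note iq = img'[OF q(1)]
      have "Q (map cnj q) \<noteq> 0" using Q'(2) iq q(2) by auto
      then have "f (cinv c (map cnj q)) = P (map cnj q) / Q (map cnj q)"
        using bspec[OF PQ(4) conjunct1[OF iq]] by simp
      then show "cnj (f (conj_point X (cinv c q))) = P' q / Q' q"
        using iq P'(2) Q'(2) by simp
    qed
  qed
  show ?thesis unfolding anti_regular_map_def using conj_point_mem[OF X] op fn by blast
qed

section \<open>Equivariant isomorphisms and real forms\<close>

text \<open>With \<open>X = Y\<close> and two real structures this is their equivalence; with the
  conjugations of two real varieties it is isomorphism over the reals.\<close>

definition equivariant_iso ::
  "'a chart set \<Rightarrow> ('a \<Rightarrow> 'a) \<Rightarrow> 'b chart set \<Rightarrow> ('b \<Rightarrow> 'b) \<Rightarrow> bool" where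
  "equivariant_iso X \<sigma> Y \<tau> \<longleftrightarrow>
     (\<exists>\<phi>. isomorphism UNIV X Y \<phi> \<and> (\<forall>x\<in>points X. \<phi> (\<sigma> x) = \<tau> (\<phi> x)))"

lemma equivariant_isoI:
  assumes "regular_map UNIV X Y \<phi>" "regular_map UNIV Y X \<psi>"
    and "\<And>x. x \<in> points X \<Longrightarrow> \<psi> (\<phi> x) = x" "\<And>y. y \<in> points Y \<Longrightarrow> \<phi> (\<psi> y) = y"
    and "\<And>x. x \<in> points X \<Longrightarrow> \<phi> (\<sigma> x) = \<tau> (\<phi> x)"
  shows "equivariant_iso X \<sigma> Y \<tau>"
  unfolding equivariant_iso_def using isomorphismI[OF assms(1-4)] assms(5) by blast

definition equivariant_pair ::
  "'a chart set \<Rightarrow> ('a \<Rightarrow> 'a) \<Rightarrow> 'b chart set \<Rightarrow> ('b \<Rightarrow> 'b) \<Rightarrow> ('a \<Rightarrow> 'b) \<Rightarrow> ('b \<Rightarrow> 'a) \<Rightarrow> bool" where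
  "equivariant_pair X \<sigma> Y \<tau> \<phi> \<psi> \<longleftrightarrow> regular_map UNIV X Y \<phi> \<and> regular_map UNIV Y X \<psi> \<and>
     (\<forall>x\<in>points X. \<psi> (\<phi> x) = x) \<and> (\<forall>y\<in>points Y. \<phi> (\<psi> y) = y) \<and> (\<forall>x\<in>points X. \<phi> (\<sigma> x) = \<tau> (\<phi> x))"

lemma equivariant_isoE:
  assumes "equivariant_iso X \<sigma> Y \<tau>"
  obtains \<phi> \<psi> where "equivariant_pair X \<sigma> Y \<tau> \<phi> \<psi>"
proof -
  obtain \<phi> where \<phi>: "isomorphism UNIV X Y \<phi>" "\<forall>x\<in>points X. \<phi> (\<sigma> x) = \<tau> (\<phi> x)"
    using assms unfolding equivariant_iso_def by blast
  show thesis by (rule isomorphismE[OF \<phi>(1)], rule that) (use \<phi>(2) in \<open>auto simp: equivariant_pair_def\<close>)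
qed

lemma equivariant_pairD:
  assumes "equivariant_pair X \<sigma> Y \<tau> \<phi> \<psi>"
  shows "regular_map UNIV X Y \<phi>" "regular_map UNIV Y X \<psi>"
    "\<And>x. x \<in> points X \<Longrightarrow> \<psi> (\<phi> x) = x" "\<And>y. y \<in> points Y \<Longrightarrow> \<phi> (\<psi> y) = y"
    "\<And>x. x \<in> points X \<Longrightarrow> \<phi> x \<in> points Y" "\<And>y. y \<in> points Y \<Longrightarrow> \<psi> y \<in> points X"
    "\<And>x. x \<in> points X \<Longrightarrow> \<phi> (\<sigma> x) = \<tau> (\<phi> x)"
  using assms unfolding equivariant_pair_def by (auto intro: regular_map_mem)

lemma equivariant_iso_refl: "equivariant_iso X \<sigma> X \<sigma>"
  unfolding equivariant_iso_def using isomorphism_refl by blast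

lemma equivariant_iso_sym:
  assumes "equivariant_iso X \<sigma> Y \<tau>" and \<sigma>: "\<And>x. x \<in> points X \<Longrightarrow> \<sigma> x \<in> points X"
  shows "equivariant_iso Y \<tau> X \<sigma>"
proof -
  obtain \<phi> \<psi> where "equivariant_pair X \<sigma> Y \<tau> \<phi> \<psi>"
    by (rule equivariant_isoE[OF assms(1)])
  note 1 = equivariant_pairD[OF this]
  show ?thesis
  proof (rule equivariant_isoI[OF 1(2,1,4,3)])
    show "\<psi> (\<tau> y) = \<sigma> (\<psi> y)" if y: "y \<in> points Y" for y
      using 1(7)[OF 1(6)[OF y]] 1(4)[OF y] 1(3)[OF \<sigma>[OF 1(6)[OF y]]] by simp
  qed
qed

lemma equivariant_iso_trans:
  assumes "equivariant_iso X \<sigma> Y \<tau>" "equivariant_iso Y \<tau> Z \<upsilon>"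
  shows "equivariant_iso X \<sigma> Z \<upsilon>"
proof -
  obtain \<phi> \<psi> where "equivariant_pair X \<sigma> Y \<tau> \<phi> \<psi>"
    by (rule equivariant_isoE[OF assms(1)])
  note 1 = equivariant_pairD[OF this]
  obtain \<phi>' \<psi>' where "equivariant_pair Y \<tau> Z \<upsilon> \<phi>' \<psi>'"
    by (rule equivariant_isoE[OF assms(2)])
  note 2 = equivariant_pairD[OF this]
  show ?thesis
    by (rule equivariant_isoI[OF regular_map_compose[OF 1(1) 2(1)] regular_map_compose[OF 2(2) 1(2)]])
      (use 1(3-7) 2(3-7) in simp_all)
qed

lemma equivariant_iso_cong:
  assumes "equivariant_iso X \<sigma> Y \<tau>" "\<And>x. x \<in> points X \<Longrightarrow> \<sigma> x = \<sigma>' x"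
    and "\<And>y. y \<in> points Y \<Longrightarrow> \<tau> y = \<tau>' y"
  shows "equivariant_iso X \<sigma>' Y \<tau>'"
proof -
  obtain \<phi> \<psi> where "equivariant_pair X \<sigma> Y \<tau> \<phi> \<psi>"
    by (rule equivariant_isoE[OF assms(1)])
  note 1 = equivariant_pairD[OF this]
  show ?thesis
    by (rule equivariant_isoI[OF 1(1-4)]) (use 1(5,7) assms(2,3) in auto)
qed

lemma equivariant_iso_fixed_point:
  assumes "equivariant_iso X \<sigma> Y \<tau>" "\<exists>x\<in>points X. \<sigma> x = x"
  shows "\<exists>y\<in>points Y. \<tau> y = y"
proof -
  obtain \<phi> \<psi> where "equivariant_pair X \<sigma> Y \<tau> \<phi> \<psi>" by (rule equivariant_isoE[OF assms(1)])
  note 1 = equivariant_pairD[OF this]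
  then show ?thesis using assms(2) by metis
qed

text \<open>The conjugation of \<open>X0\<close>, carried over to \<open>X\<close> by \<open>\<phi>\<close>, is the
  composition of an anti-regular map with two regular ones.\<close>

lemma real_form_transport:
  assumes X0: "variety \<real> X0" and \<phi>: "isomorphism UNIV X0 X \<phi>"
  obtains \<rho> where "anti_regular_map X X \<rho>" "\<And>x. x \<in> points X \<Longrightarrow> \<rho> (\<rho> x) = x"
    "equivariant_iso X0 (conj_point X0) X \<rho>"
proof -
  obtain \<psi> where 1: "regular_map UNIV X0 X \<phi>" "regular_map UNIV X X0 \<psi>"
    "\<And>x. x \<in> points X0 \<Longrightarrow> \<psi> (\<phi> x) = x" "\<And>y. y \<in> points X \<Longrightarrow> \<phi> (\<psi> y) = y"
    "\<And>x. x \<in> points X0 \<Longrightarrow> \<phi> x \<in> points X" "\<And>y. y \<in> points X \<Longrightarrow> \<psi> y \<in> points X0"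
    by (rule isomorphismE[OF \<phi>]) blast
  let ?\<rho> = "\<lambda>x. \<phi> (conj_point X0 (\<psi> x))"
  show thesis
  proof (rule that[of ?\<rho>])
    show "anti_regular_map X X ?\<rho>"
      by (rule anti_regular_regular_compose[OF
        regular_anti_regular_compose[OF 1(2) anti_regular_conj_point[OF X0]] 1(1)])
    show "?\<rho> (?\<rho> x) = x" if x: "x \<in> points X" for x
      using conj_point_involution[OF X0 1(6)[OF x]] conj_point_mem[OF X0 1(6)[OF x]] 1(3,4) x by simp
    show "equivariant_iso X0 (conj_point X0) X ?\<rho>"
    proof (rule equivariant_isoI[OF 1(1-4)])
      show "\<phi> (conj_point X0 x) = ?\<rho> (\<phi> x)" if "x \<in> points X0" for x
        using 1(3)[OF that] by simp
    qed
  qed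
qed

text \<open>The inverse of an equivariant isomorphism is equivariant as well, so that both maps descend to the
  reals.\<close>

lemma isomorphic_real_if_equivariant_iso:
  assumes X: "variety \<real> X" and Y: "variety \<real> Y"
    and "equivariant_iso X (conj_point X) Y (conj_point Y)"
  shows "isomorphic \<real> X Y"
proof -
  obtain \<phi> \<psi> where "equivariant_pair X (conj_point X) Y (conj_point Y) \<phi> \<psi>"
    by (rule equivariant_isoE[OF assms(3)])
  note 1 = equivariant_pairD[OF this]
  have "\<psi> (conj_point Y y) = conj_point X (\<psi> y)" if y: "y \<in> points Y" for y
    using 1(7)[OF 1(6)[OF y]] 1(4)[OF y] 1(3)[OF conj_point_mem[OF X 1(6)[OF y]]] by simp
  then have "isomorphism \<real> X Y \<phi>"
    by (intro isomorphismI[OF regular_map_descent[OF X Y 1(1)] regular_map_descent[OF Y X 1(2)]])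
      (use 1(3,4,7) in auto)
  then show ?thesis unfolding isomorphic_def by blast
qed

text \<open>For the sections in the definition of a quotient this is Galois descent for functions: the
  inverse of the pullback \<open>f \<mapsto> f \<circ> \<pi>\<close> is \<open>g \<mapsto> g \<circ> \<phi>\<close>, and
  \<open>g \<circ> \<phi>\<close> is defined over the reals exactly when g is invariant.\<close>

lemma corresponding_real_formI:
  assumes X0: "variety \<real> X0" and \<phi>: "isomorphism UNIV X0 X \<phi>"
    and inj: "\<And>c. c \<in> X \<Longrightarrow> inj_on (ccoord c) (cdom c)"
    and eq: "\<And>y. y \<in> points X0 \<Longrightarrow> \<phi> (conj_point X0 y) = \<rho> (\<phi> y)"
  shows "corresponding_real_form X \<rho> X0"
proof -
  obtain \<pi> where 1: "regular_map UNIV X0 X \<phi>" "regular_map UNIV X X0 \<pi>"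
    "\<pi> = inv_into (points X0) \<phi>"
    "\<And>x. x \<in> points X0 \<Longrightarrow> \<pi> (\<phi> x) = x" "\<And>y. y \<in> points X \<Longrightarrow> \<phi> (\<pi> y) = y"
    "\<And>x. x \<in> points X0 \<Longrightarrow> \<phi> x \<in> points X" "\<And>y. y \<in> points X \<Longrightarrow> \<pi> y \<in> points X0"
    by (rule isomorphismE[OF \<phi>]) blast
  have \<rho>: "\<rho> x \<in> points X \<and> \<pi> (\<rho> x) = conj_point X0 (\<pi> x)" if x: "x \<in> points X" for x
  proof -
    have "\<rho> x = \<phi> (conj_point X0 (\<pi> x))" using eq[OF 1(7)[OF x]] 1(5)[OF x] by simp
    then show ?thesis using 1(4,6) conj_point_mem[OF X0 1(7)[OF x]] by simp
  qed
  have pre: "preimage X0 \<phi> (preimage X \<pi> V) = V" if "V \<subseteq> points X0" for V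
    using that 1(4,6) by (auto simp: preimage_def)
  have "is_quotient X \<rho> X0 \<pi>"
    unfolding is_quotient_def
  proof (intro conjI ballI allI impI)
    show "\<exists>x\<in>points X. closed_point X0 (\<pi> x) = closed_point X0 y" if "y \<in> points X0" for y
      using 1(4,6)[OF that] by (intro bexI[of _ "\<phi> y"]) auto
    show "closed_point X0 (\<pi> x) = closed_point X0 (\<pi> x') \<longleftrightarrow> x' = x \<or> x' = \<rho> x"
      if x: "x \<in> points X" and x': "x' \<in> points X" for x x'
    proof -
      let ?c = "conj_point X0"
      have cc: "?c (?c (\<pi> x)) = \<pi> x"
        using conj_point_involution[OF X0] 1(7) x by blast
      have "closed_point X0 (\<pi> x) = closed_point X0 (\<pi> x') \<longleftrightarrow> \<pi> x' = \<pi> x \<or> \<pi> x' = ?c (\<pi> x)"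
        unfolding closed_point_def using cc by (auto simp: doubleton_eq_iff)
      also have "\<dots> \<longleftrightarrow> \<pi> x' = \<pi> x \<or> \<pi> x' = \<pi> (\<rho> x)" using \<rho>[OF x] by simp
      also have "\<dots> \<longleftrightarrow> x' = x \<or> x' = \<rho> x" using 1(5) x x' \<rho>[OF x] by metis
      finally show ?thesis .
    qed
    show "variety_open \<real> X0 V \<longleftrightarrow> variety_open UNIV X (preimage X \<pi> V)"
      if V: "V \<subseteq> points X0" "conj_point X0 ` V \<subseteq> V" for V
    proof
      show "variety_open UNIV X (preimage X \<pi> V)" if "variety_open \<real> X0 V"
        using 1(2) variety_open_complexify[OF that] unfolding regular_map_def by blast
      show "variety_open \<real> X0 V" if W: "variety_open UNIV X (preimage X \<pi> V)"
      proof (rule variety_open_descent[OF X0])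
        have "variety_open UNIV X0 (preimage X0 \<phi> (preimage X \<pi> V))"
          using 1(1) W unfolding regular_map_def by blast
        then show "variety_open UNIV X0 V" using pre[OF V(1)] by simp
      qed (use V(2) in blast)
    qed
    fix V assume V: "variety_open \<real> X0 V"
    let ?W = "preimage X \<pi> V"
    have Vs: "V \<subseteq> points X0" using V unfolding variety_open_def by blast
    note stable = variety_open_conj_stable[OF X0 V]
    have W: "x \<in> points X \<and> \<pi> x \<in> V \<and> \<rho> x \<in> ?W \<and> \<pi> (\<rho> x) = conj_point X0 (\<pi> x)"
      if "x \<in> ?W" for x
      using that \<rho>[of x] stable[of "\<pi> x"] by (simp add: preimage_def)
    have V\<phi>: "y \<in> points X0 \<and> \<phi> y \<in> ?W \<and> \<pi> (\<phi> y) = y" if "y \<in> V" for y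
      using that Vs 1(4,6) by (auto simp: preimage_def)
    have cong: "regular_fun UNIV X ?W f \<longleftrightarrow> regular_fun UNIV X ?W g"
      if fg: "\<And>x. x \<in> ?W \<Longrightarrow> f x = g x" for f g
    proof -
      have "regular_on UNIV (cdim c) (ccoord c ` (?W \<inter> cdom c)) (\<lambda>p. f (cinv c p)) \<longleftrightarrow>
          regular_on UNIV (cdim c) (ccoord c ` (?W \<inter> cdom c)) (\<lambda>p. g (cinv c p))" if "c \<in> X" for c
        by (rule regular_on_cong[OF refl]) (use fg cinv_ccoord[OF inj[OF that]] in auto)
      then show ?thesis unfolding regular_fun_def by blast
    qed
    let ?A = "{f \<in> extensional V. regular_fun \<real> X0 V f}"
    let ?B = "{g \<in> extensional ?W. regular_fun UNIV X ?W g \<and> (\<forall>x\<in>?W. cnj (g (\<rho> x)) = g x)}"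
    show "bij_betw (\<lambda>f. restrict (\<lambda>x. f (\<pi> x)) ?W) ?A ?B"
    proof (rule bij_betwI[where g = "\<lambda>g. restrict (\<lambda>y. g (\<phi> y)) V"])
      show "(\<lambda>f. restrict (\<lambda>x. f (\<pi> x)) ?W) \<in> ?A \<rightarrow> ?B"
      proof
        fix f assume f: "f \<in> ?A"
        have "regular_fun UNIV X ?W (\<lambda>x. f (\<pi> x))"
          using 1(2) variety_open_complexify[OF V] regular_fun_complexify[of X0 V f] f
          unfolding regular_map_def by blast
        then have "regular_fun UNIV X ?W (restrict (\<lambda>x. f (\<pi> x)) ?W)"
          using cong[of "restrict (\<lambda>x. f (\<pi> x)) ?W" "\<lambda>x. f (\<pi> x)"] by simp
        moreover have "f (conj_point X0 y) = cnj (f y)" if "y \<in> V" for y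
          by (rule regular_fun_conj[OF X0 Vs stable _ that]) (use f in auto)
        ultimately show "restrict (\<lambda>x. f (\<pi> x)) ?W \<in> ?B" using W by simp
      qed
      show "(\<lambda>g. restrict (\<lambda>y. g (\<phi> y)) V) \<in> ?B \<rightarrow> ?A"
      proof
        fix g assume g: "g \<in> ?B"
        have Wo: "variety_open UNIV X ?W"
          using 1(2) variety_open_complexify[OF V] unfolding regular_map_def by blast
        have "regular_fun UNIV X0 (preimage X0 \<phi> ?W) (\<lambda>y. g (\<phi> y))"
          using 1(1) Wo g unfolding regular_map_def by blast
        then have r: "regular_fun UNIV X0 V (\<lambda>y. g (\<phi> y))" using pre[OF Vs] by simp
        have "regular_fun \<real> X0 V (\<lambda>y. g (\<phi> y))"
        proof (rule regular_fun_descent[OF X0 stable r])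
          show "g (\<phi> (conj_point X0 y)) = cnj (g (\<phi> y))" if "y \<in> V" for y
          proof -
            have "cnj (g (\<rho> (\<phi> y))) = g (\<phi> y)" using g V\<phi>[OF that] by blast
            then have "g (\<rho> (\<phi> y)) = cnj (g (\<phi> y))" by (metis complex_cnj_cnj)
            then show ?thesis using eq V\<phi>[OF that] by simp
          qed
        qed
        moreover have "regular_on \<real> (cdim c) (ccoord c ` (V \<inter> cdom c)) (\<lambda>p. g (\<phi> (cinv c p))) \<longleftrightarrow>
            regular_on \<real> (cdim c) (ccoord c ` (V \<inter> cdom c)) (\<lambda>p. restrict (\<lambda>y. g (\<phi> y)) V (cinv c p))"
          if "c \<in> X0" for c
          by (rule regular_on_cong[OF refl])
            (use cinv_ccoord[OF variety_chart(1)[OF X0 that]] in auto)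
        ultimately have "regular_fun \<real> X0 V (restrict (\<lambda>y. g (\<phi> y)) V)"
          unfolding regular_fun_def by blast
        then show "restrict (\<lambda>y. g (\<phi> y)) V \<in> ?A" by simp
      qed
      show "restrict (\<lambda>y. restrict (\<lambda>x. f (\<pi> x)) ?W (\<phi> y)) V = f" if "f \<in> ?A" for f
        using that V\<phi> by (intro extensionalityI[of _ V]) auto
      show "restrict (\<lambda>x. restrict (\<lambda>y. g (\<phi> y)) V (\<pi> x)) ?W = g" if "g \<in> ?B" for g
        using that W 1(5) by (intro extensionalityI[of _ ?W]) auto
    qed
  qed (use X0 1(2) in auto)
  then show ?thesis
    unfolding corresponding_real_form_def real_form_def using X0 \<phi> 1(3) by blast
qed

section \<open>Real varieties with one chart\<close>

definition chart_prod :: "'a chart \<Rightarrow> 'b chart \<Rightarrow> ('a \<times> 'b) chart" where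
  "chart_prod c d = \<lparr>cdom = cdom c \<times> cdom d, cdim = cdim c + cdim d,
     ccoord = (\<lambda>(x, y). ccoord c x @ ccoord d y)\<rparr>"

lemma chart_prod_sel [simp]:
  "cdom (chart_prod c d) = cdom c \<times> cdom d"
  "cdim (chart_prod c d) = cdim c + cdim d"
  "ccoord (chart_prod c d) = (\<lambda>(x, y). ccoord c x @ ccoord d y)"
  by (simp_all add: chart_prod_def)

lemma variety_prod_single: "variety_prod {c} {d} = {chart_prod c d}"
  by (simp add: variety_prod_def chart_prod_def)

lemma inj_on_chart_prod:
  assumes "inj_on (ccoord c) (cdom c)" "inj_on (ccoord d) (cdom d)"
    and "ccoord c ` cdom c \<subseteq> affine_space (cdim c)"
  shows "inj_on (ccoord (chart_prod c d)) (cdom (chart_prod c d))"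
proof (rule inj_onI)
  fix u v
  assume "u \<in> cdom (chart_prod c d)" "v \<in> cdom (chart_prod c d)"
    and eq: "ccoord (chart_prod c d) u = ccoord (chart_prod c d) v"
  then obtain x y x' y' where uv: "u = (x, y)" "v = (x', y')"
    and mem: "x \<in> cdom c" "x' \<in> cdom c" "y \<in> cdom d" "y' \<in> cdom d" by auto
  have "length (ccoord c x) = length (ccoord c x')"
    using assms(3) mem by (auto simp: affine_space_def image_subset_iff)
  then have "ccoord c x = ccoord c x' \<and> ccoord d y = ccoord d y'" using eq uv by simp
  then show "u = v" using uv mem assms(1,2) by (auto simp: inj_on_def)
qed

lemma regular_on_eqI:
  "regular_on K n Z f \<Longrightarrow> (\<And>p. p \<in> Z \<Longrightarrow> f p = g p) \<Longrightarrow> regular_on K n Z g"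
  using regular_on_cong[OF refl, of Z f g] by blast

lemma regular_on_precompose:
  assumes "regular_on K n Z f" "\<And>i. i < n \<Longrightarrow> (\<lambda>q. G q ! i) \<in> polys K m"
    and G: "\<And>q. q \<in> Z' \<Longrightarrow> G q \<in> Z"
  shows "regular_on K m Z' (\<lambda>q. f (G q))"
proof (rule regular_onI)
  fix p assume p: "p \<in> Z'"
  obtain P Q where PQ: "P \<in> polys K n" "Q \<in> polys K n" "Q (G p) \<noteq> 0"
    "\<forall>q\<in>Z. Q q \<noteq> 0 \<longrightarrow> f q = P q / Q q" by (rule regular_onD[OF assms(1) G[OF p]])
  have "(\<lambda>q. P (G q)) \<in> polys K m" "(\<lambda>q. Q (G q)) \<in> polys K m"
    using polys_compose[OF PQ(1) assms(2)] polys_compose[OF PQ(2) assms(2)] by blast+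
  then show "\<exists>P\<in>polys K m. \<exists>Q\<in>polys K m. Q p \<noteq> 0 \<and> (\<forall>q\<in>Z'. Q q \<noteq> 0 \<longrightarrow> f (G q) = P q / Q q)"
    by (intro bexI[of _ "\<lambda>q. P (G q)"] bexI[of _ "\<lambda>q. Q (G q)"]) (use PQ(3,4) G in auto)
qed

text \<open>The coordinates of the two factors of a product; written with indices instead of \<open>take\<close>
  and \<open>drop\<close>, since a polynomial is a function on lists of all lengths.\<close>

definition fst_coords :: "nat \<Rightarrow> complex list \<Rightarrow> complex list" where
  "fst_coords n r = map (\<lambda>i. r ! i) [0..<n]"

definition snd_coords :: "nat \<Rightarrow> nat \<Rightarrow> complex list \<Rightarrow> complex list" where
  "snd_coords n m r = map (\<lambda>i. r ! (n + i)) [0..<m]"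

lemma fst_coords_append [simp]: "length p = n \<Longrightarrow> fst_coords n (p @ q) = p"
  unfolding fst_coords_def by (rule nth_equalityI) (auto simp: nth_append)

lemma snd_coords_append [simp]: "length p = n \<Longrightarrow> length q = m \<Longrightarrow> snd_coords n m (p @ q) = q"
  unfolding snd_coords_def by (rule nth_equalityI) (auto simp: nth_append)

lemma fst_coords_polys: "i < n \<Longrightarrow> (\<lambda>r. fst_coords n r ! i) \<in> polys K (n + m)"
  using polys.coord[of i "n + m" K] by (simp add: fst_coords_def)

lemma snd_coords_polys: "i < m \<Longrightarrow> (\<lambda>r. snd_coords n m r ! i) \<in> polys K (n + m)"
  using polys.coord[of "n + i" "n + m" K] by (simp add: snd_coords_def)

lemma cinv_chart_prod:
  assumes "inj_on (ccoord c) (cdom c)" "inj_on (ccoord d) (cdom d)"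
    and "ccoord c ` cdom c \<subseteq> affine_space (cdim c)"
    and "x \<in> cdom c" "y \<in> cdom d"
  shows "cinv (chart_prod c d) (ccoord c x @ ccoord d y) = (x, y)"
  using cinv_ccoord[OF inj_on_chart_prod[OF assms(1-3)], of "(x, y)"] assms by simp

text \<open>A coordinate of the product map is a coordinate of one of the two maps, composed with a
  projection.\<close>

lemma regular_map_prod:
  assumes K: "1 \<in> K"
    and c: "inj_on (ccoord c) (cdom c)" "ccoord c ` cdom c \<subseteq> affine_space (cdim c)"
    and c': "inj_on (ccoord c') (cdom c')" "ccoord c' ` cdom c' \<subseteq> affine_space (cdim c')"
    and d: "inj_on (ccoord d) (cdom d)" "ccoord d ` cdom d \<subseteq> affine_space (cdim d)"
    and d': "inj_on (ccoord d') (cdom d')"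
    and \<phi>: "regular_map K {c} {d} \<phi>" and \<phi>': "regular_map K {c'} {d'} \<phi>'"
  shows "regular_map K {chart_prod c c'} {chart_prod d d'} (map_prod \<phi> \<phi>')"
proof (rule regular_map_singleI[OF K inj_on_chart_prod[OF c(1) c'(1) c(2)] inj_on_chart_prod[OF d(1) d' d(2)]])
  have mem: "\<phi> x \<in> cdom d" if "x \<in> cdom c" for x using regular_map_mem[OF \<phi>] that by simp
  have mem': "\<phi>' x \<in> cdom d'" if "x \<in> cdom c'" for x using regular_map_mem[OF \<phi>'] that by simp
  show "map_prod \<phi> \<phi>' u \<in> cdom (chart_prod d d')" if "u \<in> cdom (chart_prod c c')" for u
    using that mem mem' by auto
  fix i assume i: "i < cdim (chart_prod d d')"
  let ?n = "cdim c" and ?m = "cdim c'"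
  let ?Z = "ccoord (chart_prod c c') ` cdom (chart_prod c c')"
  have Z: "fst_coords ?n r = ccoord c x \<and> snd_coords ?n ?m r = ccoord c' y"
    if "x \<in> cdom c" "y \<in> cdom c'" "r = ccoord c x @ ccoord c' y" for r x y
    using that c(2) c'(2) by (auto simp: affine_space_def image_subset_iff)
  have len: "length (ccoord d (\<phi> x)) = cdim d" if "x \<in> cdom c" for x
    using mem[OF that] d(2) by (auto simp: affine_space_def)
  show "regular_on K (cdim (chart_prod c c')) ?Z
      (\<lambda>p. ccoord (chart_prod d d') (map_prod \<phi> \<phi>' (cinv (chart_prod c c') p)) ! i)"
  proof (cases "i < cdim d")
    case True
    have "regular_on K (cdim (chart_prod c c')) ?Z (\<lambda>r. ccoord d (\<phi> (cinv c (fst_coords ?n r))) ! i)"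
      unfolding chart_prod_sel(2)
      by (rule regular_on_precompose[OF regular_map_coord[OF K \<phi> True] fst_coords_polys])
        (use Z in auto)
    then show ?thesis
    proof (rule regular_on_eqI)
      fix r assume r: "r \<in> ?Z"
      show "ccoord d (\<phi> (cinv c (fst_coords ?n r))) ! i =
        ccoord (chart_prod d d') (map_prod \<phi> \<phi>' (cinv (chart_prod c c') r)) ! i"
      proof -
      obtain x y where xy: "x \<in> cdom c" "y \<in> cdom c'" "r = ccoord c x @ ccoord c' y"
        using r by auto
      then show ?thesis
        using Z[OF xy] cinv_chart_prod[OF c(1) c'(1) c(2) xy(1,2)] cinv_ccoord[OF c(1) xy(1)]
          len[OF xy(1)] True by (simp add: nth_append)
      qed
    qed
  next
    case False
    then have i': "i - cdim d < cdim d'" using i by simp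
    have "regular_on K (cdim (chart_prod c c')) ?Z (\<lambda>r. ccoord d' (\<phi>' (cinv c' (snd_coords ?n ?m r))) ! (i - cdim d))"
      unfolding chart_prod_sel(2)
      by (rule regular_on_precompose[OF regular_map_coord[OF K \<phi>' i'] snd_coords_polys])
        (use Z in auto)
    then show ?thesis
    proof (rule regular_on_eqI)
      fix r assume r: "r \<in> ?Z"
      show "ccoord d' (\<phi>' (cinv c' (snd_coords ?n ?m r))) ! (i - cdim d) =
        ccoord (chart_prod d d') (map_prod \<phi> \<phi>' (cinv (chart_prod c c') r)) ! i"
      proof -
      obtain x y where xy: "x \<in> cdom c" "y \<in> cdom c'" "r = ccoord c x @ ccoord c' y"
        using r by auto
      then show ?thesis
        using Z[OF xy] cinv_chart_prod[OF c(1) c'(1) c(2) xy(1,2)] cinv_ccoord[OF c'(1) xy(2)]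
          len[OF xy(1)] False by (simp add: nth_append)
      qed
    qed
  qed
qed

text \<open>Outside of a product of two open sets all the products \<open>P(x) Q(y)\<close> vanish, where
  \<open>P\<close> and \<open>Q\<close> run through the equations of the two complements, and conversely.\<close>

lemma locally_closed_append:
  assumes "locally_closed K n Z" "locally_closed K m W"
  shows "locally_closed K (n + m) {p @ q | p q. p \<in> Z \<and> q \<in> W}"
proof -
  obtain Y where "zclosed_in K n (affine_space n) Y" "zopen_in K n Y Z"
    using assms(1) unfolding locally_closed_def by (elim exE conjE)
  then obtain T S where Y: "T \<subseteq> polys K n" "Y = {p \<in> affine_space n. \<forall>P\<in>T. P p = 0}"
    and S: "S \<subseteq> polys K n" "Z \<subseteq> Y" "Y - Z = {p \<in> Y. \<forall>P\<in>S. P p = 0}"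
    unfolding zopen_in_def zclosed_in_def by (elim exE conjE)
  obtain Y' where "zclosed_in K m (affine_space m) Y'" "zopen_in K m Y' W"
    using assms(2) unfolding locally_closed_def by (elim exE conjE)
  then obtain T' S' where Y': "T' \<subseteq> polys K m" "Y' = {p \<in> affine_space m. \<forall>P\<in>T'. P p = 0}"
    and S': "S' \<subseteq> polys K m" "W \<subseteq> Y'" "Y' - W = {p \<in> Y'. \<forall>P\<in>S'. P p = 0}"
    unfolding zopen_in_def zclosed_in_def by (elim exE conjE)
  have lift1: "(\<lambda>r. P (fst_coords n r)) \<in> polys K (n + m)" if "P \<in> polys K n" for P
    by (rule polys_compose[OF that fst_coords_polys])
  have lift2: "(\<lambda>r. P (snd_coords n m r)) \<in> polys K (n + m)" if "P \<in> polys K m" for P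
    by (rule polys_compose[OF that snd_coords_polys])
  define A where "A = (\<lambda>P r. P (fst_coords n r)) ` T \<union> (\<lambda>P r. P (snd_coords n m r)) ` T'"
  define B where "B = (\<lambda>(P, Q) r. P (fst_coords n r) * Q (snd_coords n m r)) ` (S \<times> S')"
  define YY where "YY = {p @ q | p q. p \<in> Y \<and> q \<in> Y'}"
  define ZZ where "ZZ = {p @ q | p q. p \<in> Z \<and> q \<in> W}"
  have A: "A \<subseteq> polys K (n + m)" using Y(1) Y'(1) lift1 lift2 unfolding A_def by blast
  have B: "B \<subseteq> polys K (n + m)"
    using S(1) S'(1) polys.mult[OF lift1 lift2] unfolding B_def by fast
  have A0: "(\<forall>P\<in>A. P (p @ q) = 0) \<longleftrightarrow> (\<forall>P\<in>T. P p = 0) \<and> (\<forall>P\<in>T'. P q = 0)"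
    if "length p = n" "length q = m" for p q
    unfolding A_def using that by (simp add: ball_Un)
  have B0: "(\<forall>P\<in>B. P (p @ q) = 0) \<longleftrightarrow> (\<forall>P\<in>S. P p = 0) \<or> (\<forall>P\<in>S'. P q = 0)"
    if "length p = n" "length q = m" for p q
    unfolding B_def using that by auto
  have split: "\<exists>p q. r = p @ q \<and> length p = n \<and> length q = m" if "length r = n + m" for r :: "complex list"
    using that by (intro exI[of _ "take n r"] exI[of _ "drop n r"]) auto
  have YY: "YY = {r \<in> affine_space (n + m). \<forall>P\<in>A. P r = 0}"
  proof (intro set_eqI iffI)
    fix r assume "r \<in> YY"
    then obtain p q where "r = p @ q" "p \<in> Y" "q \<in> Y'" unfolding YY_def by blast
    then show "r \<in> {r \<in> affine_space (n + m). \<forall>P\<in>A. P r = 0}"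
      using Y(2) Y'(2) A0[of p q] by (simp add: affine_space_def)
  next
    fix r assume r: "r \<in> {r \<in> affine_space (n + m). \<forall>P\<in>A. P r = 0}"
    then obtain p q where pq: "r = p @ q" "length p = n" "length q = m"
      using split[of r] by (auto simp: affine_space_def)
    then have "p \<in> Y" "q \<in> Y'" using A0[OF pq(2,3)] r Y(2) Y'(2) by (simp_all add: affine_space_def)
    then show "r \<in> YY" using pq unfolding YY_def by blast
  qed
  have inY: "p \<in> Z \<longleftrightarrow> \<not> (\<forall>P\<in>S. P p = 0)" if "p \<in> Y" for p using S(2,3) that by blast
  have inY': "p \<in> W \<longleftrightarrow> \<not> (\<forall>P\<in>S'. P p = 0)" if "p \<in> Y'" for p using S'(2,3) that by blast
  have ZZ: "YY - ZZ = {r \<in> YY. \<forall>P\<in>B. P r = 0}"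
  proof -
    have "p @ q \<in> ZZ \<longleftrightarrow> \<not> (\<forall>P\<in>B. P (p @ q) = 0)" if pq: "p \<in> Y" "q \<in> Y'" for p q
    proof -
      have len: "length p = n" "length q = m" using pq Y(2) Y'(2) by (auto simp: affine_space_def)
      have "p @ q \<in> ZZ \<longleftrightarrow> p \<in> Z \<and> q \<in> W"
      proof
        assume "p @ q \<in> ZZ"
        then obtain p' q' where e: "p @ q = p' @ q'" "p' \<in> Z" "q' \<in> W" unfolding ZZ_def by blast
        then have "length p' = n" using S(2) Y(2) by (auto simp: affine_space_def)
        then show "p \<in> Z \<and> q \<in> W" using e len by simp
      qed (auto simp: ZZ_def)
      then show ?thesis using B0[OF len] inY[OF pq(1)] inY'[OF pq(2)] by simp
    qed
    then have "r \<in> ZZ \<longleftrightarrow> \<not> (\<forall>P\<in>B. P r = 0)" if "r \<in> YY" for r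
      using that unfolding YY_def by fast
    then show ?thesis by blast
  qed
  have "zclosed_in K (n + m) (affine_space (n + m)) YY" unfolding zclosed_in_def using YY A by (intro exI[of _ A] conjI)
  moreover have "zopen_in K (n + m) YY ZZ"
    unfolding zopen_in_def zclosed_in_def 
  proof (intro conjI exI[of _ B])
    show "ZZ \<subseteq> YY" using S(2) S'(2) unfolding YY_def ZZ_def by blast
  qed (rule B ZZ)+
  ultimately show ?thesis unfolding locally_closed_def ZZ_def by blast
qed

text \<open>The diagonal is cut out by the differences of the coordinates of the two points.\<close>

lemma variety_single:
  assumes K: "1 \<in> K" "- 1 \<in> K" and c: "inj_on (ccoord c) (cdom c)"
    and lc: "locally_closed K (cdim c) (ccoord c ` cdom c)"
  shows "variety K {c}"
proof -
  let ?n = "cdim c" and ?Z = "ccoord c ` cdom c"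
  have len: "length (ccoord c x) = ?n" if "x \<in> cdom c" for x
    using locally_closed_affine[OF lc] that by (auto simp: affine_space_def)
  have reg: "regular_on K ?n ?Z (\<lambda>p. ccoord c (cinv c p) ! i)" if "i < ?n" for i
    using regular_fun_coord[OF K(1) that] by (simp add: regular_fun_single_iff)
  define S where "S = (\<lambda>i (p :: complex list). p ! i + (- 1) * p ! (?n + i)) ` {..<?n}"
  have "(\<lambda>p. p ! i + (- 1) * p ! (?n + i)) \<in> polys K (?n + ?n)" if "i < ?n" for i
    by (rule polys.add[OF polys.coord polys.mult[OF polys.const polys.coord]]) (use K that in auto)
  then have S: "S \<subseteq> polys K (?n + ?n)" unfolding S_def by blast
  have S0: "(\<forall>P\<in>S. P (ccoord c x @ ccoord c y) = 0) \<longleftrightarrow> x = y"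
    if xy: "x \<in> cdom c" "y \<in> cdom c" for x y
  proof -
    have "(\<forall>P\<in>S. P (ccoord c x @ ccoord c y) = 0) \<longleftrightarrow> (\<forall>i<?n. ccoord c x ! i = ccoord c y ! i)"
      unfolding S_def using len xy by (auto simp: nth_append)
    also have "\<dots> \<longleftrightarrow> ccoord c x = ccoord c y" using len xy by (simp add: list_eq_iff_nth_eq)
    also have "\<dots> \<longleftrightarrow> x = y" using c xy by (auto simp: inj_on_def)
    finally show ?thesis .
  qed
  have "zclosed_in K (?n + ?n) {ccoord c x @ ccoord c y | x y. x \<in> cdom c \<and> y \<in> cdom c}
      {ccoord c x @ ccoord c x | x. x \<in> cdom c}"
    unfolding zclosed_in_def
  proof (intro exI[of _ S] conjI S set_eqI iffI)
    fix r assume "r \<in> {ccoord c x @ ccoord c x | x. x \<in> cdom c}"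
    then obtain x where "x \<in> cdom c" "r = ccoord c x @ ccoord c x" by blast
    then show "r \<in> {p \<in> {ccoord c x @ ccoord c y | x y. x \<in> cdom c \<and> y \<in> cdom c}. \<forall>P\<in>S. P p = 0}"
      using S0[of x x] by blast
  next
    fix r assume "r \<in> {p \<in> {ccoord c x @ ccoord c y | x y. x \<in> cdom c \<and> y \<in> cdom c}. \<forall>P\<in>S. P p = 0}"
    then obtain x y where "x \<in> cdom c" "y \<in> cdom c" "r = ccoord c x @ ccoord c y" "\<forall>P\<in>S. P r = 0"
      by blast
    then show "r \<in> {ccoord c x @ ccoord c x | x. x \<in> cdom c}" using S0[of x y] by blast
  qed
  then show ?thesis unfolding variety_def using c lc reg by (simp add: zopen_in_whole[OF K(1)])
qed

lemma variety_chart_prod: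
  assumes K: "1 \<in> K" "- 1 \<in> K" and "variety K {c}" "variety K {d}"
  shows "variety K {chart_prod c d}"
proof (rule variety_single[OF K])
  note c = variety_chart[OF assms(3) singletonI] and d = variety_chart[OF assms(4) singletonI]
  show "inj_on (ccoord (chart_prod c d)) (cdom (chart_prod c d))"
    by (rule inj_on_chart_prod[OF c(1) d(1) c(3)])
  have "ccoord (chart_prod c d) ` cdom (chart_prod c d) =
      {p @ q | p q. p \<in> ccoord c ` cdom c \<and> q \<in> ccoord d ` cdom d}" by force
  then show "locally_closed K (cdim (chart_prod c d)) (ccoord (chart_prod c d) ` cdom (chart_prod c d))"
    using locally_closed_append[OF c(2) d(2)] by simp
qed

lemma conj_point_chart_prod:
  assumes "variety \<real> {c}" "variety \<real> {d}" "x \<in> cdom c" "y \<in> cdom d"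
  shows "conj_point {chart_prod c d} (x, y) = (conj_point {c} x, conj_point {d} y)"
proof -
  have v: "variety \<real> {chart_prod c d}" by (rule variety_chart_prod) (use assms in auto)
  note 1 = conj_point_chart[OF v singletonI, of "(x, y)"]
  note 2 = conj_point_chart[OF assms(1) singletonI assms(3)]
  note 3 = conj_point_chart[OF assms(2) singletonI assms(4)]
  show ?thesis
    using inj_onD[OF variety_chart(1)[OF v singletonI],
      of "conj_point {chart_prod c d} (x, y)" "(conj_point {c} x, conj_point {d} y)"]
      1 2 3 assms by simp
qed

lemma equivariant_iso_prod:
  assumes c: "inj_on (ccoord c) (cdom c)" "ccoord c ` cdom c \<subseteq> affine_space (cdim c)"
    and c': "inj_on (ccoord c') (cdom c')" "ccoord c' ` cdom c' \<subseteq> affine_space (cdim c')"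
    and d: "inj_on (ccoord d) (cdom d)" "ccoord d ` cdom d \<subseteq> affine_space (cdim d)"
    and d': "inj_on (ccoord d') (cdom d')" "ccoord d' ` cdom d' \<subseteq> affine_space (cdim d')"
    and "equivariant_iso {c} \<sigma> {d} \<tau>" "equivariant_iso {c'} \<sigma>' {d'} \<tau>'"
  shows "equivariant_iso {chart_prod c c'} (map_prod \<sigma> \<sigma>') {chart_prod d d'} (map_prod \<tau> \<tau>')"
proof -
  obtain \<phi> \<psi> where "equivariant_pair {c} \<sigma> {d} \<tau> \<phi> \<psi>"
    by (rule equivariant_isoE[OF assms(9)])
  note 1 = equivariant_pairD[OF this]
  obtain \<phi>' \<psi>' where "equivariant_pair {c'} \<sigma>' {d'} \<tau>' \<phi>' \<psi>'"
    by (rule equivariant_isoE[OF assms(10)])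
  note 2 = equivariant_pairD[OF this]
  show ?thesis
    by (rule equivariant_isoI[OF regular_map_prod[OF UNIV_I c c' d d'(1) 1(1) 2(1)]
      regular_map_prod[OF UNIV_I d d' c c'(1) 1(2) 2(2)]])
      (use 1(3,4,7) 2(3,4,7) in auto)
qed

text \<open>The coordinates of the target pull back to real regular functions on the source, and these
  commute with conjugation.\<close>

lemma equivariant_iso_if_isomorphic_real:
  assumes c: "variety \<real> {c}" and d: "variety \<real> {d}" and "isomorphic \<real> {c} {d}"
  shows "equivariant_iso {c} (conj_point {c}) {d} (conj_point {d})"
proof -
  obtain \<phi> where \<phi>: "isomorphism \<real> {c} {d} \<phi>" using assms(3) unfolding isomorphic_def by blast
  obtain \<psi> where 1: "regular_map \<real> {c} {d} \<phi>" "regular_map \<real> {d} {c} \<psi>"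
    "\<And>x. x \<in> points {c} \<Longrightarrow> \<psi> (\<phi> x) = x" "\<And>y. y \<in> points {d} \<Longrightarrow> \<phi> (\<psi> y) = y"
    "\<And>x. x \<in> points {c} \<Longrightarrow> \<phi> x \<in> points {d}" "\<And>y. y \<in> points {d} \<Longrightarrow> \<psi> y \<in> points {c}"
    by (rule isomorphismE[OF \<phi>]) blast
  note vc = variety_chart[OF c singletonI] and vd = variety_chart[OF d singletonI]
  have U: "regular_map UNIV {c} {d} \<phi>" "regular_map UNIV {d} {c} \<psi>"
    using regular_map_single_mono_field[of \<real> UNIV c d \<phi>] regular_map_single_mono_field[of \<real> UNIV d c \<psi>]
      1(1,2) vc(1) vd(1) by auto
  have "\<phi> (conj_point {c} x) = conj_point {d} (\<phi> x)" if x: "x \<in> points {c}" for x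
  proof -
    have cx: "conj_point {c} x \<in> points {c}" by (rule conj_point_mem[OF c x])
    have mem: "\<phi> x \<in> cdom d" "\<phi> (conj_point {c} x) \<in> cdom d" using 1(5) x cx by auto
    note pd = conj_point_chart[OF d singletonI mem(1)]
    have len: "length (ccoord d y) = cdim d" if "y \<in> cdom d" for y
      using vd(3) that by (auto simp: affine_space_def)
    have "ccoord d (\<phi> (conj_point {c} x)) = map cnj (ccoord d (\<phi> x))"
    proof (rule nth_equalityI)
      fix i assume "i < length (ccoord d (\<phi> (conj_point {c} x)))"
      then have i: "i < cdim d" using len mem by simp
      have reg: "regular_fun \<real> {c} (points {c}) (\<lambda>x. ccoord d (\<phi> x) ! i)"
        using regular_map_pullback[OF 1(1), of "\<lambda>y. ccoord d y ! i"] regular_fun_coord[OF _ i] by simp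
      have "ccoord d (\<phi> (conj_point {c} x)) ! i = cnj (ccoord d (\<phi> x) ! i)"
        using regular_fun_conj[OF c subset_refl conj_point_mem[OF c] reg x] .
      then show "ccoord d (\<phi> (conj_point {c} x)) ! i = map cnj (ccoord d (\<phi> x)) ! i"
        using i len mem by simp
    qed (use len mem in simp)
    then show ?thesis using pd inj_onD[OF vd(1)] mem by metis
  qed
  then show ?thesis by (intro equivariant_isoI[OF U 1(3,4)])
qed

section \<open>Units on the torus\<close>

lemma poly_monomial_if_no_nonzero_root:
  fixes p :: "complex poly"
  assumes "p \<noteq> 0" "\<And>t. t \<noteq> 0 \<Longrightarrow> poly p t \<noteq> 0"
  shows "\<exists>c k. c \<noteq> 0 \<and> (\<forall>t. poly p t = c * t ^ k)"
proof -
  obtain q where q: "p = [:- 0, 1:] ^ order 0 p * q" "\<not> [:- 0, 1:] dvd q"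
    using order_decomp[OF assms(1)] by blast
  have "poly q t \<noteq> 0" for t
  proof (cases "t = 0")
    case True
    then show ?thesis using q(2) poly_eq_0_iff_dvd[of q 0] by simp
  next
    case False
    then show ?thesis using assms(2)[OF False] q(1) by (metis mult_zero_right poly_mult)
  qed
  then obtain c where "c \<noteq> 0" "q = [:c:]" using fundamental_theorem_of_algebra_alt[of q] by auto
  then have "poly p t = c * t ^ order 0 p" for t
    using arg_cong[OF q(1), of "\<lambda>p. poly p t"] by simp
  then show ?thesis using \<open>c \<noteq> 0\<close> by blast
qed

lemma poly_eq_if_eq_on_cofinite:
  fixes p q :: "complex poly"
  assumes "finite S" "\<And>t. t \<notin> S \<Longrightarrow> poly p t = poly q t"
  shows "p = q"
proof (rule ccontr)
  assume "p \<noteq> q"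
  then have "finite {t. poly (p - q) t = 0}" by (intro poly_roots_finite) simp
  moreover have "- S \<subseteq> {t. poly (p - q) t = 0}" using assms(2) by auto
  ultimately have "finite (- S)" by (rule finite_subset[rotated])
  then show False using assms(1) infinite_UNIV_char_0[where 'a = complex] by simp
qed

text \<open>A denominator \<open>q\<close> of minimal degree with \<open>f q = p\<close> has no zero off the
  origin: at such a zero \<open>t\<^sub>1\<close> a linear factor cancels from \<open>p\<close> and
  \<open>q\<close>, and a local representation of \<open>f\<close> around \<open>t\<^sub>1\<close> shows that the
  equation still holds at \<open>t\<^sub>1\<close> itself.\<close>

lemma unit_on_punctured_line:
  fixes f :: "complex \<Rightarrow> complex"
  assumes loc: "\<And>t\<^sub>0. t\<^sub>0 \<noteq> 0 \<Longrightarrow> \<exists>p q. poly q t\<^sub>0 \<noteq> 0 \<and>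
      (\<forall>t. t \<noteq> 0 \<longrightarrow> poly q t \<noteq> 0 \<longrightarrow> f t = poly p t / poly q t)"
    and nz: "\<And>t. t \<noteq> 0 \<Longrightarrow> f t \<noteq> 0"
  shows "\<exists>a n. a \<noteq> 0 \<and> (\<forall>t. t \<noteq> 0 \<longrightarrow> f t = a * t powi n)"
proof -
  define denom where "denom q \<longleftrightarrow> q \<noteq> 0 \<and> (\<exists>p. \<forall>t. t \<noteq> 0 \<longrightarrow> f t * poly q t = poly p t)" for q
  have glob: "\<exists>A B. poly B t\<^sub>0 \<noteq> 0 \<and> (\<forall>t. t \<noteq> 0 \<longrightarrow> f t * poly B t = poly A t)"
    if t0: "t\<^sub>0 \<noteq> 0" for t\<^sub>0
  proof -
    obtain p q where pq: "poly q t\<^sub>0 \<noteq> 0"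
      "\<forall>t. t \<noteq> 0 \<longrightarrow> poly q t \<noteq> 0 \<longrightarrow> f t = poly p t / poly q t" using loc[OF t0] by blast
    have "f t * poly (q * q) t = poly (p * q) t" if "t \<noteq> 0" for t
      using pq(2) that by (cases "poly q t = 0") auto
    then show ?thesis using pq(1) by (intro exI[of _ "p * q"] exI[of _ "q * q"]) simp
  qed
  obtain A B where "poly B 1 \<noteq> 0" "\<forall>t. t \<noteq> 0 \<longrightarrow> f t * poly B t = poly A t"
    using glob[OF one_neq_zero] by (elim exE conjE)
  then have "denom B" unfolding denom_def by auto
  then have "\<exists>q. denom q" ..
  then obtain q where q: "denom q" and min: "\<And>q'. denom q' \<Longrightarrow> degree q \<le> degree q'"
    using ex_has_least_nat[of denom _ degree] by blast
  then obtain p where p: "\<And>t. t \<noteq> 0 \<Longrightarrow> f t * poly q t = poly p t" and q0: "q \<noteq> 0"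
    unfolding denom_def by blast
  have qnz: "poly q t \<noteq> 0" if t: "t \<noteq> 0" for t
  proof
    assume qt: "poly q t = 0"
    then have "poly p t = 0" using p[OF t] by simp
    then obtain p' q' where p': "p = [:- t, 1:] * p'" and q': "q = [:- t, 1:] * q'"
      using qt by (metis dvdE poly_eq_0_iff_dvd)
    obtain A B where AB: "poly B t \<noteq> 0" "\<forall>s. s \<noteq> 0 \<longrightarrow> f s * poly B s = poly A s"
      using glob[OF t] by blast
    have off: "f s * poly q' s = poly p' s" if "s \<noteq> 0" "s \<noteq> t" for s
    proof -
      have "(s - t) * (f s * poly q' s) = (s - t) * poly p' s"
        using p[OF that(1)] p' q' by (simp add: algebra_simps)
      then show ?thesis using that by simp
    qed
    have "A * q' = B * p'"
    proof (rule poly_eq_if_eq_on_cofinite[of "{0, t}"])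
      fix s assume s: "s \<notin> {0, t}"
      have "poly A s = f s * poly B s" using AB s by simp
      moreover have "poly p' s = f s * poly q' s" using off[of s] s by simp
      ultimately show "poly (A * q') s = poly (B * p') s" by simp
    qed simp
    then have "poly A t * poly q' t = poly B t * poly p' t" by (metis poly_mult)
    then have "f t * poly q' t = poly p' t" using AB(1) t by (simp add: mult.commute mult.left_commute
      flip: AB(2)[rule_format, OF t])
    have "denom q'"
      unfolding denom_def
    proof (intro conjI exI[of _ p'] allI impI)
      show "q' \<noteq> 0" using q0 q' by auto
      show "f s * poly q' s = poly p' s" if "s \<noteq> 0" for s
        using off[OF that] \<open>f t * poly q' t = poly p' t\<close> by (cases "s = t") auto
    qed
    moreover have "degree q = Suc (degree q')" using q0 q' by (subst q', subst degree_mult_eq) auto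
    ultimately show False using min[of q'] by simp
  qed
  have "poly p t \<noteq> 0" if "t \<noteq> 0" for t using p[OF that] qnz[OF that] nz[OF that] by (metis mult_eq_0_iff)
  moreover from this[of 1] have "p \<noteq> 0" by auto
  ultimately obtain c k where c: "c \<noteq> 0" "\<And>t. poly p t = c * t ^ k"
    using poly_monomial_if_no_nonzero_root[of p] by blast
  obtain d l where d: "d \<noteq> 0" "\<And>t. poly q t = d * t ^ l"
    using poly_monomial_if_no_nonzero_root[of q] q0 qnz by blast
  have "f t = (c / d) * t powi (int k - int l)" if "t \<noteq> 0" for t
    using p[OF that] c d that by (simp add: power_int_diff field_simps)
  then show ?thesis using c(1) d(1) by (intro exI[of _ "c / d"] exI[of _ "int k - int l"]) simp
qed

lemma two_powi_inj: "(2 :: complex) powi m = 2 powi n \<Longrightarrow> m = n"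
proof -
  assume "(2 :: complex) powi m = 2 powi n"
  then have "norm ((2 :: complex) powi m) = norm ((2 :: complex) powi n)" by simp
  then have "(2 :: real) powi m = 2 powi n" by (simp add: norm_power_int)
  then show "m = n"
    using power_int_strict_increasing[of m n "2 :: real"] power_int_strict_increasing[of n m "2 :: real"]
    by (cases m n rule: linorder_cases) auto
qed

lemma one_variable_polys:
  assumes "P \<in> polys UNIV (Suc 0)"
  shows "\<exists>p. \<forall>t. P [t] = poly p t"
  using assms
proof induction
  case (const a)
  show ?case by (rule exI[of _ "[:a:]"]) simp
next
  case (coord i)
  then show ?case by (intro exI[of _ "[:0, 1:]"]) simp
next
  case (add P Q)
  then obtain p q where "\<forall>t. P [t] = poly p t" "\<forall>t. Q [t] = poly q t" by blast
  then show ?case by (intro exI[of _ "p + q"]) simp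
next
  case (mult P Q)
  then obtain p q where "\<forall>t. P [t] = poly p t" "\<forall>t. Q [t] = poly q t" by blast
  then show ?case by (intro exI[of _ "p * q"]) simp
qed

lemma regular_unit_1:
  assumes F: "regular_on UNIV (Suc 0) {[t] | t. t \<noteq> 0} F" "\<And>t. t \<noteq> 0 \<Longrightarrow> F [t] \<noteq> 0"
  shows "\<exists>a n. a \<noteq> 0 \<and> (\<forall>t. t \<noteq> 0 \<longrightarrow> F [t] = a * t powi n)"
proof (rule unit_on_punctured_line[OF _ F(2)])
  fix t\<^sub>0 :: complex assume t0: "t\<^sub>0 \<noteq> 0"
  have "[t\<^sub>0] \<in> {[t] | t. t \<noteq> 0}" using t0 by simp
  then obtain P Q where PQ: "P \<in> polys UNIV (Suc 0)" "Q \<in> polys UNIV (Suc 0)" "Q [t\<^sub>0] \<noteq> 0"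
    "\<forall>q\<in>{[t] | t. t \<noteq> 0}. Q q \<noteq> 0 \<longrightarrow> F q = P q / Q q" by (rule regular_onD[OF F(1)])
  obtain p where p: "\<forall>t. P [t] = poly p t" using one_variable_polys[OF PQ(1)] by (elim exE)
  obtain q where q: "\<forall>t. Q [t] = poly q t" using one_variable_polys[OF PQ(2)] by (elim exE)
  have "F [t] = poly p t / poly q t" if "t \<noteq> 0" "poly q t \<noteq> 0" for t
    using bspec[OF PQ(4), of "[t]"] that p q by simp
  moreover have "poly q t\<^sub>0 \<noteq> 0" using PQ(3) q by simp
  ultimately show "\<exists>p q. poly q t\<^sub>0 \<noteq> 0 \<and>
      (\<forall>t. t \<noteq> 0 \<longrightarrow> poly q t \<noteq> 0 \<longrightarrow> F [t] = poly p t / poly q t)" by blast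
qed

text \<open>On every horizontal and every vertical line a unit of the two-dimensional torus is a
  monomial.  The exponents do not depend on the line: otherwise a relation
  \<open>2\<^sup>j = y\<^sup>k\<close> with \<open>k \<noteq> 0\<close> fixed would hold for all \<open>y\<close>, with an
  integer \<open>j\<close> depending on \<open>y\<close>, which fails if \<open>y\<^sup>k\<close> is the square root
  of 2.\<close>

lemma regular_unit_2:
  assumes F: "regular_on UNIV 2 {[x, y] | x y. x \<noteq> 0 \<and> y \<noteq> 0} F"
    "\<And>x y. x \<noteq> 0 \<Longrightarrow> y \<noteq> 0 \<Longrightarrow> F [x, y] \<noteq> 0"
  shows "\<exists>a n m. a \<noteq> 0 \<and> (\<forall>x y. x \<noteq> 0 \<longrightarrow> y \<noteq> 0 \<longrightarrow> F [x, y] = a * x powi n * y powi m)"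
proof -
  let ?Z = "{[x, y] | x y :: complex. x \<noteq> 0 \<and> y \<noteq> 0}"
  have "\<exists>a n. a \<noteq> 0 \<and> (\<forall>x. x \<noteq> 0 \<longrightarrow> F [x, y] = a * x powi n)" if y: "y \<noteq> 0" for y
  proof -
    have "regular_on UNIV (Suc 0) {[t] | t. t \<noteq> 0} (\<lambda>q. F [q ! 0, y])"
    proof (rule regular_on_precompose[OF F(1)])
      fix i :: nat assume "i < 2"
      then have "i = 0 \<or> i = 1" by auto
      then show "(\<lambda>q. [q ! 0, y] ! i) \<in> polys UNIV (Suc 0)"
        using polys.coord[of 0 "Suc 0" UNIV] polys.const[of y UNIV "Suc 0"] by auto
    qed (use y in auto)
    then show ?thesis using regular_unit_1[of "\<lambda>q. F [q ! 0, y]"] F(2) y by simp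
  qed
  then obtain a n where an: "\<And>x y. y \<noteq> 0 \<Longrightarrow> x \<noteq> 0 \<Longrightarrow> F [x, y] = a y * x powi n y" by metis
  have "\<exists>b m. b \<noteq> 0 \<and> (\<forall>y. y \<noteq> 0 \<longrightarrow> F [x, y] = b * y powi m)" if x: "x \<noteq> 0" for x
  proof -
    have "regular_on UNIV (Suc 0) {[t] | t. t \<noteq> 0} (\<lambda>q. F [x, q ! 0])"
    proof (rule regular_on_precompose[OF F(1)])
      fix i :: nat assume "i < 2"
      then have "i = 0 \<or> i = 1" by auto
      then show "(\<lambda>q. [x, q ! 0] ! i) \<in> polys UNIV (Suc 0)"
        using polys.coord[of 0 "Suc 0" UNIV] polys.const[of x UNIV "Suc 0"] by auto
    qed (use x in auto)
    then show ?thesis using regular_unit_1[of "\<lambda>q. F [x, q ! 0]"] F(2) x by simp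
  qed
  then obtain b m where bm: "\<And>x y. x \<noteq> 0 \<Longrightarrow> y \<noteq> 0 \<Longrightarrow> F [x, y] = b x * y powi m x" by metis
  let ?c = "F [1, 1]"
  have c: "?c \<noteq> 0" using F(2) by simp
  have a: "a y = ?c * y powi m 1" if "y \<noteq> 0" for y
    using an[OF that, of 1] bm[of 1 y] bm[of 1 1] that by simp
  have b: "b x = ?c * x powi n 1" if "x \<noteq> 0" for x
    using bm[OF that, of 1] an[of 1 x] an[of 1 1] that by simp
  have rel: "x powi (n y - n 1) = y powi (m x - m 1)" if "x \<noteq> 0" "y \<noteq> 0" for x y
  proof -
    have "?c * y powi m 1 * x powi n y = ?c * x powi n 1 * y powi m x"
      using an[OF that(2,1)] bm[OF that] unfolding a[OF that(2)] b[OF that(1)] by (rule subst)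
    then show ?thesis using c that by (simp add: power_int_diff field_simps)
  qed
  define k where "k = m 2 - m 1"
  have "k = 0"
  proof (rule ccontr)
    assume k: "k \<noteq> 0"
    \<comment> \<open>Chosen such that \<open>(exp u)\<^sup>k\<close> is the square root of 2.\<close>
    define u where "u = ln 2 / (2 * real_of_int k)"
    define y where "y = complex_of_real (exp u)"
    define j where "j = n y - n 1"
    have "y \<noteq> 0" by (simp add: y_def)
    then have "(2 :: complex) powi j = y powi k" using rel[of 2 y] by (simp add: j_def k_def)
    then have "norm ((2 :: complex) powi j) = norm (y powi k)" by simp
    then have "(2 :: real) powi j = exp u powi k" by (simp add: norm_power_int y_def)
    moreover have "(2 :: real) powi j = exp (real_of_int j * ln 2)"
      using exp_power_int[of "ln 2 :: real" j] by simp
    ultimately have "real_of_int j * ln 2 = real_of_int k * u"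
      by (simp add: exp_power_int)
    then have "real_of_int j * ln 2 = ln 2 / 2" using k by (simp add: u_def)
    then have "2 * real_of_int j = 1" by simp
    then have "2 * j = 1" by linarith
    then show False by presburger
  qed
  then have n: "n y = n 1" if "y \<noteq> 0" for y
    using rel[of 2 y] that two_powi_inj[of "n y - n 1" 0] by (simp add: k_def)
  have "F [x, y] = ?c * x powi n 1 * y powi m 1" if "x \<noteq> 0" "y \<noteq> 0" for x y
    using an[OF that(2,1)] unfolding a[OF that(2)] n[OF that(2)] by (simp add: mult_ac)
  then show ?thesis using c by blast
qed

section \<open>Monomial maps\<close>

definition Gm_chart :: "complex list chart" where
  "Gm_chart = \<lparr>cdom = {[x] | x. x \<noteq> 0}, cdim = 1, ccoord = (\<lambda>p. p)\<rparr>"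

abbreviation Gm2_chart :: "(complex list \<times> complex list) chart" where
  "Gm2_chart \<equiv> chart_prod Gm_chart Gm_chart"

abbreviation Gm2 :: "(complex list \<times> complex list) chart set" where
  "Gm2 \<equiv> {Gm2_chart}"

lemma Gm_eq: "Gm = {Gm_chart}"
  by (simp add: Gm_def embedded_def Gm_chart_def)

lemma Gm_chart_sel [simp]:
  "cdom Gm_chart = {[x] | x. x \<noteq> 0}" "cdim Gm_chart = 1" "ccoord Gm_chart = (\<lambda>p. p)"
  by (simp_all add: Gm_chart_def)

lemma inj_Gm_chart: "inj_on (ccoord Gm_chart) (cdom Gm_chart)"
  by simp

lemma affine_Gm_chart: "ccoord Gm_chart ` cdom Gm_chart \<subseteq> affine_space (cdim Gm_chart)"
  by (auto simp: affine_space_def)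

lemma inj_Gm2_chart: "inj_on (ccoord Gm2_chart) (cdom Gm2_chart)"
  by (rule inj_on_chart_prod[OF inj_Gm_chart inj_Gm_chart affine_Gm_chart])

lemma Gm_mem: "u \<in> points Gm \<longleftrightarrow> (\<exists>x. x \<noteq> 0 \<and> u = [x])"
  by (auto simp: Gm_eq)

lemma Gm2_mem: "w \<in> points Gm2 \<longleftrightarrow> (\<exists>x y. x \<noteq> 0 \<and> y \<noteq> 0 \<and> w = ([x], [y]))"
  by auto

lemma cinv_Gm_chart: "x \<noteq> 0 \<Longrightarrow> cinv Gm_chart [x] = [x]"
  using cinv_ccoord[OF inj_Gm_chart, of "[x]"] by simp

lemma cinv_Gm2_chart: "x \<noteq> 0 \<Longrightarrow> y \<noteq> 0 \<Longrightarrow> cinv Gm2_chart [x, y] = ([x], [y])"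
  using cinv_ccoord[OF inj_Gm2_chart, of "([x], [y])"] by simp

lemma Gm2_coords: "ccoord Gm2_chart ` cdom Gm2_chart =
    {[x, y] | x y. x \<noteq> 0 \<and> y \<noteq> 0}" (is "?L = ?R")
proof
  show "?L \<subseteq> ?R" by auto
  show "?R \<subseteq> ?L"
  proof
    fix w assume "w \<in> ?R"
    then obtain x y where "w = [x, y]" "x \<noteq> 0" "y \<noteq> 0" by blast
    then show "w \<in> ?L" by (intro image_eqI[of _ _ "([x], [y])"]) auto
  qed
qed

text \<open>The exponents are the rows of a matrix, and composition of maps is multiplication of
  these matrices, see \<open>mono_map_comp\<close> below.\<close>

definition mono_map :: "complex \<Rightarrow> complex \<Rightarrow> int \<Rightarrow> int \<Rightarrow> int \<Rightarrow> int \<Rightarrow>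
    complex list \<times> complex list \<Rightarrow> complex list \<times> complex list" where
  "mono_map a b p q r s = (\<lambda>(u, v).
     ([a * (u ! 0) powi p * (v ! 0) powi q], [b * (u ! 0) powi r * (v ! 0) powi s]))"

definition conj_pair :: "complex list \<times> complex list \<Rightarrow> complex list \<times> complex list" where
  "conj_pair = map_prod (map cnj) (map cnj)"

lemma mono_map_simp [simp]:
  "mono_map a b p q r s ([x], [y]) = ([a * x powi p * y powi q], [b * x powi r * y powi s])"
  by (simp add: mono_map_def)

lemma conj_pair_simp [simp]: "conj_pair ([x], [y]) = ([cnj x], [cnj y])"
  by (simp add: conj_pair_def)

lemma regular_map_mono_map:
  assumes "a \<noteq> 0" "b \<noteq> 0"
  shows "regular_map UNIV Gm2 Gm2 (mono_map a b p q r s)"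
proof (rule regular_map_singleI[OF UNIV_I inj_Gm2_chart inj_Gm2_chart])
  show "mono_map a b p q r s w \<in> cdom Gm2_chart"
    if "w \<in> cdom Gm2_chart" for w
    using that assms by auto
  fix i assume i: "i < cdim Gm2_chart"
  let ?Z = "{[x, y] | x y :: complex. x \<noteq> 0 \<and> y \<noteq> 0}"
  have reg: "regular_on UNIV 2 ?Z (\<lambda>w. c * (w ! 0) powi k * (w ! 1) powi l)" for c k l
    by (intro regular_on_mult regular_on_const regular_on_power_int regular_on_coord) auto
  define c k l where "c = (if i = 0 then a else b)" and "k = (if i = 0 then p else r)"
    and "l = (if i = 0 then q else s)"
  have "regular_on UNIV 2 ?Z (\<lambda>w. ccoord Gm2_chart
      (mono_map a b p q r s (cinv Gm2_chart w)) ! i)"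
  proof (rule regular_on_eqI[OF reg[of c k l]])
    fix w assume "w \<in> ?Z"
    then obtain x y where w: "w = [x, y]" "x \<noteq> 0" "y \<noteq> 0" by blast
    have "i = 0 \<or> i = 1" using i by auto
    then show "c * (w ! 0) powi k * (w ! 1) powi l = ccoord Gm2_chart
        (mono_map a b p q r s (cinv Gm2_chart w)) ! i"
      using w cinv_Gm2_chart[OF w(2,3)] by (auto simp: c_def k_def l_def)
  qed
  then show "regular_on UNIV (cdim Gm2_chart)
     (ccoord Gm2_chart ` cdom Gm2_chart)
     (\<lambda>w. ccoord Gm2_chart
       (mono_map a b p q r s (cinv Gm2_chart w)) ! i)"
    unfolding Gm2_coords by (simp add: numeral_2_eq_2)
qed

lemma regular_unit_Gm2:
  assumes "regular_fun UNIV Gm2 (points Gm2) f" "\<And>x y. x \<noteq> 0 \<Longrightarrow> y \<noteq> 0 \<Longrightarrow> f ([x], [y]) \<noteq> 0"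
  shows "\<exists>a n m. a \<noteq> 0 \<and> (\<forall>x y. x \<noteq> 0 \<longrightarrow> y \<noteq> 0 \<longrightarrow> f ([x], [y]) = a * x powi n * y powi m)"
proof -
  have "regular_on UNIV 2 {[x, y] | x y. x \<noteq> 0 \<and> y \<noteq> 0} (\<lambda>w. f (cinv Gm2_chart w))"
    using assms(1) Gm2_coords by (simp add: regular_fun_single_iff numeral_2_eq_2)
  then show ?thesis
    using regular_unit_2[of "\<lambda>w. f (cinv Gm2_chart w)"] assms(2)
    by (simp add: cinv_Gm2_chart)
qed

lemma regular_fun_Gm2_coords:
  "regular_fun UNIV Gm2 (points Gm2) (\<lambda>w. fst w ! 0)" "regular_fun UNIV Gm2 (points Gm2) (\<lambda>w. snd w ! 0)"
proof -
  have "regular_fun UNIV Gm2 (points Gm2) (\<lambda>w. ccoord Gm2_chart w ! i)" if "i < 2" for i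
    using regular_fun_coord[of UNIV i "Gm2_chart"] that by simp
  note r = this
  have e: "ccoord Gm2_chart w ! 0 = fst w ! 0"
    "ccoord Gm2_chart w ! 1 = snd w ! 0" if "w \<in> points Gm2" for w
    using that by auto
  show "regular_fun UNIV Gm2 (points Gm2) (\<lambda>w. fst w ! 0)"
    by (rule iffD1[OF regular_fun_cong[OF e(1)] r]) simp_all
  show "regular_fun UNIV Gm2 (points Gm2) (\<lambda>w. snd w ! 0)"
    by (rule iffD1[OF regular_fun_cong[OF e(2)] r]) simp_all
qed

lemma regular_map_Gm2_eq_mono_map:
  assumes "regular_map UNIV Gm2 Gm2 \<phi>"
  obtains a b p q r s where "a \<noteq> 0" "b \<noteq> 0" "\<And>w. w \<in> points Gm2 \<Longrightarrow> \<phi> w = mono_map a b p q r s w"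
proof -
  have mem: "\<exists>x' y'. x' \<noteq> 0 \<and> y' \<noteq> 0 \<and> \<phi> ([x], [y]) = ([x'], [y'])" if "x \<noteq> 0" "y \<noteq> 0" for x y
    using regular_map_mem[OF assms, of "([x], [y])"] that by auto
  obtain a p q where 1: "a \<noteq> 0" "\<forall>x y. x \<noteq> 0 \<longrightarrow> y \<noteq> 0 \<longrightarrow> fst (\<phi> ([x], [y])) ! 0 = a * x powi p * y powi q"
    using regular_unit_Gm2[OF regular_map_pullback[OF assms regular_fun_Gm2_coords(1) UNIV_I]] mem by fastforce
  obtain b r s where 2: "b \<noteq> 0" "\<forall>x y. x \<noteq> 0 \<longrightarrow> y \<noteq> 0 \<longrightarrow> snd (\<phi> ([x], [y])) ! 0 = b * x powi r * y powi s"
    using regular_unit_Gm2[OF regular_map_pullback[OF assms regular_fun_Gm2_coords(2) UNIV_I]] mem by fastforce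
  have "\<phi> w = mono_map a b p q r s w" if "w \<in> points Gm2" for w
  proof -
    obtain x y where w: "x \<noteq> 0" "y \<noteq> 0" "w = ([x], [y])" using \<open>w \<in> points Gm2\<close> unfolding Gm2_mem by blast
    then show ?thesis using mem[OF w(1,2)] 1(2)[rule_format, OF w(1,2)] 2(2)[rule_format, OF w(1,2)] by auto
  qed
  then show thesis using that 1(1) 2(1) by blast
qed

lemma monomial_power_int:
  fixes c x y :: complex
  shows "(c * x powi k * y powi l) powi n = c powi n * x powi (n * k) * y powi (n * l)"
  by (simp add: power_int_mult_distrib mult.commute[of n] power_int_mult)

lemma monomial_power_int2:
  fixes x y :: complex
  shows "(x powi k * y powi l) powi n = x powi (k * n) * y powi (l * n)"
  by (simp add: power_int_mult_distrib power_int_mult)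

lemma mono_map_comp:
  assumes "x \<noteq> 0" "y \<noteq> 0" "a' \<noteq> 0" "b' \<noteq> 0"
  shows "mono_map a b p q r s (mono_map a' b' p' q' r' s' ([x], [y])) =
    mono_map (a * a' powi p * b' powi q) (b * a' powi r * b' powi s)
      (p * p' + q * r') (p * q' + q * s') (r * p' + s * r') (r * q' + s * s') ([x], [y])"
  using assms unfolding mono_map_simp monomial_power_int by (simp add: power_int_add mult_ac)

lemma conj_pair_mono_map:
  "conj_pair (mono_map a b p q r s ([x], [y])) = mono_map (cnj a) (cnj b) p q r s ([cnj x], [cnj y])"
  by simp

lemma mono_map_inject:
  assumes "\<And>x y. x \<noteq> 0 \<Longrightarrow> y \<noteq> 0 \<Longrightarrow>
    mono_map a b p q r s ([x], [y]) = mono_map a' b' p' q' r' s' ([x], [y])"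
    and "a \<noteq> 0" "b \<noteq> 0"
  shows "a' = a \<and> b' = b \<and> p' = p \<and> q' = q \<and> r' = r \<and> s' = s"
proof -
  have "a' = a" "b' = b" using assms(1)[of 1 1] by simp_all
  then show ?thesis
    using assms(1)[of 2 1] assms(1)[of 1 2] assms(2,3) two_powi_inj by simp
qed

lemma mono_map_one [simp]: "mono_map 1 1 1 0 0 1 ([x], [y]) = ([x], [y])"
  by simp

text \<open>The exponents of the inverse are the entries of the adjugate matrix times the determinant
  \<open>e = \<plusminus> 1\<close>, and its constants are those that cancel the powers of
  \<open>a\<close> and \<open>b\<close>.\<close>

lemma mono_map_inverse:
  assumes "a \<noteq> 0" "b \<noteq> 0" "\<bar>p * s - q * r\<bar> = 1"
  obtains a' b' p' q' r' s' where "a' \<noteq> 0" "b' \<noteq> 0"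
    "\<And>w. w \<in> points Gm2 \<Longrightarrow> mono_map a' b' p' q' r' s' (mono_map a b p q r s w) = w"
    "\<And>w. w \<in> points Gm2 \<Longrightarrow> mono_map a b p q r s (mono_map a' b' p' q' r' s' w) = w"
proof -
  define e where "e = p * s - q * r"
  have e: "e * e = 1" using assms(3) unfolding e_def[symmetric] by (auto simp: abs_if split: if_splits)
  define a' where "a' = a powi (- e * s) * b powi (e * q)"
  define b' where "b' = a powi (e * r) * b powi (- e * p)"
  have nz: "a' \<noteq> 0" "b' \<noteq> 0" using assms(1,2) by (simp_all add: a'_def b'_def)
  have E: "e * s * p + - e * q * r = 1" "e * s * q + - e * q * s = 0" "- e * r * p + e * p * r = 0"
    "- e * r * q + e * p * s = 1"
    using e by (simp_all add: e_def algebra_simps)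
  have E': "p * (e * s) + q * (- e * r) = 1" "p * (- e * q) + q * (e * p) = 0"
    "r * (e * s) + s * (- e * r) = 0" "r * (- e * q) + s * (e * p) = 1"
    using E by (simp_all add: algebra_simps)
  have A: "a' * a powi (e * s) * b powi (- e * q) = 1" "b' * a powi (- e * r) * b powi (e * p) = 1"
    using assms(1,2) by (simp_all add: a'_def b'_def power_int_minus field_simps)
  have B: "a * a' powi p * b' powi q = 1"
  proof -
    have "a * a' powi p * b' powi q =
        (a powi 1 * a powi (- e * s * p) * a powi (e * r * q)) * (b powi (e * q * p) * b powi (- e * p * q))"
      unfolding a'_def b'_def monomial_power_int2 by (simp only: power_int_1_right mult_ac)
    also have "\<dots> = a powi (1 + - e * s * p + e * r * q) * b powi (e * q * p + - e * p * q)"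
      by (simp only: power_int_add assms(1,2) simp_thms)
    also have "1 + - e * s * p + e * r * q = 0" using E by (simp add: algebra_simps)
    also have "e * q * p + - e * p * q = 0" by (simp add: algebra_simps)
    finally show ?thesis by simp
  qed
  have C: "b * a' powi r * b' powi s = 1"
  proof -
    have "b * a' powi r * b' powi s =
        (a powi (- e * s * r) * a powi (e * r * s)) * (b powi 1 * b powi (e * q * r) * b powi (- e * p * s))"
      unfolding a'_def b'_def monomial_power_int2 by (simp only: power_int_1_right mult_ac)
    also have "\<dots> = a powi (- e * s * r + e * r * s) * b powi (1 + e * q * r + - e * p * s)"
      by (simp only: power_int_add assms(1,2) simp_thms)
    also have "- e * s * r + e * r * s = 0" by (simp add: algebra_simps)
    also have "1 + e * q * r + - e * p * s = 0" using E by (simp add: algebra_simps)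
    finally show ?thesis by simp
  qed
  show thesis
  proof (rule that[OF nz, of "e * s" "- e * q" "- e * r" "e * p"])
    fix w assume "w \<in> points Gm2"
    then obtain x y where w: "x \<noteq> 0" "y \<noteq> 0" "w = ([x], [y])" unfolding Gm2_mem by blast
    show "mono_map a' b' (e * s) (- e * q) (- e * r) (e * p) (mono_map a b p q r s w) = w"
      unfolding w(3) mono_map_comp[OF w(1,2) assms(1,2)] A E by simp
    show "mono_map a b p q r s (mono_map a' b' (e * s) (- e * q) (- e * r) (e * p) w) = w"
      unfolding w(3) mono_map_comp[OF w(1,2) nz] B C E' by simp
  qed
qed

section \<open>Real structures on the punctured line\<close>

definition emb :: "nat \<Rightarrow> complex list set \<Rightarrow> complex list chart" where
  "emb n Z = \<lparr>cdom = Z, cdim = n, ccoord = (\<lambda>p. p)\<rparr>"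

lemma emb_sel [simp]: "cdom (emb n Z) = Z" "cdim (emb n Z) = n" "ccoord (emb n Z) = (\<lambda>p. p)"
  by (simp_all add: emb_def)

lemma embedded_eq: "embedded n Z = {emb n Z}"
  by (simp add: embedded_def emb_def)

lemma Gm_chart_eq_emb: "Gm_chart = emb 1 {[x] | x. x \<noteq> 0}"
  by (simp add: Gm_chart_def emb_def)

lemma inj_emb: "inj_on (ccoord (emb n Z)) (cdom (emb n Z))"
  by simp

lemma cinv_emb: "p \<in> Z \<Longrightarrow> cinv (emb n Z) p = p"
  using cinv_ccoord[OF inj_emb, of p n Z] by simp

lemma regular_map_embI:
  assumes "1 \<in> K" "\<And>p. p \<in> Z \<Longrightarrow> \<phi> p \<in> W" "\<And>i. i < m \<Longrightarrow> regular_on K n Z (\<lambda>p. \<phi> p ! i)"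
  shows "regular_map K {emb n Z} {emb m W} \<phi>"
proof (rule regular_map_singleI[OF assms(1) inj_emb inj_emb])
  fix i assume "i < cdim (emb m W)"
  then have "regular_on K n Z (\<lambda>p. \<phi> p ! i)" using assms(3) by simp
  then have "regular_on K n Z (\<lambda>p. \<phi> (cinv (emb n Z) p) ! i)"
    by (rule regular_on_eqI) (simp add: cinv_emb)
  then show "regular_on K (cdim (emb n Z)) (ccoord (emb n Z) ` cdom (emb n Z))
      (\<lambda>p. ccoord (emb m W) (\<phi> (cinv (emb n Z) p)) ! i)" by simp
qed (use assms(2) in auto)

lemma conj_point_emb:
  assumes "variety \<real> {emb n Z}" "p \<in> Z"
  shows "conj_point {emb n Z} p = map cnj p"
  using conj_point_chart[OF assms(1) singletonI, of p] assms(2) by simp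

lemma regular_fun_Gm_coord: "regular_fun UNIV Gm (points Gm) (\<lambda>u. u ! 0)"
  using regular_fun_coord[of UNIV 0 Gm_chart] by (simp add: Gm_eq)

lemma regular_unit_Gm:
  assumes "regular_fun UNIV Gm (points Gm) f" "\<And>x. x \<noteq> 0 \<Longrightarrow> f [x] \<noteq> 0"
  shows "\<exists>a n. a \<noteq> 0 \<and> (\<forall>x. x \<noteq> 0 \<longrightarrow> f [x] = a * x powi n)"
proof -
  have "regular_on UNIV (Suc 0) {[x] | x. x \<noteq> 0} (\<lambda>w. f (cinv Gm_chart w))"
    using assms(1) by (simp add: Gm_eq regular_fun_single_iff)
  then show ?thesis
    using regular_unit_1[of "\<lambda>w. f (cinv Gm_chart w)"] assms(2) by (simp add: cinv_Gm_chart)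
qed

lemma regular_map_Gm_eq:
  assumes "regular_map UNIV Gm Gm \<phi>"
  obtains a n where "a \<noteq> 0" "\<And>x. x \<noteq> 0 \<Longrightarrow> \<phi> [x] = [a * x powi n]"
proof -
  have mem: "\<exists>x'. x' \<noteq> 0 \<and> \<phi> [x] = [x']" if "x \<noteq> 0" for x
    using regular_map_mem[OF assms, of "[x]"] that by (simp add: Gm_mem)
  have nz: "\<phi> [x] ! 0 \<noteq> 0" if "x \<noteq> 0" for x
    using mem[OF that] by auto
  obtain a n where a: "a \<noteq> 0" "\<forall>x. x \<noteq> 0 \<longrightarrow> \<phi> [x] ! 0 = a * x powi n"
    using regular_unit_Gm[OF regular_map_pullback[OF assms regular_fun_Gm_coord UNIV_I]] nz by blast
  have "\<phi> [x] = [a * x powi n]" if "x \<noteq> 0" for x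
    using mem[OF that] a(2)[rule_format, OF that] by auto
  then show thesis using that a(1) by blast
qed

lemma minus_one_real: "(- 1 :: complex) \<in> \<real>"
  by simp

lemma variety_hypersurface:
  assumes "P \<in> polys \<real> n"
  shows "variety \<real> {emb n {p \<in> affine_space n. P p = 0}}"
proof (rule variety_single[OF Reals_1 minus_one_real inj_emb])
  have "zclosed_in \<real> n (affine_space n) {p \<in> affine_space n. P p = 0}"
    unfolding zclosed_in_def using assms by (intro exI[of _ "{P}"]) simp
  then have "locally_closed \<real> n {p \<in> affine_space n. P p = 0}"
    unfolding locally_closed_def using zopen_in_whole[OF Reals_1] by blast
  then show "locally_closed \<real> (cdim (emb n {p \<in> affine_space n. P p = 0}))
     (ccoord (emb n {p \<in> affine_space n. P p = 0}) ` cdom (emb n {p \<in> affine_space n. P p = 0}))"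
    by simp
qed

lemma variety_hypersurface_complement:
  assumes "P \<in> polys \<real> n"
  shows "variety \<real> {emb n {p \<in> affine_space n. P p \<noteq> 0}}"
proof (rule variety_single[OF Reals_1 minus_one_real inj_emb])
  let ?Z = "{p \<in> affine_space n. P p \<noteq> 0}"
  have "affine_space n - ?Z = {p \<in> affine_space n. \<forall>R\<in>{P}. R p = 0}" by auto
  then have "zopen_in \<real> n (affine_space n) ?Z"
    unfolding zopen_in_def zclosed_in_def using assms by (intro conjI exI[of _ "{P}"]) auto
  moreover have "zclosed_in \<real> n (affine_space n) (affine_space n)"
    unfolding zclosed_in_def by (intro exI[of _ "{}"]) simp
  ultimately have "locally_closed \<real> n ?Z" unfolding locally_closed_def by blast
  then show "locally_closed \<real> (cdim (emb n ?Z)) (ccoord (emb n ?Z) ` cdom (emb n ?Z))" by simp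
qed

lemma affine_line: "affine_space 1 = {[x] | x. True}"
  by (auto simp: affine_space_def length_Suc_conv)

lemma variety_Gm: "variety \<real> Gm"
proof -
  have P: "(\<lambda>p :: complex list. p ! 0) \<in> polys \<real> 1" by (rule polys.coord) simp
  have "{p \<in> affine_space 1. p ! 0 \<noteq> 0} = {[x] | x. x \<noteq> 0}" unfolding affine_line by force
  then show ?thesis
    using variety_hypersurface_complement[OF P] by (simp only: Gm_eq Gm_chart_eq_emb)
qed

lemma conj_point_Gm: "x \<noteq> 0 \<Longrightarrow> conj_point Gm [x] = [cnj x]"
  using conj_point_emb[of 1 "{[x] | x. x \<noteq> 0}" "[x]"] variety_Gm by (simp add: Gm_eq Gm_chart_eq_emb)

text \<open>Precomposition with complex conjugation turns an anti-regular map into a regular one.\<close>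

lemma anti_regular_map_Gm_eq:
  assumes "anti_regular_map Gm Gm \<rho>"
  obtains a n where "a \<noteq> 0" "\<And>x. x \<noteq> 0 \<Longrightarrow> \<rho> [x] = [a * cnj x powi n]"
proof -
  obtain a n where a: "a \<noteq> 0" "\<And>x. x \<noteq> 0 \<Longrightarrow> \<rho> (conj_point Gm [x]) = [a * x powi n]"
    by (rule regular_map_Gm_eq[OF anti_regular_anti_regular_compose[OF anti_regular_conj_point[OF variety_Gm] assms]]) blast
  have "\<rho> [x] = [a * cnj x powi n]" if "x \<noteq> 0" for x
    using a(2)[of "cnj x"] that by (simp add: conj_point_Gm)
  then show thesis using that a(1) by blast
qed

lemma variety_Gm2: "variety \<real> Gm2"
  using variety_chart_prod[OF Reals_1 minus_one_real] variety_Gm unfolding Gm_eq by blast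

lemma conj_point_Gm2: "w \<in> points Gm2 \<Longrightarrow> conj_point Gm2 w = conj_pair w"
  using conj_point_chart_prod[of Gm_chart Gm_chart] variety_Gm conj_point_Gm unfolding Gm_eq by auto

lemma anti_regular_map_Gm2_eq_mono_map:
  assumes "anti_regular_map Gm2 Gm2 \<rho>"
  obtains a b p q r s where "a \<noteq> 0" "b \<noteq> 0"
    "\<And>w. w \<in> points Gm2 \<Longrightarrow> \<rho> w = mono_map a b p q r s (conj_pair w)"
proof -
  obtain a b p q r s where 1: "a \<noteq> 0" "b \<noteq> 0"
    "\<And>w. w \<in> points Gm2 \<Longrightarrow> \<rho> (conj_point Gm2 w) = mono_map a b p q r s w"
    by (rule regular_map_Gm2_eq_mono_map[OF anti_regular_anti_regular_compose[OF
      anti_regular_conj_point[OF variety_Gm2] assms]]) blast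
  have "\<rho> w = mono_map a b p q r s (conj_pair w)" if w: "w \<in> points Gm2" for w
    using 1(3)[OF conj_point_mem[OF variety_Gm2 w]] conj_point_involution[OF variety_Gm2 w] conj_point_Gm2[OF w]
    by simp
  then show thesis using that 1(1,2) by blast
qed

definition line_anti :: "complex \<Rightarrow> int \<Rightarrow> complex list \<Rightarrow> complex list" where
  "line_anti a n u = [a * cnj (u ! 0) powi n]"

lemma line_anti_simp [simp]: "line_anti a n [x] = [a * cnj x powi n]"
  by (simp add: line_anti_def)

lemma line_anti_involution:
  assumes "a \<noteq> 0" "\<And>x. x \<noteq> 0 \<Longrightarrow> line_anti a n (line_anti a n [x]) = [x]"
  shows "n = 1 \<and> norm a = 1 \<or> n = - 1 \<and> a \<in> \<real>"
proof -
  have eq: "a * cnj a powi n * x powi (n * n) = x" if "x \<noteq> 0" for x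
    using assms(2)[OF that] by (simp add: power_int_mult power_int_mult_distrib mult_ac)
  have c: "a * cnj a powi n = 1" using eq[of 1] by simp
  then have "(2 :: complex) powi (n * n) = 2 powi 1" using eq[of 2] by simp
  then have "n * n = 1" by (rule two_powi_inj)
  then have "n = 1 \<or> n = - 1" by (simp add: zmult_eq_1_iff)
  then show ?thesis
  proof
    assume n: "n = 1"
    then have "a * cnj a = 1" using c by simp
    then have "complex_of_real ((norm a)\<^sup>2) = 1" unfolding complex_norm_square .
    then have "(norm a)\<^sup>2 = 1" using of_real_eq_1_iff by blast
    then show ?thesis using n by (simp add: power2_eq_1_iff) (smt (verit) norm_ge_zero)
  next
    assume n: "n = - 1"
    then have "a = cnj a" using c assms(1) by (simp add: field_simps)
    then show ?thesis using n by (simp add: Reals_cnj_iff)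
  qed
qed

lemma equivariant_iso_line_scale:
  assumes "l \<noteq> 0" "l * a = b * cnj l powi n"
  shows "equivariant_iso Gm (line_anti a n) Gm (line_anti b n)"
proof (rule equivariant_isoI[where \<phi> = "\<lambda>u. [l * u ! 0]" and \<psi> = "\<lambda>u. [inverse l * u ! 0]"])
  have reg: "regular_map UNIV Gm Gm (\<lambda>u. [c * u ! 0])" if "c \<noteq> 0" for c
    unfolding Gm_eq Gm_chart_eq_emb
    by (rule regular_map_embI)
      (use that in \<open>auto intro!: regular_on_mult regular_on_const regular_on_coord\<close>)
  show "regular_map UNIV Gm Gm (\<lambda>u. [l * u ! 0])" by (rule reg[OF assms(1)])
  show "regular_map UNIV Gm Gm (\<lambda>u. [inverse l * u ! 0])" by (rule reg) (use assms(1) in simp)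
  fix u assume "u \<in> points Gm"
  then obtain x where u: "u = [x]" "x \<noteq> 0" by (auto simp: Gm_mem)
  show "[inverse l * [l * u ! 0] ! 0] = u" "[l * [inverse l * u ! 0] ! 0] = u"
    using u assms(1) by simp_all
  have "l * (a * cnj x powi n) = (l * a) * cnj x powi n" by simp
  also have "\<dots> = b * cnj (l * x) powi n" using assms(2) by (simp add: power_int_mult_distrib)
  finally show "[l * line_anti a n u ! 0] = line_anti b n [l * u ! 0]" using u by simp
qed

text \<open>A square root of a number of modulus 1 has modulus 1, so its conjugate is its inverse; dividing
  \<open>x\<close> by it therefore removes the constant.\<close>

lemma normal_form_plus:
  assumes "norm a = 1"
  shows "equivariant_iso Gm (line_anti a 1) Gm (line_anti 1 1)"
proof (rule equivariant_iso_line_scale[of "inverse (csqrt a)"])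
  have "norm (csqrt a) = 1" using assms by simp
  then have "csqrt a * cnj (csqrt a) = 1" by (simp flip: complex_norm_square)
  then have "cnj (csqrt a) = inverse (csqrt a)" by (metis inverse_unique)
  moreover have "inverse (csqrt a) * a = csqrt a"
  proof -
    have "csqrt a \<noteq> 0" using assms by auto
    then have "inverse (csqrt a) * (csqrt a * csqrt a) = csqrt a" by simp
    then show ?thesis using power2_csqrt[of a] unfolding power2_eq_square by simp
  qed
  ultimately show "inverse (csqrt a) * a = 1 * cnj (inverse (csqrt a)) powi 1" by simp
  show "inverse (csqrt a) \<noteq> 0" using assms by auto
qed

text \<open>Rescaling \<open>x\<close> by \<open>l\<close> multiplies the constant of a structure with exponent
  \<open>- 1\<close> by \<open>\<bar>l\<bar>\<^sup>2\<close>, so that only its sign survives.\<close>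

lemma normal_form_minus_pos:
  assumes "r > 0"
  shows "equivariant_iso Gm (line_anti (complex_of_real r) (- 1)) Gm (line_anti 1 (- 1))"
proof (rule equivariant_iso_line_scale[of "complex_of_real (1 / sqrt r)"])
  have "complex_of_real (1 / sqrt r) * complex_of_real r = complex_of_real (1 / sqrt r * r)"
    by (rule of_real_mult[symmetric])
  also have "1 / sqrt r * r = sqrt r" using assms by (simp add: real_div_sqrt)
  also have "complex_of_real (sqrt r) = 1 * cnj (complex_of_real (1 / sqrt r)) powi - 1"
    by (simp add: power_int_minus)
  finally show "complex_of_real (1 / sqrt r) * complex_of_real r = 1 * cnj (complex_of_real (1 / sqrt r)) powi - 1" .
qed (use assms in simp)

lemma normal_form_minus_neg:
  assumes "r < 0"
  shows "equivariant_iso Gm (line_anti (complex_of_real r) (- 1)) Gm (line_anti (- 1) (- 1))"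
proof (rule equivariant_iso_line_scale[of "complex_of_real (1 / sqrt (- r))"])
  have "complex_of_real (1 / sqrt (- r)) * complex_of_real r = complex_of_real (1 / sqrt (- r) * r)"
    by (rule of_real_mult[symmetric])
  also have "1 / sqrt (- r) * r = - sqrt (- r)" using assms real_div_sqrt[of "- r"] by simp
  also have "complex_of_real (- sqrt (- r)) = - 1 * cnj (complex_of_real (1 / sqrt (- r))) powi - 1"
    by (simp add: power_int_minus)
  finally show "complex_of_real (1 / sqrt (- r)) * complex_of_real r =
      - 1 * cnj (complex_of_real (1 / sqrt (- r))) powi - 1" .
qed (use assms in simp)

lemma rho_eq_line_anti:
  "u \<in> points Gm \<Longrightarrow> rho1 u = line_anti 1 1 u"
  "u \<in> points Gm \<Longrightarrow> rho2 u = line_anti 1 (- 1) u"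
  "u \<in> points Gm \<Longrightarrow> rho3 u = line_anti (- 1) (- 1) u"
  by (simp_all add: rho1_def rho2_def rho3_def line_anti_def power_int_minus)

subsection \<open>The three conics\<close>

lemma affine_plane: "affine_space 2 = {[x, y] | x y. True}"
  by (auto simp: affine_space_def length_Suc_conv numeral_2_eq_2)

definition hyperbola :: "complex list chart" where
  "hyperbola = emb 2 {[x, y] | x y. x * y - 1 = 0}"

definition conic_curve :: "complex \<Rightarrow> complex list chart" where
  "conic_curve e = emb 2 {[x, y] | x y. x\<^sup>2 + y\<^sup>2 - e = 0}"

lemma Gamma_eq: "Gamma1 = {hyperbola}" "Gamma2 = {conic_curve 1}" "Gamma3 = {conic_curve (- 1)}"
  by (simp_all add: Gamma1_def Gamma2_def Gamma3_def embedded_eq hyperbola_def conic_curve_def)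

lemma variety_hyperbola: "variety \<real> {hyperbola}"
proof -
  have "(\<lambda>p :: complex list. p ! 0 * p ! 1 + - 1) \<in> polys \<real> 2"
    by (intro polys.add polys.mult polys.coord polys.const) auto
  from variety_hypersurface[OF this] show ?thesis
    unfolding hyperbola_def affine_plane by (rule back_subst[of "\<lambda>Z. variety \<real> {emb 2 Z}"]) auto
qed

lemma variety_conic:
  assumes "e \<in> \<real>"
  shows "variety \<real> {conic_curve e}"
proof -
  have "(\<lambda>p :: complex list. p ! 0 * p ! 0 + p ! 1 * p ! 1 + - e) \<in> polys \<real> 2"
    by (intro polys.add polys.mult polys.coord polys.const) (use assms in auto)
  from variety_hypersurface[OF this] show ?thesis
    unfolding conic_curve_def affine_plane
    by (rule back_subst[of "\<lambda>Z. variety \<real> {emb 2 Z}"]) (auto simp: power2_eq_square)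
qed

lemma regular_on_divide_const:
  assumes "regular_on UNIV n Z f"
  shows "regular_on UNIV n Z (\<lambda>p. f p / c)"
  using regular_on_mult[OF assms regular_on_const[of UNIV "inverse c"]] by (simp add: divide_inverse)

lemma hyperbola_iso:
  "isomorphism UNIV {hyperbola} Gm (\<lambda>p. [p ! 0])"
  "p \<in> points {hyperbola} \<Longrightarrow> [conj_point {hyperbola} p ! 0] = line_anti 1 1 [p ! 0]"
proof -
  show "isomorphism UNIV {hyperbola} Gm (\<lambda>p. [p ! 0])"
  proof (rule isomorphismI[where \<psi> = "\<lambda>u. [u ! 0, inverse (u ! 0)]"])
    show "regular_map UNIV {hyperbola} Gm (\<lambda>p. [p ! 0])"
      unfolding Gm_eq Gm_chart_eq_emb hyperbola_def
      by (rule regular_map_embI) (auto intro!: regular_on_coord)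
    show "regular_map UNIV Gm {hyperbola} (\<lambda>u. [u ! 0, inverse (u ! 0)])"
      unfolding Gm_eq Gm_chart_eq_emb hyperbola_def
    proof (rule regular_map_embI)
      fix i :: nat assume "i < 2"
      then have "i = 0 \<or> i = 1" by auto
      then show "regular_on UNIV 1 {[x] | x :: complex. x \<noteq> 0} (\<lambda>u. [u ! 0, inverse (u ! 0)] ! i)"
        by (auto intro!: regular_on_coord regular_on_inverse)
    qed auto
  qed (auto simp: hyperbola_def Gm_mem intro: inverse_unique)
  show "[conj_point {hyperbola} p ! 0] = line_anti 1 1 [p ! 0]" if "p \<in> points {hyperbola}"
    using that conj_point_emb[of 2 "{[x, y] | x y. x * y - 1 = 0}" p] variety_hyperbola
    by (auto simp: hyperbola_def)
qed

text \<open>Since \<open>x\<^sup>2 + y\<^sup>2 = (x + \<i> y) (x - \<i> y)\<close>, the function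
  \<open>t = x + \<i> y\<close> has no zero on the curve and \<open>x - \<i> y\<close> is
  \<open>e / t\<close>, so that \<open>x\<close> and \<open>y\<close> can be recovered from \<open>t\<close>.\<close>

lemma conic_iso:
  assumes e: "e \<in> \<real>" "e \<noteq> 0"
  shows "isomorphism UNIV {conic_curve e} Gm (\<lambda>p. [p ! 0 + \<i> * p ! 1])"
    "p \<in> points {conic_curve e} \<Longrightarrow>
      [conj_point {conic_curve e} p ! 0 + \<i> * conj_point {conic_curve e} p ! 1] = line_anti e (- 1) [p ! 0 + \<i> * p ! 1]"
proof -
  have fac: "(x + \<i> * y) * (x - \<i> * y) = e" if "x\<^sup>2 + y\<^sup>2 - e = 0" for x y
    using that by (simp add: algebra_simps power2_eq_square)
  let ?\<psi> = "\<lambda>u. [(u ! 0 + e * inverse (u ! 0)) / 2, (u ! 0 + (- e) * inverse (u ! 0)) / (2 * \<i>)]"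
  show "isomorphism UNIV {conic_curve e} Gm (\<lambda>p. [p ! 0 + \<i> * p ! 1])"
  proof (rule isomorphismI[where \<psi> = ?\<psi>])
    show "regular_map UNIV {conic_curve e} Gm (\<lambda>p. [p ! 0 + \<i> * p ! 1])"
      unfolding Gm_eq Gm_chart_eq_emb conic_curve_def
    proof (rule regular_map_embI)
      show "[p ! 0 + \<i> * p ! 1] \<in> {[x] | x. x \<noteq> 0}" if "p \<in> {[x, y] | x y. x\<^sup>2 + y\<^sup>2 - e = 0}" for p
        using that fac e by fastforce
    qed (auto intro!: regular_on_coord regular_on_add regular_on_mult regular_on_const)
    have reg: "regular_on UNIV 1 {[x] | x :: complex. x \<noteq> 0} (\<lambda>u. (u ! 0 + c * inverse (u ! 0)) / d)" for c d
      by (intro regular_on_divide_const regular_on_add regular_on_mult regular_on_const regular_on_inverse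
          regular_on_coord) auto
    show "regular_map UNIV Gm {conic_curve e} ?\<psi>"
      unfolding Gm_eq Gm_chart_eq_emb conic_curve_def
    proof (rule regular_map_embI)
      show "?\<psi> p \<in> {[x, y] | x y. x\<^sup>2 + y\<^sup>2 - e = 0}" if pm: "p \<in> {[x] | x. x \<noteq> 0}" for p
      proof -
        obtain x where x: "p = [x]" "x \<noteq> 0" using pm by blast
        then have eq: "((x + e * inverse x) / 2)\<^sup>2 + ((x + (- e) * inverse x) / (2 * \<i>))\<^sup>2 - e = 0"
          by (simp add: field_simps power2_eq_square)
        have "?\<psi> p = [(x + e * inverse x) / 2, (x + (- e) * inverse x) / (2 * \<i>)]" using x by simp
        then show ?thesis using eq by (intro CollectI exI conjI)
      qed
      fix i :: nat assume "i < 2"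
      then consider (0) "i = 0" | (1) "i = 1" by linarith
      then show "regular_on UNIV 1 {[x] | x. x \<noteq> 0} (\<lambda>p. ?\<psi> p ! i)"
      proof cases
        case 0
        show ?thesis unfolding 0 nth_Cons_0 by (rule reg)
      next
        case 1
        show ?thesis unfolding 1 One_nat_def nth_Cons_Suc nth_Cons_0 by (rule reg[unfolded One_nat_def])
      qed
    qed auto
    show "?\<psi> [p ! 0 + \<i> * p ! 1] = p" if pm: "p \<in> points {conic_curve e}" for p
    proof -
      obtain x y where p: "p = [x, y]" "x\<^sup>2 + y\<^sup>2 - e = 0" using pm by (auto simp: conic_curve_def)
      note f = fac[OF p(2)]
      have "x + \<i> * y \<noteq> 0" using f e by auto
      then have "e * inverse (x + \<i> * y) = x - \<i> * y" using f by (simp add: field_simps)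
      then show ?thesis using p by (simp add: field_simps)
    qed
    show "[?\<psi> u ! 0 + \<i> * ?\<psi> u ! 1] = u" if "u \<in> points Gm" for u
      using that by (auto simp: Gm_mem field_simps)
  qed
  show "[conj_point {conic_curve e} p ! 0 + \<i> * conj_point {conic_curve e} p ! 1] = line_anti e (- 1) [p ! 0 + \<i> * p ! 1]"
    if pm: "p \<in> points {conic_curve e}"
  proof -
    obtain x y where p: "p = [x, y]" "x\<^sup>2 + y\<^sup>2 - e = 0" using pm by (auto simp: conic_curve_def)
    have c: "conj_point {conic_curve e} p = [cnj x, cnj y]"
      using conj_point_emb[of 2 "{[x, y] | x y. x\<^sup>2 + y\<^sup>2 - e = 0}" p] variety_conic[OF e(1)] p
      by (simp add: conic_curve_def)
    have "cnj ((x + \<i> * y) * (x - \<i> * y)) = cnj e" using fac[OF p(2)] by simp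
    then have "cnj (x + \<i> * y) * (cnj x + \<i> * cnj y) = e" using e(1) by (simp add: Reals_cnj_iff)
    moreover from this have "cnj (x + \<i> * y) \<noteq> 0" using e(2) by auto
    ultimately have "cnj x + \<i> * cnj y = e * cnj (x + \<i> * y) powi - 1"
      by (simp add: power_int_minus field_simps)
    then show ?thesis using c p by simp
  qed
qed

lemma equivariant_iso_hyperbola: "equivariant_iso {hyperbola} (conj_point {hyperbola}) Gm (line_anti 1 1)"
  unfolding equivariant_iso_def using hyperbola_iso by blast

lemma equivariant_iso_conic:
  "e \<in> \<real> \<Longrightarrow> e \<noteq> 0 \<Longrightarrow> equivariant_iso {conic_curve e} (conj_point {conic_curve e}) Gm (line_anti e (- 1))"
  unfolding equivariant_iso_def using conic_iso by blast

lemma inj_Gm: "c \<in> Gm \<Longrightarrow> inj_on (ccoord c) (cdom c)"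
  by (simp add: Gm_eq)

lemma corresponding_real_forms_Gm:
  "corresponding_real_form Gm rho1 Gamma1"
  "corresponding_real_form Gm rho2 Gamma2"
  "corresponding_real_form Gm rho3 Gamma3"
proof -
  have mem: "\<phi> y \<in> points Gm" if "isomorphism UNIV X Gm \<phi>" "y \<in> points X"
    for \<phi> X and y :: "complex list"
    using that unfolding isomorphism_def by (blast intro: regular_map_mem)
  show "corresponding_real_form Gm rho1 Gamma1"
    unfolding Gamma_eq
    by (rule corresponding_real_formI[OF variety_hyperbola hyperbola_iso(1) inj_Gm])
      (use hyperbola_iso(2) rho_eq_line_anti(1)[OF mem[OF hyperbola_iso(1)]] in simp_all)
  have e: "1 \<in> (\<real> :: complex set)" "1 \<noteq> (0 :: complex)" "- 1 \<in> (\<real> :: complex set)" "- 1 \<noteq> (0 :: complex)"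
    by auto
  show "corresponding_real_form Gm rho2 Gamma2"
    unfolding Gamma_eq
    by (rule corresponding_real_formI[OF variety_conic[OF e(1)] conic_iso(1)[OF e(1,2)] inj_Gm])
      (use conic_iso(2)[OF e(1,2)] rho_eq_line_anti(2)[OF mem[OF conic_iso(1)[OF e(1,2)]]] in simp_all)
  show "corresponding_real_form Gm rho3 Gamma3"
    unfolding Gamma_eq
    by (rule corresponding_real_formI[OF variety_conic[OF e(3)] conic_iso(1)[OF e(3,4)] inj_Gm])
      (use conic_iso(2)[OF e(3,4)] rho_eq_line_anti(3)[OF mem[OF conic_iso(1)[OF e(3,4)]]] in simp_all)
qed

subsection \<open>Equivalence classes of real structures\<close>

lemma real_structures_mem: "\<rho> \<in> real_structures X \<Longrightarrow> x \<in> points X \<Longrightarrow> \<rho> x \<in> points X"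
  unfolding real_structures_def by (blast intro: anti_regular_map_mem)

lemma real_structure_equiv_iff:
  "(\<rho>, \<rho>') \<in> real_structure_equiv X \<longleftrightarrow>
     \<rho> \<in> real_structures X \<and> \<rho>' \<in> real_structures X \<and> equivariant_iso X \<rho>' X \<rho>"
proof -
  have "(\<forall>x\<in>points X. \<rho>' x = inv_into (points X) \<alpha> (\<rho> (\<alpha> x))) \<longleftrightarrow> (\<forall>x\<in>points X. \<alpha> (\<rho>' x) = \<rho> (\<alpha> x))"
    if R: "\<rho> \<in> real_structures X" "\<rho>' \<in> real_structures X" and \<alpha>: "isomorphism UNIV X X \<alpha>" for \<alpha>
  proof -
    have bij: "bij_betw \<alpha> (points X) (points X)" using \<alpha> unfolding isomorphism_def by blast
    have "\<rho>' x = inv_into (points X) \<alpha> (\<rho> (\<alpha> x)) \<longleftrightarrow> \<alpha> (\<rho>' x) = \<rho> (\<alpha> x)" if x: "x \<in> points X" for x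
    proof -
      have "\<alpha> x \<in> points X" using bij_betwE[OF bij] x by blast
      then have "\<alpha> (inv_into (points X) \<alpha> (\<rho> (\<alpha> x))) = \<rho> (\<alpha> x)"
        by (intro bij_betw_inv_into_right[OF bij] real_structures_mem[OF R(1)])
      moreover have "inv_into (points X) \<alpha> (\<alpha> (\<rho>' x)) = \<rho>' x"
        by (intro bij_betw_inv_into_left[OF bij] real_structures_mem[OF R(2) x])
      ultimately show ?thesis by auto
    qed
    then show ?thesis by simp
  qed
  note key = this
  show ?thesis
  proof
    assume "(\<rho>, \<rho>') \<in> real_structure_equiv X"
    then obtain \<alpha> where "\<rho> \<in> real_structures X" "\<rho>' \<in> real_structures X" "isomorphism UNIV X X \<alpha>"
      "\<forall>x\<in>points X. \<rho>' x = inv_into (points X) \<alpha> (\<rho> (\<alpha> x))"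
      unfolding real_structure_equiv_def by blast
    then show "\<rho> \<in> real_structures X \<and> \<rho>' \<in> real_structures X \<and> equivariant_iso X \<rho>' X \<rho>"
      unfolding equivariant_iso_def using key[of \<alpha>] by (intro conjI exI[of _ \<alpha>]) simp_all
  next
    assume R: "\<rho> \<in> real_structures X \<and> \<rho>' \<in> real_structures X \<and> equivariant_iso X \<rho>' X \<rho>"
    then obtain \<alpha> where "isomorphism UNIV X X \<alpha>" "\<forall>x\<in>points X. \<alpha> (\<rho>' x) = \<rho> (\<alpha> x)"
      unfolding equivariant_iso_def by blast
    then show "(\<rho>, \<rho>') \<in> real_structure_equiv X"
      unfolding real_structure_equiv_def using key[of \<alpha>] R
      by (intro CollectI case_prodI conjI exI[of _ \<alpha>]) simp_all
  qed
qed

lemma equiv_real_structures: "equiv (real_structures X) (real_structure_equiv X)"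
proof (rule equivI)
  show "real_structure_equiv X \<subseteq> real_structures X \<times> real_structures X"
    using real_structure_equiv_iff by fast
  show "refl_on (real_structures X) (real_structure_equiv X)"
    unfolding refl_on_def using real_structure_equiv_iff equivariant_iso_refl by blast
  show "sym (real_structure_equiv X)"
  proof (rule symI)
    fix \<rho> \<rho>' assume "(\<rho>, \<rho>') \<in> real_structure_equiv X"
    then show "(\<rho>', \<rho>) \<in> real_structure_equiv X"
      using equivariant_iso_sym[of X \<rho>' X \<rho>] real_structures_mem[of \<rho>' X]
      unfolding real_structure_equiv_iff by blast
  qed
  show "trans (real_structure_equiv X)"
  proof (rule transI)
    fix \<rho> \<rho>' \<rho>''
    assume "(\<rho>, \<rho>') \<in> real_structure_equiv X" "(\<rho>', \<rho>'') \<in> real_structure_equiv X"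
    then show "(\<rho>, \<rho>'') \<in> real_structure_equiv X"
      using equivariant_iso_trans[of X \<rho>'' X \<rho>' X \<rho>] unfolding real_structure_equiv_iff by blast
  qed
qed

text \<open>Anti-regularity and the involution property are transported from the conjugation of the real
  variety.\<close>

lemma real_structure_if_equivariant_iso:
  assumes X0: "variety \<real> X0" and "equivariant_iso X0 (conj_point X0) X \<rho>" "\<rho> \<in> extensional (points X)"
  shows "\<rho> \<in> real_structures X"
proof -
  obtain \<phi> \<psi> where "equivariant_pair X0 (conj_point X0) X \<rho> \<phi> \<psi>"
    by (rule equivariant_isoE[OF assms(2)])
  note 1 = equivariant_pairD[OF this]
  have eq: "\<phi> (conj_point X0 (\<psi> x)) = \<rho> x" if "x \<in> points X" for x
    using 1(7)[OF 1(6)[OF that]] 1(4)[OF that] by simp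
  have "anti_regular_map X X (\<lambda>x. \<phi> (conj_point X0 (\<psi> x)))"
    by (rule anti_regular_regular_compose[OF
      regular_anti_regular_compose[OF 1(2) anti_regular_conj_point[OF X0]] 1(1)])
  then have "anti_regular_map X X \<rho>"
    using anti_regular_map_cong[of X "\<lambda>x. \<phi> (conj_point X0 (\<psi> x))" \<rho> X] eq by blast
  moreover have "\<rho> (\<rho> x) = x" if x: "x \<in> points X" for x
  proof -
    have "\<rho> (\<rho> x) = \<phi> (conj_point X0 (\<psi> (\<phi> (conj_point X0 (\<psi> x)))))"
      using eq[OF x] eq[of "\<rho> x"] 1(5)[OF conj_point_mem[OF X0 1(6)[OF x]]] by simp
    then show ?thesis
      using 1(3)[OF conj_point_mem[OF X0 1(6)[OF x]]] conj_point_involution[OF X0 1(6)[OF x]] 1(4)[OF x]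
      by simp
  qed
  ultimately show ?thesis unfolding real_structures_def using assms(3) by blast
qed

lemma equivariant_iso_Gm_cong_right:
  "equivariant_iso X \<sigma> Gm \<tau> \<Longrightarrow> (\<And>u. u \<in> points Gm \<Longrightarrow> \<tau>' u = \<tau> u) \<Longrightarrow> equivariant_iso X \<sigma> Gm \<tau>'"
  by (rule equivariant_iso_cong) auto

lemma equivariant_iso_if_eq:
  "(\<And>x. x \<in> points X \<Longrightarrow> \<sigma> x = \<tau> x) \<Longrightarrow> equivariant_iso X \<sigma> X \<tau>"
  by (rule equivariant_iso_cong[OF equivariant_iso_refl[of X \<tau>]]) auto

lemma equivariant_iso_rho:
  "equivariant_iso Gm (line_anti 1 1) Gm rho1" "equivariant_iso Gm rho1 Gm (line_anti 1 1)"
  "equivariant_iso Gm (line_anti 1 (- 1)) Gm rho2" "equivariant_iso Gm rho2 Gm (line_anti 1 (- 1))"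
  "equivariant_iso Gm (line_anti (- 1) (- 1)) Gm rho3" "equivariant_iso Gm rho3 Gm (line_anti (- 1) (- 1))"
  by (rule equivariant_iso_if_eq; simp add: rho_eq_line_anti)+

lemma rho_real_structures: "{rho1, rho2, rho3} \<subseteq> real_structures Gm"
proof -
  have e: "equivariant_iso {conic_curve 1} (conj_point {conic_curve 1}) Gm (line_anti 1 (- 1))"
    "equivariant_iso {conic_curve (- 1)} (conj_point {conic_curve (- 1)}) Gm (line_anti (- 1) (- 1))"
    by (rule equivariant_iso_conic; simp)+
  have ext: "rho1 \<in> extensional (points Gm)" "rho2 \<in> extensional (points Gm)"
    "rho3 \<in> extensional (points Gm)"
    unfolding rho1_def rho2_def rho3_def by (rule restrict_extensional)+
  have "rho1 \<in> real_structures Gm"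
    by (rule real_structure_if_equivariant_iso[OF variety_hyperbola
        equivariant_iso_Gm_cong_right[OF equivariant_iso_hyperbola rho_eq_line_anti(1)]])
      (simp_all add: ext)
  moreover have "rho2 \<in> real_structures Gm"
    by (rule real_structure_if_equivariant_iso[OF variety_conic
        equivariant_iso_Gm_cong_right[OF e(1) rho_eq_line_anti(2)]])
      (simp_all add: ext)
  moreover have "rho3 \<in> real_structures Gm"
    by (rule real_structure_if_equivariant_iso[OF variety_conic
        equivariant_iso_Gm_cong_right[OF e(2) rho_eq_line_anti(3)]])
      (simp_all add: ext)
  ultimately show ?thesis by simp
qed

lemma line_anti_normal_form:
  assumes "a \<noteq> 0" "\<And>x. x \<noteq> 0 \<Longrightarrow> line_anti a n (line_anti a n [x]) = [x]"
  shows "n = 1 \<and> equivariant_iso Gm (line_anti a n) Gm (line_anti 1 1) \<or>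
    n = - 1 \<and> equivariant_iso Gm (line_anti a n) Gm (line_anti 1 (- 1)) \<or>
    n = - 1 \<and> equivariant_iso Gm (line_anti a n) Gm (line_anti (- 1) (- 1))"
  using line_anti_involution[OF assms]
proof
  assume "n = 1 \<and> norm a = 1"
  then show ?thesis using normal_form_plus by simp
next
  assume n: "n = - 1 \<and> a \<in> \<real>"
  then obtain r where r: "a = complex_of_real r" by (auto elim: Reals_cases)
  then have "r > 0 \<or> r < 0" using assms(1) by auto
  then show ?thesis using n r normal_form_minus_pos normal_form_minus_neg by auto
qed

lemma real_structure_Gm_cases:
  assumes "\<rho> \<in> real_structures Gm"
  shows "\<exists>\<rho>'\<in>{rho1, rho2, rho3}. equivariant_iso Gm \<rho> Gm \<rho>'"
proof -
  have anti: "anti_regular_map Gm Gm \<rho>" and inv: "\<forall>x\<in>points Gm. \<rho> (\<rho> x) = x"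
    using assms unfolding real_structures_def by blast+
  obtain a n where a: "a \<noteq> 0" "\<And>x. x \<noteq> 0 \<Longrightarrow> \<rho> [x] = [a * cnj x powi n]"
    by (rule anti_regular_map_Gm_eq[OF anti]) blast
  have eq: "\<rho> u = line_anti a n u" if "u \<in> points Gm" for u
    using that a(2) by (auto simp: Gm_mem)
  have "line_anti a n (line_anti a n [x]) = [x]" if "x \<noteq> 0" for x
  proof -
    have x: "[x] \<in> points Gm" using that by (simp add: Gm_mem)
    show ?thesis
      using bspec[OF inv x] eq[OF x] eq[OF real_structures_mem[OF assms x]] by simp
  qed
  then have "equivariant_iso Gm (line_anti a n) Gm (line_anti 1 1) \<or>
      equivariant_iso Gm (line_anti a n) Gm (line_anti 1 (- 1)) \<or>
      equivariant_iso Gm (line_anti a n) Gm (line_anti (- 1) (- 1))"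
    using line_anti_normal_form[OF a(1)] by blast
  then have "\<exists>\<rho>'\<in>{rho1, rho2, rho3}. equivariant_iso Gm (line_anti a n) Gm \<rho>'"
    using equivariant_iso_rho(1,3,5) equivariant_iso_trans by blast
  moreover have "equivariant_iso Gm \<rho> Gm (line_anti a n)"
    by (rule equivariant_iso_if_eq[OF eq])
  ultimately show ?thesis using equivariant_iso_trans by blast
qed

text \<open>An equivalence is \<open>x \<mapsto> c x\<^sup>k\<close>.  Comparison of the values at 1 and 2 gives
  \<open>2\<^sup>k = 2\<^sup>-\<^sup>k\<close>, so \<open>k = 0\<close> and the map would be constant.\<close>

lemma line_anti_exponents:
  assumes "a \<noteq> 0" "b \<noteq> 0"
  shows "\<not> equivariant_iso Gm (line_anti a 1) Gm (line_anti b (- 1))"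
proof
  assume "equivariant_iso Gm (line_anti a 1) Gm (line_anti b (- 1))"
  then obtain \<phi> \<psi> where "equivariant_pair Gm (line_anti a 1) Gm (line_anti b (- 1)) \<phi> \<psi>"
    by (rule equivariant_isoE)
  note 1 = equivariant_pairD[OF this]
  obtain c k where c: "c \<noteq> 0" "\<And>x. x \<noteq> 0 \<Longrightarrow> \<phi> [x] = [c * x powi k]"
    by (rule regular_map_Gm_eq[OF 1(1)]) blast
  have eq: "c * (a * cnj x) powi k = b * cnj (c * x powi k) powi - 1" if "x \<noteq> 0" for x
  proof -
    have "[x] \<in> points Gm" using that by (simp add: Gm_mem)
    from 1(7)[OF this] show ?thesis using c that assms by simp
  qed
  have 11: "c * a powi k = b * inverse (cnj c)" using eq[of 1] by (simp add: power_int_minus)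
  have "(c * a powi k) * 2 powi k = (b * inverse (cnj c)) * 2 powi (- k)"
    using eq[of 2] by (simp add: power_int_mult_distrib power_int_minus mult_ac)
  then have "(2 :: complex) powi k = 2 powi (- k)"
    unfolding 11 using assms c(1) by simp
  then have "k = - k" by (rule two_powi_inj)
  then have "k = 0" by simp
  then have "\<phi> [1] = \<phi> [2]" using c(2) by simp
  then have "[1] = [2 :: complex]" using 1(3)[of "[1]"] 1(3)[of "[2]"] by (simp add: Gm_mem)
  then show False by simp
qed

lemma line_anti_fixed_points:
  "\<exists>u\<in>points Gm. line_anti 1 n u = u"
  "u \<in> points Gm \<Longrightarrow> line_anti (- 1) (- 1) u \<noteq> u"
proof -
  show "\<exists>u\<in>points Gm. line_anti 1 n u = u" by (rule bexI[of _ "[1]"]) (simp_all add: Gm_mem)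
  show "line_anti (- 1) (- 1) u \<noteq> u" if "u \<in> points Gm"
  proof
    assume u: "line_anti (- 1) (- 1) u = u"
    obtain x where x: "u = [x]" "x \<noteq> 0" using \<open>u \<in> points Gm\<close> by (auto simp: Gm_mem)
    then have "x = - inverse (cnj x)" using u by (simp add: power_int_minus)
    then have "x * cnj x = - 1" using x by (simp add: field_simps)
    then have "complex_of_real ((norm x)\<^sup>2) = complex_of_real (- 1)" unfolding complex_norm_square by simp
    then have "(norm x)\<^sup>2 = - 1" using of_real_eq_iff by blast
    then show False by (metis neg_0_le_iff_le not_one_le_zero zero_le_power2)
  qed
qed

lemma rho_inequivalent:
  "\<not> equivariant_iso Gm rho1 Gm rho2" "\<not> equivariant_iso Gm rho1 Gm rho3"
  "\<not> equivariant_iso Gm rho2 Gm rho3"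
proof -
  show "\<not> equivariant_iso Gm rho1 Gm rho2"
    using line_anti_exponents[of 1 1] equivariant_iso_trans[OF equivariant_iso_rho(1)]
      equivariant_iso_trans[OF _ equivariant_iso_rho(4)] by auto
  show "\<not> equivariant_iso Gm rho1 Gm rho3"
    using line_anti_exponents[of 1 "- 1"] equivariant_iso_trans[OF equivariant_iso_rho(1)]
      equivariant_iso_trans[OF _ equivariant_iso_rho(6)] by auto
  show "\<not> equivariant_iso Gm rho2 Gm rho3"
  proof
    assume "equivariant_iso Gm rho2 Gm rho3"
    then have "equivariant_iso Gm (line_anti 1 (- 1)) Gm (line_anti (- 1) (- 1))"
      using equivariant_iso_trans[OF equivariant_iso_rho(3)] equivariant_iso_trans[OF _ equivariant_iso_rho(6)]
      by blast
    then show False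
      using equivariant_iso_fixed_point[OF _ line_anti_fixed_points(1)] line_anti_fixed_points(2) by blast
  qed
qed

lemma real_structure_classes_Gm:
  "real_structures Gm // real_structure_equiv Gm =
    {real_structure_equiv Gm `` {rho1}, real_structure_equiv Gm `` {rho2}, real_structure_equiv Gm `` {rho3}}"
  "card (real_structures Gm // real_structure_equiv Gm) = 3"
proof -
  let ?R = "real_structure_equiv Gm" and ?A = "real_structures Gm"
  note eqv = equiv_real_structures[of Gm]
  have mem: "rho1 \<in> ?A" "rho2 \<in> ?A" "rho3 \<in> ?A" using rho_real_structures by auto
  show *: "?A // ?R = {?R `` {rho1}, ?R `` {rho2}, ?R `` {rho3}}"
  proof (intro equalityI subsetI)
    fix C assume "C \<in> ?A // ?R"
    then obtain \<rho> where \<rho>: "\<rho> \<in> ?A" "C = ?R `` {\<rho>}" by (auto elim: quotientE)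
    obtain \<rho>' where \<rho>': "\<rho>' \<in> {rho1, rho2, rho3}" "equivariant_iso Gm \<rho> Gm \<rho>'"
      using real_structure_Gm_cases[OF \<rho>(1)] by blast
    then have "(\<rho>', \<rho>) \<in> ?R" unfolding real_structure_equiv_iff using \<rho>(1) mem by blast
    then have "?R `` {\<rho>'} = C" unfolding \<rho>(2) by (rule equiv_class_eq[OF eqv])
    then show "C \<in> {?R `` {rho1}, ?R `` {rho2}, ?R `` {rho3}}" using \<rho>'(1) by blast
  next
    fix C assume "C \<in> {?R `` {rho1}, ?R `` {rho2}, ?R `` {rho3}}"
    then show "C \<in> ?A // ?R" by (elim insertE emptyE) (simp_all only: quotientI mem)
  qed
  have "(rho2, rho1) \<notin> ?R" "(rho3, rho1) \<notin> ?R" "(rho3, rho2) \<notin> ?R"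
    unfolding real_structure_equiv_iff using rho_inequivalent by blast+
  then have d: "?R `` {rho2} \<noteq> ?R `` {rho1}" "?R `` {rho3} \<noteq> ?R `` {rho1}" "?R `` {rho3} \<noteq> ?R `` {rho2}"
    using eq_equiv_class_iff[OF eqv mem(2,1)] eq_equiv_class_iff[OF eqv mem(3,1)]
      eq_equiv_class_iff[OF eqv mem(3,2)] by simp_all
  have c: "card {x, y, z} = 3" if "y \<noteq> x" "z \<noteq> x" "z \<noteq> y" for x y z :: "(complex list \<Rightarrow> complex list) set"
    using that by auto
  show "card (?A // ?R) = 3" unfolding * by (rule c[OF d])
qed

subsection \<open>Real parts of the conics\<close>

lemma plane_real_part_emb:
  assumes "variety \<real> {emb 2 Z}"
  shows "plane_real_part {emb 2 Z} = {(a, b). [complex_of_real a, complex_of_real b] \<in> Z}"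
  using conj_point_emb[OF assms] by (auto simp: plane_real_part_def real_points_def)

lemma plane_real_part_hyperbola: "plane_real_part {hyperbola} = {(a, b). a * b = 1}"
proof -
  have "complex_of_real a * complex_of_real b - 1 = 0 \<longleftrightarrow> a * b = 1" for a b
    by (simp flip: of_real_mult)
  then show ?thesis
    using plane_real_part_emb variety_hyperbola by (simp add: hyperbola_def)
qed

lemma plane_real_part_circle: "plane_real_part {conic_curve 1} = sphere 0 1"
proof -
  have "complex_of_real a ^ 2 + complex_of_real b ^ 2 - 1 = 0 \<longleftrightarrow> a\<^sup>2 + b\<^sup>2 = 1" for a b
    by (simp flip: of_real_power of_real_add)
  then have "plane_real_part {conic_curve 1} = {(a, b). a\<^sup>2 + b\<^sup>2 = 1}"
    using plane_real_part_emb variety_conic[of 1] by (simp add: conic_curve_def)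
  then show ?thesis by (auto simp: norm_Pair)
qed

lemma real_points_empty_conic: "real_points {conic_curve (- 1)} = {}"
proof -
  have "conj_point {conic_curve (- 1)} p \<noteq> p" if "p \<in> points {conic_curve (- 1)}" for p
  proof
    assume "conj_point {conic_curve (- 1)} p = p"
    then have "line_anti (- 1) (- 1) [p ! 0 + \<i> * p ! 1] = [p ! 0 + \<i> * p ! 1]"
      using conic_iso(2)[of "- 1" p] that by simp
    moreover have "[p ! 0 + \<i> * p ! 1] \<in> points Gm"
      using conic_iso(1)[of "- 1"] that unfolding isomorphism_def by (auto dest: regular_map_mem)
    ultimately show False using line_anti_fixed_points(2) by blast
  qed
  then show ?thesis by (auto simp: real_points_def)
qed

lemma Ck_on_cong:
  assumes "open U" "Ck_on k f U" "\<And>x. x \<in> U \<Longrightarrow> f x = g x"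
  shows "Ck_on k g U"
  using assms(2,3)
proof (induction k arbitrary: f g)
  case 0
  then show ?case using continuous_on_cong[OF refl, of U f g] by simp
next
  case (Suc k)
  have d: "f differentiable (at x)" if "x \<in> U" for x using Suc.prems(1) that by simp
  have "g differentiable (at x)" if "x \<in> U" for x
  proof -
    have "(f has_derivative frechet_derivative f (at x)) (at x)"
      using d[OF that] frechet_derivative_works by blast
    then have "(g has_derivative frechet_derivative f (at x)) (at x)"
      by (rule has_derivative_transform_within_open[OF _ assms(1) that]) (rule Suc.prems(2))
    then show ?thesis unfolding differentiable_def by blast
  qed
  moreover have "Ck_on k (\<lambda>x. frechet_derivative g (at x) v) U" for v
  proof (rule Suc.IH)
    show "Ck_on k (\<lambda>x. frechet_derivative f (at x) v) U" using Suc.prems(1) by simp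
    show "frechet_derivative f (at x) v = frechet_derivative g (at x) v" if "x \<in> U" for x
      by (rule fun_cong[OF frechet_derivative_transform_within_open[OF d[OF that] assms(1) that]])
        (rule Suc.prems(2))
  qed
  ultimately show ?case by simp
qed

lemma Ck_on_const: "Ck_on k (\<lambda>x. c) U"
  by (induction k arbitrary: c) auto

lemma Ck_on_bounded_linear:
  assumes "bounded_linear f"
  shows "Ck_on k f U"
proof (cases k)
  case 0
  then show ?thesis using assms by (simp add: linear_continuous_on)
next
  case (Suc l)
  have "(f has_derivative f) (at x)" for x by (rule bounded_linear_imp_has_derivative[OF assms])
  then have "frechet_derivative f (at x) = f" "f differentiable (at x)" for x
    using frechet_derivative_at unfolding differentiable_def by metis+
  then show ?thesis using Suc by (simp add: Ck_on_const)
qed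

lemma smooth_map_on_bounded_linear: "bounded_linear f \<Longrightarrow> smooth_map_on S f"
  unfolding smooth_map_on_def using Ck_on_bounded_linear open_UNIV by blast

text \<open>Pairs of an affine function and a multiple of a power of the inverse are closed under
  derivatives, which makes the induction on the order of differentiability work.\<close>

lemma Ck_on_graph_of_inverse:
  fixes c d e :: real
  shows "Ck_on k (\<lambda>t. (c + d * t, e * inverse t ^ m)) (- {0})"
proof (induction k arbitrary: c d e m)
  case 0
  show ?case by (auto intro!: continuous_intros)
next
  case (Suc k)
  let ?f = "\<lambda>t :: real. (c + d * t, e * inverse t ^ m)"
  have der: "(?f has_derivative (\<lambda>v. (d * v, - (e * m) * inverse t ^ Suc m * v))) (at t)"
    if t: "t \<noteq> 0" for t
  proof (rule has_derivative_Pair)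
    show "((\<lambda>t. c + d * t) has_derivative (\<lambda>v. d * v)) (at t)"
      by (auto intro!: derivative_eq_intros)
    have "((\<lambda>t. e * inverse t ^ m) has_real_derivative
        e * (real m * (- (inverse t ^ Suc (Suc 0)) * inverse t ^ (m - Suc 0)))) (at t)"
      by (rule DERIV_cmult[OF DERIV_power[OF DERIV_inverse[OF t]]])
    also have "e * (real m * (- (inverse t ^ Suc (Suc 0)) * inverse t ^ (m - Suc 0))) =
        - (e * m) * inverse t ^ Suc m"
      by (cases m) (simp_all add: mult_ac)
    finally have "((\<lambda>t. e * inverse t ^ m) has_real_derivative - (e * m) * inverse t ^ Suc m) (at t)" .
    then show "((\<lambda>t. e * inverse t ^ m) has_derivative (\<lambda>v. - (e * m) * inverse t ^ Suc m * v)) (at t)"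
      by (rule has_field_derivative_imp_has_derivative)
  qed
  have "?f differentiable (at t)" if "t \<in> - {0}" for t
    using der[of t] that unfolding differentiable_def by blast
  moreover have "Ck_on k (\<lambda>t. frechet_derivative ?f (at t) v) (- {0})" for v
  proof (rule Ck_on_cong)
    show "Ck_on k (\<lambda>t. (d * v + 0 * t, (- (e * m) * v) * inverse t ^ Suc m)) (- {0})" by (rule Suc)
    show "(d * v + 0 * t, (- (e * m) * v) * inverse t ^ Suc m) = frechet_derivative ?f (at t) v"
      if "t \<in> - {0}" for t
      using fun_cong[OF frechet_derivative_at[OF der[of t]], of v] that by (simp add: mult_ac)
  qed (rule open_Compl[OF closed_singleton])
  ultimately show ?case by simp
qed

lemma diffeomorphic_hyperbola: "diffeomorphic (plane_real_part {hyperbola}) (- {0 :: real})"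
  unfolding diffeomorphic_def
proof (intro exI[of _ fst] exI[of _ "\<lambda>t :: real. (t, inverse t)"] conjI)
  show "smooth_map_on (plane_real_part {hyperbola}) fst"
    by (rule smooth_map_on_bounded_linear[OF bounded_linear_fst])
  have "Ck_on k (\<lambda>t :: real. (t, inverse t)) (- {0})" for k
    using Ck_on_graph_of_inverse[of k 0 1 1 1] by simp
  then show "smooth_map_on (- {0 :: real}) (\<lambda>t. (t, inverse t))"
    unfolding smooth_map_on_def by (intro ballI exI[of _ "- {0 :: real}"] exI[of _ "\<lambda>t. (t, inverse t)"])
      (auto intro: open_Compl[OF closed_singleton])
qed (auto simp: plane_real_part_hyperbola inverse_unique)

lemma diffeomorphic_circle: "diffeomorphic (plane_real_part {conic_curve 1}) (sphere (0 :: real \<times> real) 1)"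
  unfolding diffeomorphic_def plane_real_part_circle
  by (intro exI[of _ "\<lambda>x. x"] conjI smooth_map_on_bounded_linear bounded_linear_ident) auto

section \<open>Involutions in the integral linear group\<close>

lemma primitive_fixed_row:
  fixes p q r s :: int
  assumes "a\<^sub>0 \<noteq> 0 \<or> b\<^sub>0 \<noteq> 0" "a\<^sub>0 * p + b\<^sub>0 * r = a\<^sub>0" "a\<^sub>0 * q + b\<^sub>0 * s = b\<^sub>0"
  shows "\<exists>a b c d. a * d - b * c = 1 \<and> a * p + b * r = a \<and> a * q + b * s = b"
proof -
  define g where "g = gcd a\<^sub>0 b\<^sub>0"
  have g: "g \<noteq> 0" using assms(1) by (simp add: g_def)
  obtain a b where ab: "a\<^sub>0 = g * a" "b\<^sub>0 = g * b" unfolding g_def by (meson dvdE gcd_dvd1 gcd_dvd2)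
  obtain u v where "u * a\<^sub>0 + v * b\<^sub>0 = g" using bezout_int[of a\<^sub>0 b\<^sub>0] unfolding g_def by blast
  then have "g * (u * a + v * b) = g * 1" using ab by (simp add: algebra_simps)
  then have "u * a + v * b = 1" unfolding mult_left_cancel[OF g] .
  then have bez: "a * u - b * (- v) = 1" by (simp add: algebra_simps)
  have "g * (a * p + b * r) = g * a" "g * (a * q + b * s) = g * b"
    using assms(2,3) ab by (simp_all add: algebra_simps)
  then have "a * p + b * r = a" "a * q + b * s = b" using g by simp_all
  then show ?thesis using bez by blast
qed

text \<open>An involution other than \<open>\<plusminus> 1\<close> has trace 0 and determinant \<open>- 1\<close>, hence a
  primitive fixed row vector \<open>v\<close>.  Completing \<open>v\<close> to a basis \<open>(v, w)\<close>, the image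
  of \<open>w\<close> is \<open>k v - w\<close>, and replacing \<open>w\<close> by \<open>w + j v\<close> changes
  \<open>k\<close> by \<open>2 j\<close>.  For \<open>k = 0\<close> the matrix becomes diagonal; for \<open>k = 1\<close>
  it exchanges \<open>w\<close> and \<open>v - w\<close>.\<close>

lemma integral_involution_normal_form:
  fixes p q r s :: int
  assumes M: "p * p + q * r = 1" "p * q + q * s = 0" "r * p + s * r = 0" "r * q + s * s = 1"
  shows "\<exists>a b c d n\<^sub>1 n\<^sub>2 n\<^sub>3 n\<^sub>4. \<bar>a * d - b * c\<bar> = 1 \<and>
    (n\<^sub>1, n\<^sub>2, n\<^sub>3, n\<^sub>4) \<in> {(1, 0, 0, 1), (1, 0, 0, - 1), (- 1, 0, 0, - 1), (0, 1, 1, 0)} \<and>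
    a * p + b * r = n\<^sub>1 * a + n\<^sub>2 * c \<and> a * q + b * s = n\<^sub>1 * b + n\<^sub>2 * d \<and>
    c * p + d * r = n\<^sub>3 * a + n\<^sub>4 * c \<and> c * q + d * s = n\<^sub>3 * b + n\<^sub>4 * d"
proof -
  have wit: ?thesis if "\<bar>a * d - b * c\<bar> = 1"
    "(n\<^sub>1, n\<^sub>2, n\<^sub>3, n\<^sub>4) \<in> {(1, 0, 0, 1), (1, 0, 0, - 1), (- 1, 0, 0, - 1), (0, 1, 1, 0)}"
    "a * p + b * r = n\<^sub>1 * a + n\<^sub>2 * c" "a * q + b * s = n\<^sub>1 * b + n\<^sub>2 * d"
    "c * p + d * r = n\<^sub>3 * a + n\<^sub>4 * c" "c * q + d * s = n\<^sub>3 * b + n\<^sub>4 * d"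
    for a b c d n\<^sub>1 n\<^sub>2 n\<^sub>3 n\<^sub>4
    using that by blast
  show ?thesis
  proof (cases "p + s = 0")
    case False
    have "q * (p + s) = 0" "r * (p + s) = 0" using M(2,3) by (simp_all add: algebra_simps)
    then have qr: "q = 0" "r = 0" using False by simp_all
    then have "p * p = 1" "s * s = 1" using M(1,4) by simp_all
    then have "(p = 1 \<and> s = 1) \<or> (p = - 1 \<and> s = - 1)" using False by (auto simp: zmult_eq_1_iff)
    then show ?thesis
    proof
      assume "p = 1 \<and> s = 1"
      then show ?thesis using qr
        by (intro wit[of 1 1 0 0 1 0 0 1]) auto
    next
      assume "p = - 1 \<and> s = - 1"
      then show ?thesis using qr
        by (intro wit[of 1 1 0 0 "- 1" 0 0 "- 1"]) auto
    qed
  next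
    case True
    then have s: "s = - p" by simp
    have "\<exists>a\<^sub>0 b\<^sub>0. (a\<^sub>0 \<noteq> 0 \<or> b\<^sub>0 \<noteq> 0) \<and> a\<^sub>0 * p + b\<^sub>0 * r = a\<^sub>0 \<and> a\<^sub>0 * q + b\<^sub>0 * s = b\<^sub>0"
    proof (cases "p + 1 = 0")
      case False
      then show ?thesis using M s
        by (intro exI[of _ "p + 1"] exI[of _ q]) (simp add: algebra_simps)
    next
      case True
      then show ?thesis using M s
        by (intro exI[of _ r] exI[of _ "1 - p"]) (simp add: algebra_simps)
    qed
    then obtain a b c d where v: "a * d - b * c = 1" "a * p + b * r = a" "a * q + b * s = b"
      using primitive_fixed_row[of _ _ p r q s] by metis
    define z1 z2 where "z1 = c * p + d * r + c" and "z2 = c * q + d * s + d"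
    define k where "k = z1 * d - z2 * c"
    have par: "a * z2 = b * z1"
    proof -
      have "a * z2 - b * z1 = c * (a * q - b * p - b) + d * (a * s + a - b * r)"
        by (simp add: z1_def z2_def algebra_simps)
      also have "\<dots> = 0" using v(2,3) s by (simp add: algebra_simps)
      finally show ?thesis by simp
    qed
    have "a * k = z1 * (a * d) - (a * z2) * c" by (simp add: k_def algebra_simps)
    also have "\<dots> = z1 * (a * d - b * c)" unfolding par by (simp add: algebra_simps)
    finally have z1: "z1 = k * a" using v(1) by (simp add: mult.commute)
    have "b * k = (b * z1) * d - z2 * (b * c)" by (simp add: k_def algebra_simps)
    also have "\<dots> = z2 * (a * d - b * c)" unfolding par[symmetric] by (simp add: algebra_simps)
    finally have z2: "z2 = k * b" using v(1) by (simp add: mult.commute)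
    have w: "c * p + d * r = k * a - c" "c * q + d * s = k * b - d"
      using z1 z2 unfolding z1_def z2_def by simp_all
    show ?thesis
    proof (cases "even k")
      case True
      then obtain j where k: "k = 2 * j" by blast
      have "(c - j * a) * p + (d - j * b) * r = (c * p + d * r) - j * (a * p + b * r)"
        "(c - j * a) * q + (d - j * b) * s = (c * q + d * s) - j * (a * q + b * s)"
        by (simp_all add: algebra_simps)
      then have e: "(c - j * a) * p + (d - j * b) * r = - (c - j * a)"
        "(c - j * a) * q + (d - j * b) * s = - (d - j * b)"
        unfolding w v(2,3) k by (simp_all add: algebra_simps)
      have "a * (d - j * b) - b * (c - j * a) = 1" using v(1) by (simp add: algebra_simps)
      then show ?thesis using v(2,3) e
        by (intro wit[of a "d - j * b" b "c - j * a" 1 0 0 "- 1"]) simp_all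
    next
      case False
      then obtain j where k: "k = 2 * j + 1" using oddE by blast
      have "(c - j * a) * p + (d - j * b) * r = (c * p + d * r) - j * (a * p + b * r)"
        "(c - j * a) * q + (d - j * b) * s = (c * q + d * s) - j * (a * q + b * s)"
        by (simp_all add: algebra_simps)
      then have e: "(c - j * a) * p + (d - j * b) * r = a - (c - j * a)"
        "(c - j * a) * q + (d - j * b) * s = b - (d - j * b)"
        unfolding w v(2,3) k by (simp_all add: algebra_simps)
      have "(a - (c - j * a)) * p + (b - (d - j * b)) * r = (a * p + b * r) - ((c - j * a) * p + (d - j * b) * r)"
        "(a - (c - j * a)) * q + (b - (d - j * b)) * s = (a * q + b * s) - ((c - j * a) * q + (d - j * b) * s)"
        by (simp_all add: algebra_simps)
      then have f: "(a - (c - j * a)) * p + (b - (d - j * b)) * r = c - j * a"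
        "(a - (c - j * a)) * q + (b - (d - j * b)) * s = d - j * b"
        unfolding e v(2,3) by simp_all
      have "(c - j * a) * (b - (d - j * b)) - (d - j * b) * (a - (c - j * a)) = - 1"
        using v(1) by (simp add: algebra_simps)
      then show ?thesis using e f
        by (intro wit[of "c - j * a" "b - (d - j * b)" "d - j * b" "a - (c - j * a)" 0 1 1 0]) simp_all
    qed
  qed
qed

section \<open>Real structures on the torus\<close>

definition torus_anti :: "complex \<Rightarrow> complex \<Rightarrow> int \<Rightarrow> int \<Rightarrow> int \<Rightarrow> int \<Rightarrow>
    complex list \<times> complex list \<Rightarrow> complex list \<times> complex list" where
  "torus_anti a b p q r s w = mono_map a b p q r s (conj_pair w)"

lemma torus_anti_simp:
  "torus_anti a b p q r s ([x], [y]) = mono_map a b p q r s ([cnj x], [cnj y])"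
  by (simp add: torus_anti_def)

lemma torus_anti_mem: "a \<noteq> 0 \<Longrightarrow> b \<noteq> 0 \<Longrightarrow> w \<in> points Gm2 \<Longrightarrow> torus_anti a b p q r s w \<in> points Gm2"
  by (auto simp: torus_anti_simp)

lemma torus_anti_involution:
  assumes "a \<noteq> 0" "b \<noteq> 0" "\<And>w. w \<in> points Gm2 \<Longrightarrow> torus_anti a b p q r s (torus_anti a b p q r s w) = w"
  shows "p * p + q * r = 1 \<and> p * q + q * s = 0 \<and> r * p + s * r = 0 \<and> r * q + s * s = 1 \<and>
    a * cnj a powi p * cnj b powi q = 1 \<and> b * cnj a powi r * cnj b powi s = 1"
proof -
  have "mono_map 1 1 1 0 0 1 ([x], [y]) = mono_map (a * cnj a powi p * cnj b powi q) (b * cnj a powi r * cnj b powi s)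
      (p * p + q * r) (p * q + q * s) (r * p + s * r) (r * q + s * s) ([x], [y])"
    if xy: "x \<noteq> 0" "y \<noteq> 0" for x y
  proof -
    have "torus_anti a b p q r s (torus_anti a b p q r s ([x], [y])) =
        mono_map a b p q r s (mono_map (cnj a) (cnj b) p q r s ([x], [y]))"
      by (simp add: torus_anti_def)
    also have "\<dots> = mono_map (a * cnj a powi p * cnj b powi q) (b * cnj a powi r * cnj b powi s)
      (p * p + q * r) (p * q + q * s) (r * p + s * r) (r * q + s * s) ([x], [y])"
      by (rule mono_map_comp) (use xy assms(1,2) in simp_all)
    finally show ?thesis using assms(3)[of "([x], [y])"] xy by simp
  qed
  from mono_map_inject[OF this] show ?thesis by simp
qed

text \<open>The last four hypotheses say \<open>P M = N P\<close> for the exponent matrices \<open>M\<close> of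
  the given structure, \<open>P\<close> of the change of coordinates and \<open>N\<close> of the resulting
  structure.\<close>

lemma torus_anti_conjugate:
  assumes "a \<noteq> 0" "b \<noteq> 0" "\<bar>A * D - B * C\<bar> = 1"
    and "A * p + B * r = n\<^sub>1 * A + n\<^sub>2 * C" "A * q + B * s = n\<^sub>1 * B + n\<^sub>2 * D"
    and "C * p + D * r = n\<^sub>3 * A + n\<^sub>4 * C" "C * q + D * s = n\<^sub>3 * B + n\<^sub>4 * D"
  shows "equivariant_iso Gm2 (torus_anti a b p q r s)
    Gm2 (torus_anti (a powi A * b powi B) (a powi C * b powi D) n\<^sub>1 n\<^sub>2 n\<^sub>3 n\<^sub>4)"
proof -
  have one: "(1 :: complex) \<noteq> 0" by simp
  obtain a' b' p' q' r' s' where inv: "a' \<noteq> 0" "b' \<noteq> 0"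
    "\<And>w. w \<in> points Gm2 \<Longrightarrow> mono_map a' b' p' q' r' s' (mono_map 1 1 A B C D w) = w"
    "\<And>w. w \<in> points Gm2 \<Longrightarrow> mono_map 1 1 A B C D (mono_map a' b' p' q' r' s' w) = w"
    by (rule mono_map_inverse[OF one one assms(3)]) blast
  show ?thesis
  proof (rule equivariant_isoI[OF regular_map_mono_map[OF one one] regular_map_mono_map[OF inv(1,2)] inv(3,4)])
    fix w assume "w \<in> points Gm2"
    then obtain x y where w: "x \<noteq> 0" "y \<noteq> 0" "w = ([x], [y])" unfolding Gm2_mem by blast
    have xy: "cnj x \<noteq> 0" "cnj y \<noteq> 0" using w by simp_all
    have "mono_map 1 1 A B C D (torus_anti a b p q r s w) = mono_map (a powi A * b powi B) (a powi C * b powi D)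
        (A * p + B * r) (A * q + B * s) (C * p + D * r) (C * q + D * s) ([cnj x], [cnj y])"
      unfolding w(3) torus_anti_simp mono_map_comp[OF xy assms(1,2)] by simp
    also have "\<dots> = mono_map (a powi A * b powi B) (a powi C * b powi D) n\<^sub>1 n\<^sub>2 n\<^sub>3 n\<^sub>4
        (mono_map 1 1 A B C D ([cnj x], [cnj y]))"
      unfolding mono_map_comp[OF xy one one] assms(4-7) by simp
    also have "\<dots> = torus_anti (a powi A * b powi B) (a powi C * b powi D) n\<^sub>1 n\<^sub>2 n\<^sub>3 n\<^sub>4 (mono_map 1 1 A B C D w)"
      unfolding w(3) torus_anti_def conj_pair_mono_map by simp
    finally show "mono_map 1 1 A B C D (torus_anti a b p q r s w) =
      torus_anti (a powi A * b powi B) (a powi C * b powi D) n\<^sub>1 n\<^sub>2 n\<^sub>3 n\<^sub>4 (mono_map 1 1 A B C D w)" .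
  qed
qed

text \<open>The isomorphism is a monomial map.  Its exponent matrix is invertible over the integers
  because the inverse is a monomial map, too, and equivariance compares the exponents on both sides.\<close>

lemma torus_anti_equivariant_iso_exponents:
  assumes nz: "a \<noteq> 0" "b \<noteq> 0" "a' \<noteq> 0" "b' \<noteq> 0"
    and "equivariant_iso Gm2 (torus_anti a b p q r s) Gm2 (torus_anti a' b' p' q' r' s')"
  obtains A B C D where "\<bar>A * D - B * C\<bar> = 1"
    "A * p + B * r = p' * A + q' * C" "A * q + B * s = p' * B + q' * D"
    "C * p + D * r = r' * A + s' * C" "C * q + D * s = r' * B + s' * D"
proof -
  obtain \<phi> \<psi> where "equivariant_pair Gm2 (torus_anti a b p q r s) Gm2 (torus_anti a' b' p' q' r' s') \<phi> \<psi>"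
    by (rule equivariant_isoE[OF assms(5)])
  note 1 = equivariant_pairD[OF this]
  obtain c d A B C D where \<phi>: "c \<noteq> 0" "d \<noteq> 0" "\<And>w. w \<in> points Gm2 \<Longrightarrow> \<phi> w = mono_map c d A B C D w"
    by (rule regular_map_Gm2_eq_mono_map[OF 1(1)]) blast
  obtain c' d' A' B' C' D' where \<psi>: "c' \<noteq> 0" "d' \<noteq> 0" "\<And>w. w \<in> points Gm2 \<Longrightarrow> \<psi> w = mono_map c' d' A' B' C' D' w"
    by (rule regular_map_Gm2_eq_mono_map[OF 1(2)]) blast
  have pt: "([x], [y]) \<in> points Gm2" if "x \<noteq> 0" "y \<noteq> 0" for x y :: complex using that by simp
  have "mono_map 1 1 1 0 0 1 ([x], [y]) = mono_map (c' * c powi A' * d powi B') (d' * c powi C' * d powi D')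
      (A' * A + B' * C) (A' * B + B' * D) (C' * A + D' * C) (C' * B + D' * D) ([x], [y])"
    if xy: "x \<noteq> 0" "y \<noteq> 0" for x y
    unfolding mono_map_comp[OF xy \<phi>(1,2), symmetric] \<phi>(3)[OF pt[OF xy], symmetric]
      \<psi>(3)[OF 1(5)[OF pt[OF xy]], symmetric] 1(3)[OF pt[OF xy]] by (rule mono_map_one)
  from mono_map_inject[OF this] have inv: "A' * A + B' * C = 1" "A' * B + B' * D = 0" "C' * A + D' * C = 0"
    "C' * B + D' * D = 1" by simp_all
  have "(A' * D' - B' * C') * (A * D - B * C) =
      (A' * A + B' * C) * (C' * B + D' * D) - (A' * B + B' * D) * (C' * A + D' * C)"
    by (simp add: algebra_simps)
  also have "\<dots> = 1" unfolding inv by simp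
  finally have det: "\<bar>A * D - B * C\<bar> = 1" by (auto simp: zmult_eq_1_iff)
  have "mono_map (c * a powi A * b powi B) (d * a powi C * b powi D)
        (A * p + B * r) (A * q + B * s) (C * p + D * r) (C * q + D * s) ([x], [y]) =
      mono_map (a' * cnj c powi p' * cnj d powi q') (b' * cnj c powi r' * cnj d powi s')
        (p' * A + q' * C) (p' * B + q' * D) (r' * A + s' * C) (r' * B + s' * D) ([x], [y])"
    if xy: "x \<noteq> 0" "y \<noteq> 0" for x y
  proof -
    let ?w = "([cnj x], [cnj y])"
    have w: "?w \<in> points Gm2" using xy by simp
    have cd: "cnj c \<noteq> 0" "cnj d \<noteq> 0" using \<phi>(1,2) by simp_all
    have "mono_map (c * a powi A * b powi B) (d * a powi C * b powi D)
        (A * p + B * r) (A * q + B * s) (C * p + D * r) (C * q + D * s) ([x], [y]) =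
        mono_map c d A B C D (torus_anti a b p q r s ?w)"
      unfolding torus_anti_simp complex_cnj_cnj mono_map_comp[OF xy nz(1,2)] ..
    also have "\<dots> = torus_anti a' b' p' q' r' s' (mono_map c d A B C D ?w)"
      using 1(7)[OF w] \<phi>(3)[OF w] \<phi>(3)[OF torus_anti_mem[OF nz(1,2) w]] by simp
    also have "\<dots> = mono_map a' b' p' q' r' s' (mono_map (cnj c) (cnj d) A B C D ([x], [y]))"
      unfolding torus_anti_def conj_pair_mono_map complex_cnj_cnj ..
    also have "\<dots> = mono_map (a' * cnj c powi p' * cnj d powi q') (b' * cnj c powi r' * cnj d powi s')
        (p' * A + q' * C) (p' * B + q' * D) (r' * A + s' * C) (r' * B + s' * D) ([x], [y])"
      by (rule mono_map_comp[OF xy cd])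
    finally show ?thesis .
  qed
  from mono_map_inject[OF this] nz \<phi>(1,2) show thesis by (intro that[OF det]) simp_all
qed

lemma equivariant_iso_involution:
  assumes "equivariant_iso X \<sigma> Y \<tau>" "\<And>x. x \<in> points X \<Longrightarrow> \<sigma> x \<in> points X" "\<And>x. x \<in> points X \<Longrightarrow> \<sigma> (\<sigma> x) = x"
    and y: "y \<in> points Y"
  shows "\<tau> (\<tau> y) = y"
proof -
  obtain \<phi> \<psi> where "equivariant_pair X \<sigma> Y \<tau> \<phi> \<psi>" by (rule equivariant_isoE[OF assms(1)])
  note 1 = equivariant_pairD[OF this]
  show ?thesis
    using 1(7)[OF 1(6)[OF y]] 1(7)[OF assms(2)[OF 1(6)[OF y]]] assms(3)[OF 1(6)[OF y]] 1(4)[OF y] by simp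
qed

lemma torus_anti_diagonal:
  "w \<in> points Gm2 \<Longrightarrow> torus_anti a b m 0 0 n w = map_prod (line_anti a m) (line_anti b n) w"
  by (auto simp: torus_anti_simp)

lemma equivariant_iso_map_prod_line_anti:
  assumes "equivariant_iso Gm (line_anti a m) Gm (line_anti c m)" "equivariant_iso Gm (line_anti b n) Gm (line_anti d n)"
  shows "equivariant_iso Gm2 (torus_anti a b m 0 0 n) Gm2 (torus_anti c d m 0 0 n)"
proof -
  have "equivariant_iso Gm2 (map_prod (line_anti a m) (line_anti b n)) Gm2 (map_prod (line_anti c m) (line_anti d n))"
    by (rule equivariant_iso_prod[OF inj_Gm_chart affine_Gm_chart inj_Gm_chart affine_Gm_chart
      inj_Gm_chart affine_Gm_chart inj_Gm_chart affine_Gm_chart assms[unfolded Gm_eq]])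
  then show ?thesis by (rule equivariant_iso_cong) (simp_all add: torus_anti_diagonal del: points_single)
qed

text \<open>The new second coordinate is \<open>y\<close> times the conjugate of \<open>a\<close>.\<close>

lemma torus_anti_swap_normal_form:
  assumes "a * cnj b = 1"
  shows "equivariant_iso Gm2 (torus_anti a b 0 1 1 0) Gm2 (torus_anti 1 1 0 1 1 0)"
proof -
  have a: "a \<noteq> 0" "cnj a \<noteq> 0" using assms by auto
  have "cnj (a * cnj b) = 1" using assms by simp
  then have ab: "cnj a * b = 1" by simp
  have one: "(1 :: complex) \<noteq> 0" by simp
  have det: "\<bar>1 * 1 - 0 * 0 :: int\<bar> = 1" by simp
  obtain a' b' p' q' r' s' where inv: "a' \<noteq> 0" "b' \<noteq> 0"
    "\<And>w. w \<in> points Gm2 \<Longrightarrow> mono_map a' b' p' q' r' s' (mono_map 1 (cnj a) 1 0 0 1 w) = w"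
    "\<And>w. w \<in> points Gm2 \<Longrightarrow> mono_map 1 (cnj a) 1 0 0 1 (mono_map a' b' p' q' r' s' w) = w"
    by (rule mono_map_inverse[OF one a(2) det]) blast
  show ?thesis
  proof (rule equivariant_isoI[OF regular_map_mono_map[OF one a(2)] regular_map_mono_map[OF inv(1,2)] inv(3,4)])
    fix w assume "w \<in> points Gm2"
    then obtain x y where w: "x \<noteq> 0" "y \<noteq> 0" "w = ([x], [y])" unfolding Gm2_mem by blast
    have "cnj a * (b * cnj x) = cnj x" using ab by (simp flip: mult.assoc)
    then show "mono_map 1 (cnj a) 1 0 0 1 (torus_anti a b 0 1 1 0 w) =
        torus_anti 1 1 0 1 1 0 (mono_map 1 (cnj a) 1 0 0 1 w)"
      unfolding w(3) by (simp add: torus_anti_def)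
  qed
qed

text \<open>For the exponent matrix \<open>- 1\<close> the mixed signs \<open>(1, - 1)\<close> and
  \<open>(- 1, 1)\<close> are missing since they reduce to \<open>(- 1, - 1)\<close> by the coordinate
  changes \<open>(x y, y)\<close> and \<open>(x, x y)\<close>.\<close>

definition torus_normal_forms :: "(complex list \<times> complex list \<Rightarrow> complex list \<times> complex list) set" where
  "torus_normal_forms = {torus_anti 1 1 1 0 0 1, torus_anti 1 1 1 0 0 (- 1), torus_anti 1 (- 1) 1 0 0 (- 1),
     torus_anti 1 1 (- 1) 0 0 (- 1), torus_anti (- 1) (- 1) (- 1) 0 0 (- 1), torus_anti 1 1 0 1 1 0}"

lemma torus_anti_mixed_signs:
  "equivariant_iso Gm2 (torus_anti 1 (- 1) (- 1) 0 0 (- 1)) Gm2 (torus_anti (- 1) (- 1) (- 1) 0 0 (- 1))"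
  "equivariant_iso Gm2 (torus_anti (- 1) 1 (- 1) 0 0 (- 1)) Gm2 (torus_anti (- 1) (- 1) (- 1) 0 0 (- 1))"
  using torus_anti_conjugate[of 1 "- 1" 1 1 1 0 "- 1" 0 "- 1" 0 0 "- 1" 0 "- 1"]
    torus_anti_conjugate[of "- 1" 1 1 1 0 1 "- 1" 0 "- 1" 0 0 "- 1" 0 "- 1"] by simp_all

lemma torus_anti_diagonal_normal_form:
  assumes nz: "a \<noteq> 0" "b \<noteq> 0" and mn: "(m, n) \<in> {(1, 1), (1, - 1), (- 1, - 1)}"
    and inv: "\<And>w. w \<in> points Gm2 \<Longrightarrow> torus_anti a b m 0 0 n (torus_anti a b m 0 0 n w) = w"
  shows "\<exists>\<tau>\<in>torus_normal_forms. equivariant_iso Gm2 (torus_anti a b m 0 0 n) Gm2 \<tau>"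
proof -
  have "line_anti a m (line_anti a m [x]) = [x] \<and> line_anti b n (line_anti b n [x]) = [x]" if "x \<noteq> 0" for x
    using inv[of "([x], [x])"] that nz by (simp add: torus_anti_def)
  then have 1: "\<And>x. x \<noteq> 0 \<Longrightarrow> line_anti a m (line_anti a m [x]) = [x]"
    and 2: "\<And>x. x \<noteq> 0 \<Longrightarrow> line_anti b n (line_anti b n [x]) = [x]" by blast+
  have "\<exists>c d. equivariant_iso Gm (line_anti a m) Gm (line_anti c m) \<and>
      equivariant_iso Gm (line_anti b n) Gm (line_anti d n) \<and>
      (m = 1 \<and> c = 1 \<or> m = - 1 \<and> c = 1 \<or> m = - 1 \<and> c = - 1) \<and>
      (n = 1 \<and> d = 1 \<or> n = - 1 \<and> d = 1 \<or> n = - 1 \<and> d = - 1)"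
    using line_anti_normal_form[OF nz(1) 1] line_anti_normal_form[OF nz(2) 2] by blast
  then obtain c d where cd: "equivariant_iso Gm2 (torus_anti a b m 0 0 n) Gm2 (torus_anti c d m 0 0 n)"
    "m = 1 \<and> c = 1 \<or> m = - 1 \<and> c = 1 \<or> m = - 1 \<and> c = - 1"
    "n = 1 \<and> d = 1 \<or> n = - 1 \<and> d = 1 \<or> n = - 1 \<and> d = - 1"
    using equivariant_iso_map_prod_line_anti by blast
  then have "torus_anti c d m 0 0 n \<in> torus_normal_forms \<or>
      torus_anti c d m 0 0 n \<in> {torus_anti 1 (- 1) (- 1) 0 0 (- 1), torus_anti (- 1) 1 (- 1) 0 0 (- 1)}"
    using mn unfolding torus_normal_forms_def by auto
  then have "\<exists>\<tau>\<in>torus_normal_forms. equivariant_iso Gm2 (torus_anti c d m 0 0 n) Gm2 \<tau>"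
  proof
    assume "torus_anti c d m 0 0 n \<in> torus_normal_forms"
    then show ?thesis using equivariant_iso_refl by blast
  next
    assume "torus_anti c d m 0 0 n \<in> {torus_anti 1 (- 1) (- 1) 0 0 (- 1), torus_anti (- 1) 1 (- 1) 0 0 (- 1)}"
    then have "equivariant_iso Gm2 (torus_anti c d m 0 0 n) Gm2 (torus_anti (- 1) (- 1) (- 1) 0 0 (- 1))"
      using torus_anti_mixed_signs by auto
    then show ?thesis unfolding torus_normal_forms_def by blast
  qed
  then show ?thesis using equivariant_iso_trans[OF cd(1)] by blast
qed

text \<open>The exponent matrix of an involution is an involution.  Once it is in normal form, only the two
  constants remain to be normalised.\<close>

lemma torus_real_structure_normal_form:
  assumes anti: "anti_regular_map Gm2 Gm2 \<rho>" and inv: "\<And>w. w \<in> points Gm2 \<Longrightarrow> \<rho> (\<rho> w) = w"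
  shows "\<exists>\<tau>\<in>torus_normal_forms. equivariant_iso Gm2 \<rho> Gm2 \<tau>"
proof -
  obtain a b p q r s where nz: "a \<noteq> 0" "b \<noteq> 0"
    and eq: "\<And>w. w \<in> points Gm2 \<Longrightarrow> \<rho> w = mono_map a b p q r s (conj_pair w)"
    by (rule anti_regular_map_Gm2_eq_mono_map[OF anti]) blast
  have eq': "\<rho> w = torus_anti a b p q r s w" if "w \<in> points Gm2" for w
    using eq[OF that] by (simp add: torus_anti_def)
  have inv': "torus_anti a b p q r s (torus_anti a b p q r s w) = w" if w: "w \<in> points Gm2" for w
    using inv[OF w] eq'[OF w] eq'[OF anti_regular_map_mem[OF anti w]] by simp
  have 0: "equivariant_iso Gm2 \<rho> Gm2 (torus_anti a b p q r s)" by (rule equivariant_iso_if_eq[OF eq'])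
  have M: "p * p + q * r = 1" "p * q + q * s = 0" "r * p + s * r = 0" "r * q + s * s = 1"
    using torus_anti_involution[OF nz inv'] by simp_all
  obtain A B C D n\<^sub>1 n\<^sub>2 n\<^sub>3 n\<^sub>4 where P: "\<bar>A * D - B * C\<bar> = 1"
    "A * p + B * r = n\<^sub>1 * A + n\<^sub>2 * C" "A * q + B * s = n\<^sub>1 * B + n\<^sub>2 * D"
    "C * p + D * r = n\<^sub>3 * A + n\<^sub>4 * C" "C * q + D * s = n\<^sub>3 * B + n\<^sub>4 * D"
    and N: "(n\<^sub>1, n\<^sub>2, n\<^sub>3, n\<^sub>4) \<in> {(1, 0, 0, 1), (1, 0, 0, - 1), (- 1, 0, 0, - 1), (0, 1, 1, 0)}"
    using integral_involution_normal_form[OF M] by blast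
  define a' b' where "a' = a powi A * b powi B" and "b' = a powi C * b powi D"
  have nz': "a' \<noteq> 0" "b' \<noteq> 0" using nz by (simp_all add: a'_def b'_def)
  have 1: "equivariant_iso Gm2 (torus_anti a b p q r s) Gm2 (torus_anti a' b' n\<^sub>1 n\<^sub>2 n\<^sub>3 n\<^sub>4)"
    unfolding a'_def b'_def by (rule torus_anti_conjugate[OF nz P])
  have invN: "torus_anti a' b' n\<^sub>1 n\<^sub>2 n\<^sub>3 n\<^sub>4 (torus_anti a' b' n\<^sub>1 n\<^sub>2 n\<^sub>3 n\<^sub>4 w) = w" if "w \<in> points Gm2" for w
    by (rule equivariant_iso_involution[OF 1 torus_anti_mem[OF nz] inv' that])
  have "\<exists>\<tau>\<in>torus_normal_forms. equivariant_iso Gm2 (torus_anti a' b' n\<^sub>1 n\<^sub>2 n\<^sub>3 n\<^sub>4) Gm2 \<tau>"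
  proof (cases "n\<^sub>2 = 0")
    case True
    then have n3: "n\<^sub>3 = 0" and mn: "(n\<^sub>1, n\<^sub>4) \<in> {(1, 1), (1, - 1), (- 1, - 1)}" using N by auto
    show ?thesis
      using torus_anti_diagonal_normal_form[OF nz' mn] invN unfolding True n3 by blast
  next
    case False
    then have n: "n\<^sub>1 = 0" "n\<^sub>2 = 1" "n\<^sub>3 = 1" "n\<^sub>4 = 0" using N by auto
    have "a' * cnj b' = 1" using torus_anti_involution[OF nz' invN] unfolding n by simp
    then show ?thesis
      using torus_anti_swap_normal_form unfolding n torus_normal_forms_def by blast
  qed
  then show ?thesis using equivariant_iso_trans[OF 0 equivariant_iso_trans[OF 1]] by blast
qed

text \<open>A matrix \<open>P\<close> that intertwines two different normal forms is singular by the linear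
  equations for its entries, except that between \<open>diag (1, - 1)\<close> and the exchange it has the
  rows \<open>(A, B)\<close> and \<open>(A, - B)\<close> and hence an even determinant.\<close>

lemma torus_anti_exponents_inequivalent:
  assumes nz: "a \<noteq> 0" "b \<noteq> 0" "a' \<noteq> 0" "b' \<noteq> 0"
  shows "\<not> equivariant_iso Gm2 (torus_anti a b 1 0 0 1) Gm2 (torus_anti a' b' 1 0 0 (- 1))"
    "\<not> equivariant_iso Gm2 (torus_anti a b 1 0 0 1) Gm2 (torus_anti a' b' (- 1) 0 0 (- 1))"
    "\<not> equivariant_iso Gm2 (torus_anti a b 1 0 0 1) Gm2 (torus_anti a' b' 0 1 1 0)"
    "\<not> equivariant_iso Gm2 (torus_anti a b 1 0 0 (- 1)) Gm2 (torus_anti a' b' (- 1) 0 0 (- 1))"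
    "\<not> equivariant_iso Gm2 (torus_anti a b 1 0 0 (- 1)) Gm2 (torus_anti a' b' 0 1 1 0)"
    "\<not> equivariant_iso Gm2 (torus_anti a b (- 1) 0 0 (- 1)) Gm2 (torus_anti a' b' 0 1 1 0)"
proof -
  show "\<not> equivariant_iso Gm2 (torus_anti a b 1 0 0 1) Gm2 (torus_anti a' b' 1 0 0 (- 1))"
    "\<not> equivariant_iso Gm2 (torus_anti a b 1 0 0 1) Gm2 (torus_anti a' b' (- 1) 0 0 (- 1))"
    "\<not> equivariant_iso Gm2 (torus_anti a b 1 0 0 1) Gm2 (torus_anti a' b' 0 1 1 0)"
    "\<not> equivariant_iso Gm2 (torus_anti a b 1 0 0 (- 1)) Gm2 (torus_anti a' b' (- 1) 0 0 (- 1))"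
    by (rule notI, erule torus_anti_equivariant_iso_exponents[OF nz], simp)+
  show "\<not> equivariant_iso Gm2 (torus_anti a b 1 0 0 (- 1)) Gm2 (torus_anti a' b' 0 1 1 0)"
  proof
    assume "equivariant_iso Gm2 (torus_anti a b 1 0 0 (- 1)) Gm2 (torus_anti a' b' 0 1 1 0)"
    then obtain A B C D :: int where det: "\<bar>A * D - B * C\<bar> = 1" and CD: "A = C" "- B = D"
      by (rule torus_anti_equivariant_iso_exponents[OF nz]) simp
    have "A * D - B * C = 2 * (- (A * B))" unfolding CD(1)[symmetric] CD(2)[symmetric] by simp
    then show False using det by presburger
  qed
  show "\<not> equivariant_iso Gm2 (torus_anti a b (- 1) 0 0 (- 1)) Gm2 (torus_anti a' b' 0 1 1 0)"
  proof
    assume "equivariant_iso Gm2 (torus_anti a b (- 1) 0 0 (- 1)) Gm2 (torus_anti a' b' 0 1 1 0)"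
    then obtain A B C D :: int where det: "\<bar>A * D - B * C\<bar> = 1" and CD: "- A = C" "- B = D"
      by (rule torus_anti_equivariant_iso_exponents[OF nz]) simp
    show False using det unfolding CD[symmetric] by (simp add: mult.commute)
  qed
qed

lemma torus_anti_fixed_points:
  "\<exists>w\<in>points Gm2. torus_anti 1 1 p q r s w = w"
  "w \<in> points Gm2 \<Longrightarrow> torus_anti a (- 1) m 0 0 (- 1) w \<noteq> w"
proof -
  show "\<exists>w\<in>points Gm2. torus_anti 1 1 p q r s w = w"
    by (rule bexI[of _ "([1], [1])"]) (simp_all add: torus_anti_def)
  show "torus_anti a (- 1) m 0 0 (- 1) w \<noteq> w" if w: "w \<in> points Gm2"
  proof
    assume "torus_anti a (- 1) m 0 0 (- 1) w = w"
    then have "map_prod (line_anti a m) (line_anti (- 1) (- 1)) w = w" using torus_anti_diagonal[OF w] by simp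
    then have "line_anti (- 1) (- 1) (snd w) = snd w" by (metis snd_map_prod)
    moreover have "snd w \<in> points Gm" using w by (auto simp: Gm_mem)
    ultimately show False using line_anti_fixed_points(2) by blast
  qed
qed

text \<open>Fixed points correspond to real points, and only one of the two structures has any.\<close>

lemma torus_anti_sign_inequivalent:
  "\<not> equivariant_iso Gm2 (torus_anti 1 1 p q r s) Gm2 (torus_anti a (- 1) m 0 0 (- 1))"
  using equivariant_iso_fixed_point[OF _ torus_anti_fixed_points(1)] torus_anti_fixed_points(2) by blast

section \<open>Real forms of the torus\<close>

lemma equivariant_iso_curve_prod:
  assumes c: "variety \<real> {c}" and d: "variety \<real> {d}"
    and "equivariant_iso {c} (conj_point {c}) Gm (line_anti a m)"
    and "equivariant_iso {d} (conj_point {d}) Gm (line_anti b n)"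
  shows "equivariant_iso {chart_prod c d} (conj_point {chart_prod c d}) Gm2 (torus_anti a b m 0 0 n)"
proof -
  note vc = variety_chart[OF c singletonI] and vd = variety_chart[OF d singletonI]
  have "equivariant_iso {chart_prod c d} (map_prod (conj_point {c}) (conj_point {d}))
      Gm2 (map_prod (line_anti a m) (line_anti b n))"
    by (rule equivariant_iso_prod[OF vc(1,3) vd(1,3) inj_Gm_chart affine_Gm_chart inj_Gm_chart affine_Gm_chart
      assms(3,4)[unfolded Gm_eq]])
  then show ?thesis
  proof (rule equivariant_iso_cong)
    show "map_prod (conj_point {c}) (conj_point {d}) w = conj_point {chart_prod c d} w"
      if "w \<in> points {chart_prod c d}" for w
      using that conj_point_chart_prod[OF c d] by auto
    show "map_prod (line_anti a m) (line_anti b n) w = torus_anti a b m 0 0 n w" if "w \<in> points Gm2" for w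
      using torus_anti_diagonal[OF that] by simp
  qed
qed

definition plane_chart :: "complex list chart" where
  "plane_chart = emb 2 {[x, y] | x y. x\<^sup>2 + y\<^sup>2 \<noteq> 0}"

lemma punctured_plane_eq: "punctured_plane = {plane_chart}"
  by (simp add: punctured_plane_def embedded_eq plane_chart_def)

lemma variety_plane_chart: "variety \<real> {plane_chart}"
proof -
  have "(\<lambda>p :: complex list. p ! 0 * p ! 0 + p ! 1 * p ! 1) \<in> polys \<real> 2"
    by (intro polys.add polys.mult polys.coord) auto
  from variety_hypersurface_complement[OF this] show ?thesis
    unfolding plane_chart_def affine_plane
    by (rule back_subst[of "\<lambda>Z. variety \<real> {emb 2 Z}"]) (auto simp: power2_eq_square)
qed

text \<open>At the conjugate point, \<open>x + \<i> y\<close> takes the conjugate of the value of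
  \<open>x - \<i> y\<close> and vice versa.\<close>

lemma equivariant_iso_plane:
  "equivariant_iso {plane_chart} (conj_point {plane_chart}) Gm2 (torus_anti 1 1 0 1 1 0)"
proof (rule equivariant_isoI[where \<phi> = "\<lambda>p. ([p ! 0 + \<i> * p ! 1], [p ! 0 + (- \<i>) * p ! 1])" and
    \<psi> = "\<lambda>(u, v). [(u ! 0 + v ! 0) / 2, (u ! 0 + (- 1) * v ! 0) / (2 * \<i>)]"])
  let ?\<phi> = "\<lambda>p. ([p ! 0 + \<i> * p ! 1], [p ! 0 + (- \<i>) * p ! 1])"
  let ?\<psi> = "\<lambda>(u, v). [(u ! 0 + v ! 0) / 2, (u ! 0 + (- 1) * v ! 0) / (2 * \<i>)]"
  let ?Z = "{[x, y] | x y :: complex. x\<^sup>2 + y\<^sup>2 \<noteq> 0}" and ?T = "{[x, y] | x y :: complex. x \<noteq> 0 \<and> y \<noteq> 0}"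
  have fac: "(x + \<i> * y) * (x + (- \<i>) * y) = x\<^sup>2 + y\<^sup>2" for x y
    by (simp add: algebra_simps power2_eq_square)
  have Z: "\<exists>x y. p = [x, y] \<and> x + \<i> * y \<noteq> 0 \<and> x + (- \<i>) * y \<noteq> 0" if "p \<in> points {plane_chart}" for p
  proof -
    obtain x y where p: "p = [x, y]" "x\<^sup>2 + y\<^sup>2 \<noteq> 0" using \<open>p \<in> points {plane_chart}\<close> by (auto simp: plane_chart_def)
    then have "x + \<i> * y \<noteq> 0 \<and> x + (- \<i>) * y \<noteq> 0" using fac[of x y] by (metis mult_zero_left mult_zero_right)
    then show ?thesis using p by blast
  qed
  show "regular_map UNIV {plane_chart} Gm2 ?\<phi>"
  proof (rule regular_map_singleI[OF UNIV_I _ inj_Gm2_chart])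
    show "inj_on (ccoord plane_chart) (cdom plane_chart)" unfolding plane_chart_def by (rule inj_emb)
    show "?\<phi> p \<in> cdom Gm2_chart" if "p \<in> cdom plane_chart" for p
      using Z[of p] that by auto
    fix i assume "i < cdim Gm2_chart"
    then consider (0) "i = 0" | (1) "i = 1" by fastforce
    then have "regular_on UNIV 2 ?Z (\<lambda>p. ccoord Gm2_chart (?\<phi> p) ! i)"
    proof cases
      case 0
      have "regular_on UNIV 2 ?Z (\<lambda>p. p ! 0 + \<i> * p ! 1)"
        by (intro regular_on_add regular_on_mult regular_on_const regular_on_coord) auto
      then show ?thesis using 0 by simp
    next
      case 1
      have "regular_on UNIV 2 ?Z (\<lambda>p. p ! 0 + (- \<i>) * p ! 1)"
        by (intro regular_on_add regular_on_mult regular_on_const regular_on_coord) auto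
      then show ?thesis using 1 by simp
    qed
    then have "regular_on UNIV 2 ?Z (\<lambda>p. ccoord Gm2_chart (?\<phi> (cinv plane_chart p)) ! i)"
      unfolding plane_chart_def by (rule regular_on_eqI) (simp only: cinv_emb)
    then show "regular_on UNIV (cdim plane_chart) (ccoord plane_chart ` cdom plane_chart)
        (\<lambda>p. ccoord Gm2_chart (?\<phi> (cinv plane_chart p)) ! i)"
      by (simp add: plane_chart_def)
  qed
  show "regular_map UNIV Gm2 {plane_chart} ?\<psi>"
  proof (rule regular_map_singleI[OF UNIV_I inj_Gm2_chart])
    show "inj_on (ccoord plane_chart) (cdom plane_chart)" unfolding plane_chart_def by (rule inj_emb)
    show "?\<psi> w \<in> cdom plane_chart" if w: "w \<in> cdom Gm2_chart" for w
    proof -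
      obtain u v where uv: "w = ([u], [v])" "u \<noteq> 0" "v \<noteq> 0" using w by auto
      have "((u + v) / 2)\<^sup>2 + ((u + (- 1) * v) / (2 * \<i>))\<^sup>2 = u * v"
        by (simp add: field_simps power2_eq_square)
      then have "((u + v) / 2)\<^sup>2 + ((u + (- 1) * v) / (2 * \<i>))\<^sup>2 \<noteq> 0" using uv by simp
      moreover have "?\<psi> w = [(u + v) / 2, (u + (- 1) * v) / (2 * \<i>)]" using uv by simp
      ultimately show ?thesis unfolding plane_chart_def emb_sel by blast
    qed
    fix i assume "i < cdim plane_chart"
    then consider (0) "i = 0" | (1) "i = 1" by (fastforce simp: plane_chart_def)
    then have "\<exists>c d. \<forall>u v. ?\<psi> ([u], [v]) ! i = (u + c * v) / d"
    proof cases
      case 0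
      then show ?thesis by (intro exI[of _ 1] exI[of _ 2]) simp
    next
      case 1
      then show ?thesis by (intro exI[of _ "- 1"] exI[of _ "2 * \<i>"]) simp
    qed
    then obtain c d where cd: "\<And>u v. ?\<psi> ([u], [v]) ! i = (u + c * v) / d" by blast
    have "regular_on UNIV 2 ?T (\<lambda>w. (w ! 0 + c * w ! 1) / d)"
      by (intro regular_on_divide_const regular_on_add regular_on_mult regular_on_const regular_on_coord) auto
    then have "regular_on UNIV 2 ?T (\<lambda>w. ccoord plane_chart (?\<psi> (cinv Gm2_chart w)) ! i)"
    proof (rule regular_on_eqI)
      fix w assume "w \<in> ?T"
      then obtain x y where w: "w = [x, y]" "x \<noteq> 0" "y \<noteq> 0" by blast
      show "(w ! 0 + c * w ! 1) / d = ccoord plane_chart (?\<psi> (cinv Gm2_chart w)) ! i"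
        unfolding w(1) cinv_Gm2_chart[OF w(2,3)] plane_chart_def emb_sel cd by simp
    qed
    then show "regular_on UNIV (cdim Gm2_chart)
        (ccoord Gm2_chart ` cdom Gm2_chart)
        (\<lambda>w. ccoord plane_chart (?\<psi> (cinv Gm2_chart w)) ! i)"
      unfolding Gm2_coords by (simp add: numeral_2_eq_2)
  qed
  show "?\<psi> (?\<phi> p) = p" if "p \<in> points {plane_chart}" for p
    using Z[OF that] by (auto simp: field_simps)
  show "?\<phi> (?\<psi> w) = w" if "w \<in> points Gm2" for w
    using that by (auto simp: field_simps)
  show "?\<phi> (conj_point {plane_chart} p) = torus_anti 1 1 0 1 1 0 (?\<phi> p)" if p: "p \<in> points {plane_chart}" for p
  proof -
    obtain x y where xy: "p = [x, y]" using Z[OF p] by blast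
    have "conj_point {plane_chart} p = map cnj p"
      using conj_point_emb variety_plane_chart p unfolding plane_chart_def by simp
    then show ?thesis using xy by (simp add: torus_anti_simp)
  qed
qed

lemma is_real_form_torus:
  assumes "variety \<real> Y" "equivariant_iso Y (conj_point Y) Gm2 \<sigma>"
  shows "is_real_form (variety_prod Gm Gm) Y"
  using assms unfolding is_real_form_def real_form_def equivariant_iso_def Gm_eq variety_prod_single by blast

lemma not_isomorphic_if_inequivalent:
  assumes c: "variety \<real> {c}" "equivariant_iso {c} (conj_point {c}) X \<sigma>"
    and d: "variety \<real> {d}" "equivariant_iso {d} (conj_point {d}) X \<tau>"
    and ne: "\<not> equivariant_iso X \<sigma> X \<tau>"
  shows "\<not> isomorphic \<real> {c} {d} \<and> \<not> isomorphic \<real> {d} {c}"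
proof -
  have "\<not> equivariant_iso {c} (conj_point {c}) {d} (conj_point {d})"
    using ne equivariant_iso_trans[OF equivariant_iso_sym[OF c(2) conj_point_mem[OF c(1)]]]
      equivariant_iso_trans[OF _ d(2)] by blast
  moreover have "equivariant_iso {c} (conj_point {c}) {d} (conj_point {d})" if "isomorphic \<real> {d} {c}"
    by (rule equivariant_iso_sym[OF equivariant_iso_if_isomorphic_real[OF d(1) c(1) that] conj_point_mem[OF d(1)]])
  ultimately show ?thesis using equivariant_iso_if_isomorphic_real[OF c(1) d(1)] by blast
qed

theorem proposition4p2:
  shows
    "(real_structures Gm // real_structure_equiv Gm =
        {real_structure_equiv Gm `` {rho1}, real_structure_equiv Gm `` {rho2},
         real_structure_equiv Gm `` {rho3}}
      \<and> {rho1, rho2, rho3} \<subseteq> real_structures Gm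
      \<and> equiv (real_structures Gm) (real_structure_equiv Gm)
      \<and> card (real_structures Gm // real_structure_equiv Gm) = 3
      \<and> corresponding_real_form Gm rho1 Gamma1
      \<and> corresponding_real_form Gm rho2 Gamma2
      \<and> corresponding_real_form Gm rho3 Gamma3
      \<and> diffeomorphic (plane_real_part Gamma1) (- {0 :: real})
      \<and> diffeomorphic (plane_real_part Gamma2) (sphere (0 :: real \<times> real) 1)
      \<and> real_points Gamma3 = {})
     \<and>
     (let products = [variety_prod Gamma1 Gamma1, variety_prod Gamma1 Gamma2,
           variety_prod Gamma1 Gamma3, variety_prod Gamma2 Gamma2, variety_prod Gamma3 Gamma3]
      in (\<forall>Y\<in>set products. is_real_form (variety_prod Gm Gm) Y)
       \<and> is_real_form (variety_prod Gm Gm) punctured_plane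
       \<and> (\<forall>i<length products. \<forall>j<length products.
            i \<noteq> j \<longrightarrow> \<not> isomorphic \<real> (products ! i) (products ! j))
       \<and> (\<forall>Y\<in>set products. \<not> isomorphic \<real> Y punctured_plane)
       \<and> (\<forall>X0 :: 'a chart set. is_real_form (variety_prod Gm Gm) X0 \<longrightarrow>
            (\<exists>Y\<in>set products. isomorphic \<real> X0 Y) \<or> isomorphic \<real> X0 punctured_plane))
     \<and> isomorphic \<real> (variety_prod Gamma2 Gamma3) (variety_prod Gamma3 Gamma3)"
proof -
  let ?h = hyperbola and ?c = "conic_curve 1" and ?e = "conic_curve (- 1)"
  have vh: "variety \<real> {?h}" by (rule variety_hyperbola)
  have vc: "variety \<real> {?c}" and ve: "variety \<real> {?e}" by (rule variety_conic; simp)+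
  note ih = equivariant_iso_hyperbola
  have ic: "equivariant_iso {?c} (conj_point {?c}) Gm (line_anti 1 (- 1))"
    and ie: "equivariant_iso {?e} (conj_point {?e}) Gm (line_anti (- 1) (- 1))"
    by (rule equivariant_iso_conic; simp)+
  have K: "(1 :: complex) \<in> \<real>" "(- 1 :: complex) \<in> \<real>" by simp_all
  let ?Y1 = "chart_prod ?h ?h" and ?Y2 = "chart_prod ?h ?c" and ?Y3 = "chart_prod ?h ?e"
    and ?Y4 = "chart_prod ?c ?c" and ?Y5 = "chart_prod ?e ?e" and ?Y6 = plane_chart
    and ?Y7 = "chart_prod ?c ?e"
  note v = variety_chart_prod[OF K vh vh] variety_chart_prod[OF K vh vc] variety_chart_prod[OF K vh ve]
    variety_chart_prod[OF K vc vc] variety_chart_prod[OF K ve ve] variety_plane_chart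
    variety_chart_prod[OF K vc ve]
  note i = equivariant_iso_curve_prod[OF vh vh ih ih] equivariant_iso_curve_prod[OF vh vc ih ic]
    equivariant_iso_curve_prod[OF vh ve ih ie] equivariant_iso_curve_prod[OF vc vc ic ic]
    equivariant_iso_curve_prod[OF ve ve ie ie] equivariant_iso_plane
    equivariant_iso_curve_prod[OF vc ve ic ie]
  have P: "variety_prod Gamma1 Gamma1 = {?Y1}" "variety_prod Gamma1 Gamma2 = {?Y2}"
    "variety_prod Gamma1 Gamma3 = {?Y3}" "variety_prod Gamma2 Gamma2 = {?Y4}"
    "variety_prod Gamma3 Gamma3 = {?Y5}" "variety_prod Gamma2 Gamma3 = {?Y7}"
    by (simp_all add: Gamma_eq variety_prod_single)
  note E = torus_anti_exponents_inequivalent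
  note S = torus_anti_sign_inequivalent
  have n: "\<not> isomorphic \<real> {?Y1} {?Y2} \<and> \<not> isomorphic \<real> {?Y2} {?Y1}"
    "\<not> isomorphic \<real> {?Y1} {?Y3} \<and> \<not> isomorphic \<real> {?Y3} {?Y1}"
    "\<not> isomorphic \<real> {?Y1} {?Y4} \<and> \<not> isomorphic \<real> {?Y4} {?Y1}"
    "\<not> isomorphic \<real> {?Y1} {?Y5} \<and> \<not> isomorphic \<real> {?Y5} {?Y1}"
    "\<not> isomorphic \<real> {?Y1} {?Y6} \<and> \<not> isomorphic \<real> {?Y6} {?Y1}"
    "\<not> isomorphic \<real> {?Y2} {?Y3} \<and> \<not> isomorphic \<real> {?Y3} {?Y2}"
    "\<not> isomorphic \<real> {?Y2} {?Y4} \<and> \<not> isomorphic \<real> {?Y4} {?Y2}"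
    "\<not> isomorphic \<real> {?Y2} {?Y5} \<and> \<not> isomorphic \<real> {?Y5} {?Y2}"
    "\<not> isomorphic \<real> {?Y2} {?Y6} \<and> \<not> isomorphic \<real> {?Y6} {?Y2}"
    "\<not> isomorphic \<real> {?Y3} {?Y4} \<and> \<not> isomorphic \<real> {?Y4} {?Y3}"
    "\<not> isomorphic \<real> {?Y3} {?Y5} \<and> \<not> isomorphic \<real> {?Y5} {?Y3}"
    "\<not> isomorphic \<real> {?Y3} {?Y6} \<and> \<not> isomorphic \<real> {?Y6} {?Y3}"
    "\<not> isomorphic \<real> {?Y4} {?Y5} \<and> \<not> isomorphic \<real> {?Y5} {?Y4}"
    "\<not> isomorphic \<real> {?Y4} {?Y6} \<and> \<not> isomorphic \<real> {?Y6} {?Y4}"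
    "\<not> isomorphic \<real> {?Y5} {?Y6} \<and> \<not> isomorphic \<real> {?Y6} {?Y5}"
    by ((rule not_isomorphic_if_inequivalent[OF v(1) i(1) v(2) i(2) E(1)]; simp),
      (rule not_isomorphic_if_inequivalent[OF v(1) i(1) v(3) i(3) E(1)]; simp),
      (rule not_isomorphic_if_inequivalent[OF v(1) i(1) v(4) i(4) E(2)]; simp),
      (rule not_isomorphic_if_inequivalent[OF v(1) i(1) v(5) i(5) E(2)]; simp),
      (rule not_isomorphic_if_inequivalent[OF v(1) i(1) v(6) i(6) E(3)]; simp),
      rule not_isomorphic_if_inequivalent[OF v(2) i(2) v(3) i(3) S],
      (rule not_isomorphic_if_inequivalent[OF v(2) i(2) v(4) i(4) E(4)]; simp),
      (rule not_isomorphic_if_inequivalent[OF v(2) i(2) v(5) i(5) E(4)]; simp),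
      (rule not_isomorphic_if_inequivalent[OF v(2) i(2) v(6) i(6) E(5)]; simp),
      (rule not_isomorphic_if_inequivalent[OF v(3) i(3) v(4) i(4) E(4)]; simp),
      (rule not_isomorphic_if_inequivalent[OF v(3) i(3) v(5) i(5) E(4)]; simp),
      (rule not_isomorphic_if_inequivalent[OF v(3) i(3) v(6) i(6) E(5)]; simp),
      rule not_isomorphic_if_inequivalent[OF v(4) i(4) v(5) i(5) S],
      (rule not_isomorphic_if_inequivalent[OF v(4) i(4) v(6) i(6) E(6)]; simp),
      (rule not_isomorphic_if_inequivalent[OF v(5) i(5) v(6) i(6) E(6)]; simp))
  have all5: "(\<forall>i<5. Q i) \<longleftrightarrow> Q 0 \<and> Q 1 \<and> Q 2 \<and> Q 3 \<and> Q (4 :: nat)" for Q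
    by (simp add: eval_nat_numeral All_less_Suc) blast
  have cover: "(\<exists>Y\<in>{{?Y1}, {?Y2}, {?Y3}, {?Y4}, {?Y5}}. isomorphic \<real> X0 Y) \<or> isomorphic \<real> X0 {?Y6}"
    if X0: "is_real_form (variety_prod Gm Gm) X0" for X0 :: "'a chart set"
  proof -
    obtain \<phi> where vX: "variety \<real> X0" and \<phi>: "isomorphism UNIV X0 Gm2 \<phi>"
      using X0 unfolding is_real_form_def real_form_def Gm_eq variety_prod_single by blast
    obtain \<rho> where \<rho>: "anti_regular_map Gm2 Gm2 \<rho>" "\<And>w. w \<in> points Gm2 \<Longrightarrow> \<rho> (\<rho> w) = w"
      and iX: "equivariant_iso X0 (conj_point X0) Gm2 \<rho>"
      by (rule real_form_transport[OF vX \<phi>]) blast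
    obtain \<tau> where \<tau>: "\<tau> \<in> torus_normal_forms" "equivariant_iso Gm2 \<rho> Gm2 \<tau>"
      using torus_real_structure_normal_form[OF \<rho>] by blast
    have iso: "isomorphic \<real> X0 {d}"
      if d: "variety \<real> {d}" "equivariant_iso {d} (conj_point {d}) Gm2 \<tau>" for d :: "'c chart"
      by (rule isomorphic_real_if_equivariant_iso[OF vX d(1) equivariant_iso_trans[OF iX
        equivariant_iso_trans[OF \<tau>(2) equivariant_iso_sym[OF d(2) conj_point_mem[OF d(1)]]]]])
    from \<tau>(1) consider "\<tau> = torus_anti 1 1 1 0 0 1" | "\<tau> = torus_anti 1 1 1 0 0 (- 1)"
      | "\<tau> = torus_anti 1 (- 1) 1 0 0 (- 1)" | "\<tau> = torus_anti 1 1 (- 1) 0 0 (- 1)"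
      | "\<tau> = torus_anti (- 1) (- 1) (- 1) 0 0 (- 1)" | "\<tau> = torus_anti 1 1 0 1 1 0"
      unfolding torus_normal_forms_def by blast
    then show ?thesis
      by cases (use iso v i in blast)+
  qed
  have mixed: "isomorphic \<real> {?Y7} {?Y5}"
    by (rule isomorphic_real_if_equivariant_iso[OF v(7,5) equivariant_iso_trans[OF i(7)
      equivariant_iso_trans[OF torus_anti_mixed_signs(1) equivariant_iso_sym[OF i(5) conj_point_mem[OF v(5)]]]]])
  show ?thesis
    unfolding Let_def P punctured_plane_eq
  proof (intro conjI)
    show "\<forall>Y\<in>set [{?Y1}, {?Y2}, {?Y3}, {?Y4}, {?Y5}]. is_real_form (variety_prod Gm Gm) Y"
      using is_real_form_torus[OF v(1) i(1)] is_real_form_torus[OF v(2) i(2)] is_real_form_torus[OF v(3) i(3)]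
        is_real_form_torus[OF v(4) i(4)] is_real_form_torus[OF v(5) i(5)] by simp
    show "is_real_form (variety_prod Gm Gm) {?Y6}" by (rule is_real_form_torus[OF v(6) i(6)])
    have "length [{?Y1}, {?Y2}, {?Y3}, {?Y4}, {?Y5}] = 5" by simp
    then show "\<forall>i<length [{?Y1}, {?Y2}, {?Y3}, {?Y4}, {?Y5}]. \<forall>j<length [{?Y1}, {?Y2}, {?Y3}, {?Y4}, {?Y5}].
        i \<noteq> j \<longrightarrow> \<not> isomorphic \<real> ([{?Y1}, {?Y2}, {?Y3}, {?Y4}, {?Y5}] ! i) ([{?Y1}, {?Y2}, {?Y3}, {?Y4}, {?Y5}] ! j)"
      using n by (simp only: all5) simp
    show "\<forall>Y\<in>set [{?Y1}, {?Y2}, {?Y3}, {?Y4}, {?Y5}]. \<not> isomorphic \<real> Y {?Y6}"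
      using n by simp
    show "\<forall>X0 :: 'a chart set. is_real_form (variety_prod Gm Gm) X0 \<longrightarrow>
        (\<exists>Y\<in>set [{?Y1}, {?Y2}, {?Y3}, {?Y4}, {?Y5}]. isomorphic \<real> X0 Y) \<or> isomorphic \<real> X0 {?Y6}"
      using cover by simp
    show "isomorphic \<real> {?Y7} {?Y5}" by (rule mixed)
    show "diffeomorphic (plane_real_part Gamma1) (- {0 :: real})"
      "diffeomorphic (plane_real_part Gamma2) (sphere (0 :: real \<times> real) 1)" "real_points Gamma3 = {}"
      unfolding Gamma_eq by (rule diffeomorphic_hyperbola diffeomorphic_circle real_points_empty_conic)+
  qed (rule real_structure_classes_Gm rho_real_structures equiv_real_structures corresponding_real_forms_Gm)+
qed

end
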